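(* Let $(\mathcal{X},\rho,\mu)$ be a space of homogeneous type satisfying the weak reverse doubling (WRD) condition. Let $0<q\le p<\infty$ and let $Y(\mathcal{X})$ be a ball quasi-Banach function space such that $Y^{\frac1p}(\mathcal{X})$ is a ball Banach function space and the Hardy--Littlewood maximal operator $\mathcal{M}$ is endpoint bounded on $[Y^{\frac1p}(\mathcal{X})]'$, that is, there exists a sequence $\{\theta_m\}_{m\in\mathbb{N}}$ in $(0,1)$ with $\lim_{m\to\infty}\theta_m=1$ such that, for any $m\in\mathbb{N}$, $Y^{\frac1{p\theta_m}}(\mathcal{X})$ is a ball Banach function space, $\mathcal{M}$ is bounded on $[Y^{\frac1{p\theta_m}}(\mathcal{X})]'$, and $\lim_{m\to\infty}\|\mathcal{M}\|_{[Y^{\frac1{p\theta_m}}(\mathcal{X})]'\to[Y^{\frac1{p\theta_m}}(\mathcal{X})]'}<\infty$. Then there exist two positive constants $C$ and $\widetilde{C}$, independent of $f$, such that the following hold. (i) Let $\beta\in(0,\infty)$. For any $f\in C^\beta_{\mathrm b}(\mathcal{X})\cap\bigcup_{s\in(0,1)}\dot{W}^{s,q}_Y(\mathcal{X})$, $$C\|f\|_{Y(\mathcal{X})}\le\liminf_{s\to0^+}s^{\frac1q}\left\|\left\{\int_{\mathcal{X}}\frac{|f(\cdot)-f(y)|^q}{U(\cdot,y)[\rho(\cdot,y)]^{sq}}\,d\mu(y)\right\}^{\frac1q}\right\|_{Y(\mathcal{X})}\le\limsup_{s\to0^+}s^{\frac1q}\left\|\left\{\int_{\mathcal{X}}\frac{|f(\cdot)-f(y)|^q}{U(\cdot,y)[\rho(\cdot,y)]^{sq}}\,d\mu(y)\right\}^{\frac1q}\right\|_{Y(\mathcal{X})}\le\widetilde{C}\|f\|_{Y(\mathcal{X})}.$$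 (ii) If $Y(\mathcal{X})$ has an absolutely continuous quasi-norm and $\mu$ is Borel-semiregular, then, for any $f\in[Y(\mathcal{X})/\mathbb{R}]\cap\bigcup_{s\in(0,1)}\dot{W}^{s,q}_Y(\mathcal{X})$, the same chain of inequalities holds with $\|f\|_{Y(\mathcal{X})}$ at both ends replaced by $\|f\|_{Y(\mathcal{X})/\mathbb{R}}$.
   Context: A quasi-metric on a nonempty set $\mathcal{X}$ is $\rho:\mathcal{X}\times\mathcal{X}\to[0,\infty)$ with $\rho(x,y)=0$ iff $x=y$, $\rho(x,y)=\rho(y,x)$, and $\rho(x,z)\le K_0[\rho(x,y)+\rho(y,z)]$ for some constant $K_0\in[1,\infty)$. Balls: $B(x,r):=\{y:\rho(x,y)<r\}$. $(\mathcal{X},\rho,\mu)$ is a space of homogeneous type if $\rho$ is a quasi-metric, $\mu$ is a nonnegative measure on a $\sigma$-algebra containing all balls, and there is $L_{(\mu)}\in[1,\infty)$ with $0<\mu(B(x,2r))\le L_{(\mu)}\mu(B(x,r))<\infty$ for all $x\in\mathcal{X}$, $r\in(0,\infty)$. WRD condition: there exist $x_0\in\mathcal{X}$ and $\lambda,C_{(\mu)}\in(1,\infty)$ with $\liminf_{r\to\infty}\frac{\mu(B(x_0,\lambda r))}{\mu(B(x_0,r))}\ge C_{(\mu)}$. $\mu$ is Borel-semiregular if it is a Borel measure on $\mathcal{X}$ and for every measurable $E\subseteq\mathcal{X}$ there is a Borel set $F$ with $\mu(E\setminus F)+\mu(F\setminus E)=0$. Put $U(x,y):=\min\{\mu(B(x,\rho(x,y))),\mu(B(y,\rho(x,y)))\}$.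 The integrand $|f(x)-f(y)|^q/(U(x,y)[\rho(x,y)]^{sq})$ is read as $0$ at $y=x$. $\mathscr{M}(\mathcal{X})$ is the set of $\mu$-measurable functions. A ball quasi-Banach function space $Y(\mathcal{X})$ is a quasi-Banach space of functions in $\mathscr{M}(\mathcal{X})$ whose quasi-norm makes sense (with values in $[0,\infty]$) for all $f\in\mathscr{M}(\mathcal{X})$, such that: (i) $\|f\|_{Y(\mathcal{X})}=0$ implies $f=0$ $\mu$-a.e.; (ii) $|g|\le|f|$ $\mu$-a.e. implies $\|g\|_{Y(\mathcal{X})}\le\|f\|_{Y(\mathcal{X})}$; (iii) $0\le f_m\uparrow f$ $\mu$-a.e. implies $\|f_m\|_{Y(\mathcal{X})}\uparrow\|f\|_{Y(\mathcal{X})}$; (iv) $\mathbf{1}_B\in Y(\mathcal{X})$ for every ball $B$. It is a ball Banach function space if moreover (v) the triangle inequality holds and (vi) for each ball $B$ there is $C_{(B)}\in(0,\infty)$ with $\int_B|f|\,d\mu\le C_{(B)}\|f\|_{Y(\mathcal{X})}$ for all $f\in Y(\mathcal{X})$. For $t\in(0,\infty)$, $Y^t(\mathcal{X}):=\{f\in\mathscr{M}(\mathcal{X}):|f|^t\in Y(\mathcal{X})\}$ with $\|f\|_{Y^t(\mathcal{X})}:=\||f|^t\|_{Y(\mathcal{X})}^{1/t}$. For a ball Banach function space $Z(\mathcal{X})$, $[Z(\mathcal{X})]':=\{f\in\mathscr{M}(\mathcal{X}):\|f\|_{[Z(\mathcal{X})]'}:=\sup_{\|g\|_{Z(\mathcal{X})}\le1}\|fg\|_{L^1(\mathcal{X})}<\infty\}$.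 $\mathcal{M}f(x):=\sup_{B\ni x}\frac1{\mu(B)}\int_B|f|\,d\mu$, supremum over all balls containing $x$; $\|\mathcal{M}\|_{Z\to Z}$ is its operator norm. $Y(\mathcal{X})$ has an absolutely continuous quasi-norm if $\|f\mathbf{1}_{E_j}\|_{Y(\mathcal{X})}\to0$ whenever $f\in Y(\mathcal{X})$ and $\{E_j\}$ are measurable sets with $\mathbf{1}_{E_j}\to0$ $\mu$-a.e. $C^\beta_{\mathrm b}(\mathcal{X})$: complex-valued functions $f$ on $\mathcal{X}$ with bounded support $\{f\ne0\}$ and $\sup_{x\ne y}|f(x)-f(y)|/[\rho(x,y)]^\beta<\infty$. $\dot W^{s,q}_Y(\mathcal{X})$: all $f\in\mathscr{M}(\mathcal{X})$ with $\big\|\{\int_{\mathcal{X}}\frac{|f(\cdot)-f(y)|^q}{U(\cdot,y)[\rho(\cdot,y)]^{sq}}d\mu(y)\}^{1/q}\big\|_{Y(\mathcal{X})}<\infty$. $Y(\mathcal{X})/\mathbb{R}$: (classes modulo additive real constants of) measurable $f$ with $\|f\|_{Y(\mathcal{X})/\mathbb{R}}:=\inf_{a\in\mathbb{R}}\|f+a\|_{Y(\mathcal{X})}<\infty$. $s\to0^+$ means $s\in(0,1)$, $s\to0$. *)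

theory Defs
  imports "HOL-Analysis.Analysis"
begin

section \<open>Spaces of homogeneous type\<close>

definition quasi_metric :: "'a set \<Rightarrow> ('a \<Rightarrow> 'a \<Rightarrow> real) \<Rightarrow> bool" where
  "quasi_metric X \<rho> \<longleftrightarrow>
     X \<noteq> {} \<and>
     (\<forall>x\<in>X. \<forall>y\<in>X. 0 \<le> \<rho> x y) \<and>
     (\<forall>x\<in>X. \<forall>y\<in>X. \<rho> x y = 0 \<longleftrightarrow> x = y) \<and>
     (\<forall>x\<in>X. \<forall>y\<in>X. \<rho> x y = \<rho> y x) \<and>
     (\<exists>K\<^sub>0\<ge>1. \<forall>x\<in>X. \<forall>y\<in>X. \<forall>z\<in>X. \<rho> x z \<le> K\<^sub>0 * (\<rho> x y + \<rho> y z))"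

definition qball :: "'a set \<Rightarrow> ('a \<Rightarrow> 'a \<Rightarrow> real) \<Rightarrow> 'a \<Rightarrow> real \<Rightarrow> 'a set" where
  "qball X \<rho> x r = {y\<in>X. \<rho> x y < r}"

text \<open>The underlying set of the space is \<^term>\<open>space M\<close>; functions are only relevant there.\<close>

definition homogeneous_type :: "'a measure \<Rightarrow> ('a \<Rightarrow> 'a \<Rightarrow> real) \<Rightarrow> bool" where
  "homogeneous_type M \<rho> \<longleftrightarrow>
     quasi_metric (space M) \<rho> \<and>
     (\<forall>x\<in>space M. \<forall>r>0. qball (space M) \<rho> x r \<in> sets M) \<and>
     (\<exists>L::real. 1 \<le> L \<and> (\<forall>x\<in>space M. \<forall>r>0.
        0 < emeasure M (qball (space M) \<rho> x (2 * r)) \<and>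
        emeasure M (qball (space M) \<rho> x (2 * r)) \<le> ennreal L * emeasure M (qball (space M) \<rho> x r) \<and>
        ennreal L * emeasure M (qball (space M) \<rho> x r) < \<infinity>))"

definition weak_reverse_doubling :: "'a measure \<Rightarrow> ('a \<Rightarrow> 'a \<Rightarrow> real) \<Rightarrow> bool" where
  "weak_reverse_doubling M \<rho> \<longleftrightarrow>
     (\<exists>x\<^sub>0\<in>space M. \<exists>a::real. \<exists>C::real. 1 < a \<and> 1 < C \<and>
        ennreal C \<le> Liminf at_top (\<lambda>r::real.
          emeasure M (qball (space M) \<rho> x\<^sub>0 (a * r)) / emeasure M (qball (space M) \<rho> x\<^sub>0 r)))"

definition qopen :: "'a set \<Rightarrow> ('a \<Rightarrow> 'a \<Rightarrow> real) \<Rightarrow> 'a set \<Rightarrow> bool" where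
  "qopen X \<rho> G \<longleftrightarrow> G \<subseteq> X \<and> (\<forall>x\<in>G. \<exists>r>0. qball X \<rho> x r \<subseteq> G)"

definition qborel_sets :: "'a set \<Rightarrow> ('a \<Rightarrow> 'a \<Rightarrow> real) \<Rightarrow> 'a set set" where
  "qborel_sets X \<rho> = sigma_sets X {G. qopen X \<rho> G}"

definition borel_semiregular :: "'a measure \<Rightarrow> ('a \<Rightarrow> 'a \<Rightarrow> real) \<Rightarrow> bool" where
  "borel_semiregular M \<rho> \<longleftrightarrow>
     qborel_sets (space M) \<rho> \<subseteq> sets M \<and>
     (\<forall>E\<in>sets M. \<exists>F\<in>qborel_sets (space M) \<rho>. emeasure M (E - F) + emeasure M (F - E) = 0)"

definition qU :: "'a measure \<Rightarrow> ('a \<Rightarrow> 'a \<Rightarrow> real) \<Rightarrow> 'a \<Rightarrow> 'a \<Rightarrow> ennreal" where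
  "qU M \<rho> x y = min (emeasure M (qball (space M) \<rho> x (\<rho> x y)))
                     (emeasure M (qball (space M) \<rho> y (\<rho> x y)))"

section \<open>Ball (quasi-)Banach function spaces\<close>

text \<open>
  A space of measurable functions is given by its quasi-norm
  \<^term>\<open>N :: ('a \<Rightarrow> complex) \<Rightarrow> ennreal\<close>, of which only the values on
  \<^term>\<open>borel_measurable M\<close> matter.
\<close>

definition fspace :: "'a measure \<Rightarrow> (('a \<Rightarrow> complex) \<Rightarrow> ennreal) \<Rightarrow> ('a \<Rightarrow> complex) set" where
  "fspace M N = {f \<in> borel_measurable M. N f < \<infinity>}"

definition quasi_banach :: "'a measure \<Rightarrow> (('a \<Rightarrow> complex) \<Rightarrow> ennreal) \<Rightarrow> bool" where
  "quasi_banach M N \<longleftrightarrow>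
     (\<forall>f\<in>borel_measurable M. \<forall>c. N (\<lambda>x. c * f x) = ennreal (cmod c) * N f) \<and>
     (\<exists>K::real. 1 \<le> K \<and> (\<forall>f\<in>borel_measurable M. \<forall>g\<in>borel_measurable M.
        N (\<lambda>x. f x + g x) \<le> ennreal K * (N f + N g))) \<and>
     (\<forall>F. (\<forall>n::nat. F n \<in> fspace M N) \<longrightarrow>
        (\<forall>e::real. 0 < e \<longrightarrow> (\<exists>n\<^sub>0. \<forall>m\<ge>n\<^sub>0. \<forall>n\<ge>n\<^sub>0. N (\<lambda>x. F m x - F n x) < ennreal e)) \<longrightarrow>
        (\<exists>f\<in>fspace M N. (\<lambda>n. N (\<lambda>x. F n x - f x)) \<longlonglongrightarrow> 0))"

definition ball_quasi_banach_fs ::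
  "'a measure \<Rightarrow> ('a \<Rightarrow> 'a \<Rightarrow> real) \<Rightarrow> (('a \<Rightarrow> complex) \<Rightarrow> ennreal) \<Rightarrow> bool" where
  "ball_quasi_banach_fs M \<rho> N \<longleftrightarrow>
     quasi_banach M N \<and>
     (\<forall>f\<in>borel_measurable M. N f = 0 \<longrightarrow> (AE x in M. f x = 0)) \<and>
     (\<forall>f\<in>borel_measurable M. \<forall>g\<in>borel_measurable M.
        (AE x in M. cmod (g x) \<le> cmod (f x)) \<longrightarrow> N g \<le> N f) \<and>
     (\<forall>F::nat \<Rightarrow> 'a \<Rightarrow> real. \<forall>f::'a \<Rightarrow> real.
        (\<forall>m. F m \<in> borel_measurable M) \<longrightarrow> f \<in> borel_measurable M \<longrightarrow>
        (AE x in M. (\<forall>m. 0 \<le> F m x) \<and> incseq (\<lambda>m. F m x) \<and> (\<lambda>m. F m x) \<longlonglongrightarrow> f x) \<longrightarrow>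
        incseq (\<lambda>m. N (\<lambda>x. of_real (F m x))) \<and>
        (\<lambda>m. N (\<lambda>x. of_real (F m x))) \<longlonglongrightarrow> N (\<lambda>x. of_real (f x))) \<and>
     (\<forall>x\<in>space M. \<forall>r>0. (indicator (qball (space M) \<rho> x r) :: 'a \<Rightarrow> complex) \<in> fspace M N)"

definition ball_banach_fs ::
  "'a measure \<Rightarrow> ('a \<Rightarrow> 'a \<Rightarrow> real) \<Rightarrow> (('a \<Rightarrow> complex) \<Rightarrow> ennreal) \<Rightarrow> bool" where
  "ball_banach_fs M \<rho> N \<longleftrightarrow>
     ball_quasi_banach_fs M \<rho> N \<and>
     (\<forall>f\<in>borel_measurable M. \<forall>g\<in>borel_measurable M. N (\<lambda>x. f x + g x) \<le> N f + N g) \<and>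
     (\<forall>x\<in>space M. \<forall>r>0. \<exists>C::real. 0 < C \<and> (\<forall>f\<in>fspace M N.
        (\<integral>\<^sup>+y\<in>qball (space M) \<rho> x r. ennreal (cmod (f y)) \<partial>M) \<le> ennreal C * N f))"

text \<open>Powers of extended nonnegative numbers, for exponents \<open>a > 0\<close> only.\<close>

definition epowr :: "ennreal \<Rightarrow> real \<Rightarrow> ennreal" where
  "epowr t a = (if t = \<infinity> then \<infinity> else ennreal (enn2real t powr a))"

text \<open>The quasi-norm of \<open>Y\<^sup>t\<close>, where \<open>N\<close> is the quasi-norm of \<open>Y\<close>.\<close>

definition convexif :: "(('a \<Rightarrow> complex) \<Rightarrow> ennreal) \<Rightarrow> real \<Rightarrow> ('a \<Rightarrow> complex) \<Rightarrow> ennreal" where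
  "convexif N t f = epowr (N (\<lambda>x. of_real (cmod (f x) powr t))) (1 / t)"

definition assoc_norm :: "'a measure \<Rightarrow> (('a \<Rightarrow> complex) \<Rightarrow> ennreal) \<Rightarrow> ('a \<Rightarrow> complex) \<Rightarrow> ennreal" where
  "assoc_norm M N f =
     (SUP g\<in>{g\<in>borel_measurable M. N g \<le> 1}. \<integral>\<^sup>+x. ennreal (cmod (f x * g x)) \<partial>M)"

text \<open>
  The quasi-norm of a \<open>[0,\<infinity>]\<close>-valued function. For a measurable, almost everywhere finite \<open>F\<close>
  this is the quasi-norm of \<open>F\<close> itself, by the lattice property (see \<open>ext_norm_eq\<close> below), and it is
  \<open>\<infinity>\<close> if \<open>F = \<infinity>\<close> on a set of positive measure. Balls of a quasi-metric need not be open, so that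
  measurability of maximal functions and of \<open>qU\<close> is not automatic; for nonmeasurable \<open>F\<close> the least
  quasi-norm of a measurable majorant is used.
\<close>

definition ext_norm :: "'a measure \<Rightarrow> (('a \<Rightarrow> complex) \<Rightarrow> ennreal) \<Rightarrow> ('a \<Rightarrow> ennreal) \<Rightarrow> ennreal" where
  "ext_norm M N F =
     (INF g\<in>{g\<in>borel_measurable M. AE x in M. F x \<le> ennreal (cmod (g x))}. N g)"

lemma ext_norm_eq:
  assumes "ball_quasi_banach_fs M \<rho> N" "f \<in> borel_measurable M"
    and "AE x in M. F x = ennreal (cmod (f x))"
  shows "ext_norm M N F = N f"
proof (rule antisym)
  show "ext_norm M N F \<le> N f"
    unfolding ext_norm_def using assms(2,3) by (intro INF_lower) auto
  show "N f \<le> ext_norm M N F"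
    unfolding ext_norm_def
  proof (rule INF_greatest)
    fix g assume g: "g \<in> {g\<in>borel_measurable M. AE x in M. F x \<le> ennreal (cmod (g x))}"
    then have "AE x in M. F x \<le> ennreal (cmod (g x))" by simp
    with assms(3) have "AE x in M. cmod (f x) \<le> cmod (g x)"
      by eventually_elim simp
    with assms(1,2) g show "N f \<le> N g"
      unfolding ball_quasi_banach_fs_def by blast
  qed
qed

definition abs_cont_norm :: "'a measure \<Rightarrow> (('a \<Rightarrow> complex) \<Rightarrow> ennreal) \<Rightarrow> bool" where
  "abs_cont_norm M N \<longleftrightarrow>
     (\<forall>f\<in>fspace M N. \<forall>E::nat \<Rightarrow> 'a set. (\<forall>j. E j \<in> sets M) \<longrightarrow>
        (AE x in M. (\<lambda>j. indicator (E j) x :: real) \<longlonglongrightarrow> 0) \<longrightarrow>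
        (\<lambda>j. N (\<lambda>x. f x * indicator (E j) x)) \<longlonglongrightarrow> 0)"

section \<open>The Hardy--Littlewood maximal operator\<close>

definition maximal :: "'a measure \<Rightarrow> ('a \<Rightarrow> 'a \<Rightarrow> real) \<Rightarrow> ('a \<Rightarrow> complex) \<Rightarrow> 'a \<Rightarrow> ennreal" where
  "maximal M \<rho> f x =
     (SUP B\<in>{B. x \<in> B \<and> (\<exists>z\<in>space M. \<exists>r>0. B = qball (space M) \<rho> z r)}.
        (\<integral>\<^sup>+y\<in>B. ennreal (cmod (f y)) \<partial>M) / emeasure M B)"

definition maximal_bounded ::
  "'a measure \<Rightarrow> ('a \<Rightarrow> 'a \<Rightarrow> real) \<Rightarrow> (('a \<Rightarrow> complex) \<Rightarrow> ennreal) \<Rightarrow> bool" where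
  "maximal_bounded M \<rho> N \<longleftrightarrow>
     (\<exists>C::real. 0 \<le> C \<and> (\<forall>f\<in>fspace M N. ext_norm M N (maximal M \<rho> f) \<le> ennreal C * N f))"

definition maximal_opnorm ::
  "'a measure \<Rightarrow> ('a \<Rightarrow> 'a \<Rightarrow> real) \<Rightarrow> (('a \<Rightarrow> complex) \<Rightarrow> ennreal) \<Rightarrow> ennreal" where
  "maximal_opnorm M \<rho> N = (SUP f\<in>{f\<in>fspace M N. N f \<le> 1}. ext_norm M N (maximal M \<rho> f))"

definition endpoint_bounded ::
  "'a measure \<Rightarrow> ('a \<Rightarrow> 'a \<Rightarrow> real) \<Rightarrow> (('a \<Rightarrow> complex) \<Rightarrow> ennreal) \<Rightarrow> real \<Rightarrow> bool" where
  "endpoint_bounded M \<rho> N p \<longleftrightarrow>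
     (\<exists>\<theta>::nat \<Rightarrow> real. (\<forall>m. 0 < \<theta> m \<and> \<theta> m < 1) \<and> \<theta> \<longlonglongrightarrow> 1 \<and>
        (\<forall>m. ball_banach_fs M \<rho> (convexif N (1 / (p * \<theta> m))) \<and>
             maximal_bounded M \<rho> (assoc_norm M (convexif N (1 / (p * \<theta> m))))) \<and>
        (\<exists>l. (\<lambda>m. maximal_opnorm M \<rho> (assoc_norm M (convexif N (1 / (p * \<theta> m))))) \<longlonglongrightarrow> l \<and> l < \<infinity>))"

section \<open>Function spaces of the theorem\<close>

definition Cb :: "'a set \<Rightarrow> ('a \<Rightarrow> 'a \<Rightarrow> real) \<Rightarrow> real \<Rightarrow> ('a \<Rightarrow> complex) set" where
  "Cb X \<rho> \<beta> = {f.
     (\<exists>x\<in>X. \<exists>r>0. {y\<in>X. f y \<noteq> 0} \<subseteq> qball X \<rho> x r) \<and>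
     (\<exists>H. \<forall>x\<in>X. \<forall>y\<in>X. x \<noteq> y \<longrightarrow> cmod (f x - f y) / \<rho> x y powr \<beta> \<le> H)}"

definition gagliardo ::
  "'a measure \<Rightarrow> ('a \<Rightarrow> 'a \<Rightarrow> real) \<Rightarrow> real \<Rightarrow> real \<Rightarrow> ('a \<Rightarrow> complex) \<Rightarrow> 'a \<Rightarrow> ennreal" where
  "gagliardo M \<rho> s q f x = epowr (\<integral>\<^sup>+y.
     (if y = x then 0
      else ennreal (cmod (f x - f y) powr q) / (qU M \<rho> x y * ennreal (\<rho> x y powr (s * q)))) \<partial>M) (1 / q)"

definition Wnorm ::
  "'a measure \<Rightarrow> ('a \<Rightarrow> 'a \<Rightarrow> real) \<Rightarrow> (('a \<Rightarrow> complex) \<Rightarrow> ennreal) \<Rightarrow> real \<Rightarrow> real \<Rightarrow> ('a \<Rightarrow> complex) \<Rightarrow> ennreal" where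
  "Wnorm M \<rho> N s q f = ext_norm M N (gagliardo M \<rho> s q f)"

definition Wdot ::
  "'a measure \<Rightarrow> ('a \<Rightarrow> 'a \<Rightarrow> real) \<Rightarrow> (('a \<Rightarrow> complex) \<Rightarrow> ennreal) \<Rightarrow> real \<Rightarrow> real \<Rightarrow> ('a \<Rightarrow> complex) set" where
  "Wdot M \<rho> N s q = {f \<in> borel_measurable M. Wnorm M \<rho> N s q f < \<infinity>}"

text \<open>The norm of \<open>Y/\<real>\<close>, as a function of representatives; only real constants are factored out.\<close>

definition mod_const_norm :: "(('a \<Rightarrow> complex) \<Rightarrow> ennreal) \<Rightarrow> ('a \<Rightarrow> complex) \<Rightarrow> ennreal" where
  "mod_const_norm N f = (INF a::real. N (\<lambda>x. f x + of_real a))"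

end

theory Submission
  imports Defs
begin

text \<open>
  The integral over \<open>y\<close> is split at \<open>\<rho>(x,y) = 1\<close>. For \<open>\<rho>(x,y) < 1\<close> the kernel decreases as \<open>s\<close> decreases, so this
  near part is bounded by one finite Gagliardo functional and the factor \<open>s\<^sup>1\<^sup>/\<^sup>q\<close> sends it to \<open>0\<close>. Everything
  happens in the far part \<open>\<rho>(x,y) \<ge> 1\<close>, where the integral of the kernel is of order \<open>1 / s\<close>: from above by doubling, from
  below by reverse doubling.

  The lower bound (\<open>far_lower_bound\<close>) is then pointwise for functions of bounded support: far away \<open>f y = 0\<close>, and
  \<open>s\<close> times the far part is at least a constant times \<open>\<bar>f x\<bar>\<^sup>q\<close> as soon as \<open>s\<close> is small, uniformly in \<open>x\<close>.

  For the upper bound, \<open>s\<close> times the far part is at most a constant times \<open>\<bar>f x\<bar>\<^sup>q + T \<bar>f\<bar>\<^sup>q x\<close>, where \<open>T\<close> is a weighted sum of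
  averages over balls of a discretized dyadic system, of total weight bounded uniformly in \<open>s\<close> (\<open>weight_mass\<close>,
  \<open>kernel_le_avg_kernel\<close>). Jensen's inequality replaces \<open>T \<bar>f\<bar>\<^sup>q\<close> by \<open>(T \<bar>f\<bar>\<^sup>p)\<^sup>q\<^sup>/\<^sup>p\<close>, and the matter is reduced to the
  boundedness of \<open>f \<mapsto> (T \<bar>f\<bar>\<^sup>p)\<^sup>1\<^sup>/\<^sup>p\<close> on \<open>Y\<close> (\<open>avg_op_endpoint_bounded\<close>). The operator \<open>T\<close> is self-adjoint and dominated
  by the maximal operator; hence a bound for the maximal operator on an associate space gives a bound for \<open>T\<close> on the
  space (\<open>avg_op_bounded\<close>), through the part of the Lorentz-Luxemburg duality theorem that recovers a norm from its
  associate norm (\<open>duality_witness\<close>), which follows from a projection in \<open>L\<^sup>2\<close> (\<open>L2_separation\<close>). Since the maximal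
  operator is bounded for exponents tending to \<open>p\<close>, with bounded operator norms, the Fatou property yields the
  exponent \<open>p\<close> itself.

  As the far part is bounded on \<open>Y\<close> uniformly in \<open>s\<close> (\<open>far_norm_bound\<close>), the lower bound passes from truncations
  to all of \<open>Y\<close> when the quasi-norm is absolutely continuous, and Gagliardo functionals are invariant under addition of
  constants, which gives the version modulo constants.
\<close>

section \<open>Powers of extended nonnegative numbers\<close>

lemma epowr_ennreal: "0 \<le> r \<Longrightarrow> epowr (ennreal r) a = ennreal (r powr a)"
  by (simp add: epowr_def)

lemma epowr_top [simp]: "epowr top a = top"
  by (simp add: epowr_def)

lemma epowr_one [simp]: "epowr x 1 = x"
  by (cases x) (auto simp: epowr_def)

lemma epowr_mono: "0 \<le> a \<Longrightarrow> x \<le> y \<Longrightarrow> epowr x a \<le> epowr y a"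
  by (cases x; cases y)
    (auto simp: epowr_ennreal top_unique intro!: ennreal_leI powr_mono2)

lemma epowr_epowr: "epowr (epowr x a) b = epowr x (a * b)"
  by (cases x) (auto simp: epowr_ennreal powr_powr)

text \<open>
  Taking the power \<open>a\<close> and taking the power \<open>1 / a\<close> form a Galois connection. This moves exponents
  across an infimum or supremum without a continuity argument.
\<close>

lemma epowr_le_iff: "0 < a \<Longrightarrow> epowr x a \<le> y \<longleftrightarrow> x \<le> epowr y (1 / a)"
  using epowr_mono[of a x "epowr y (1 / a)"] epowr_mono[of "1/a" "epowr x a" y]
  by (auto simp: epowr_epowr)

lemma epowr_cmult:
  "0 < c \<Longrightarrow> epowr (ennreal c * x) a = ennreal (c powr a) * epowr x a"
  by (cases x) (auto simp: epowr_ennreal powr_mult ennreal_mult_top simp flip: ennreal_mult)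

lemma epowr_add_le:
  assumes "0 < a"
  shows "epowr (x + y) a \<le> ennreal (2 powr a) * (epowr x a + epowr y a)"
proof -
  have "epowr (x + y) a \<le> epowr (ennreal 2 * max x y) a"
    using assms by (intro epowr_mono) (auto simp: ennreal_numeral mult_2 intro: add_mono)
  also have "\<dots> = ennreal (2 powr a) * epowr (max x y) a"
    by (simp only: epowr_cmult)
  also have "\<dots> \<le> ennreal (2 powr a) * (epowr x a + epowr y a)"
    by (intro mult_left_mono) (auto simp: max_def)
  finally show ?thesis .
qed

lemma measurable_epowr [measurable]:
  assumes [measurable]: "f \<in> borel_measurable M"
  shows "(\<lambda>x. epowr (f x) a) \<in> borel_measurable M"
proof -
  have "(\<lambda>x. if f x = top then top else ennreal (enn2real (f x) powr a)) \<in> borel_measurable M"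
    by measurable
  then show ?thesis by (simp add: epowr_def)
qed

text \<open>
  Jensen's inequality for a density \<open>k\<close> of mass at most \<open>A\<close>, with a constant that is not sharp. It comes
  from the elementary bound \<open>u \<le> t powr (1 - r) * u powr r + t\<close>, whose two terms balance after
  integration for \<open>t = I powr (1 / r)\<close>, where \<open>I\<close> is the integral on the right.
\<close>

lemma jensen_epowr:
  assumes [measurable]: "u \<in> borel_measurable M" "k \<in> borel_measurable M"
    and r: "1 \<le> r" and A: "0 \<le> A" and mass: "(\<integral>\<^sup>+y. k y \<partial>M) \<le> ennreal A"
  shows "(\<integral>\<^sup>+y. u y * k y \<partial>M) \<le> ennreal (1 + A) * epowr (\<integral>\<^sup>+y. epowr (u y) r * k y \<partial>M) (1 / r)"
    (is "?l \<le> _ * epowr ?I _")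
proof -
  have split: "?l \<le> ennreal (t powr (1 - r)) * ?I + ennreal t * ennreal A" if t: "0 < t" for t
  proof -
    have pt: "u y \<le> ennreal (t powr (1 - r)) * epowr (u y) r + ennreal t" for y
    proof (cases "u y")
      case (real a)
      show ?thesis
      proof (cases "a \<le> t")
        case True
        then show ?thesis using real by (auto intro: order_trans[OF ennreal_leI add_increasing])
      next
        case False
        then have "a = a powr (1 - r) * a powr r"
          using t by (simp flip: powr_add)
        also have "\<dots> \<le> t powr (1 - r) * a powr r"
          using False t r by (intro mult_right_mono powr_mono2') auto
        finally show ?thesis using real
          by (auto simp: epowr_ennreal simp flip: ennreal_mult' intro: order_trans[OF ennreal_leI add_increasing2])
      qed
    qed (use t in \<open>simp add: ennreal_mult_top\<close>)
    have "?l \<le> (\<integral>\<^sup>+y. ennreal (t powr (1 - r)) * (epowr (u y) r * k y) + ennreal t * k y \<partial>M)"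
      using pt by (intro nn_integral_mono)
        (metis (no_types, lifting) mult_right_mono distrib_right mult.assoc zero_le)
    also have "\<dots> = ennreal (t powr (1 - r)) * ?I + ennreal t * (\<integral>\<^sup>+y. k y \<partial>M)"
      by (simp add: nn_integral_add nn_integral_cmult)
    also have "\<dots> \<le> ennreal (t powr (1 - r)) * ?I + ennreal t * ennreal A"
      by (intro add_left_mono mult_left_mono mass) auto
    finally show ?thesis .
  qed
  show ?thesis
  proof (cases ?I)
    case (real i)
    show ?thesis
    proof (cases "i = 0")
      case True
      have "?l \<le> 0 + ennreal e" if e: "0 < e" for e
      proof -
        have "?l \<le> ennreal (e / (1 + A)) * ennreal A"
          using split[of "e / (1 + A)"] e A real True by simp
        also have "\<dots> = ennreal (e / (1 + A) * A)" using e A ennreal_mult[of "e / (1 + A)" A] by simp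
        also have "\<dots> \<le> ennreal e" using e A by (intro ennreal_leI) (simp add: field_simps)
        finally show ?thesis by simp
      qed
      then have "?l \<le> 0" by (rule ennreal_le_epsilon)
      then show ?thesis by simp
    next
      case False
      then have i: "0 < i" using real by simp
      have "?l \<le> ennreal ((i powr (1 / r)) powr (1 - r)) * ennreal i + ennreal (i powr (1 / r)) * ennreal A"
        using split[of "i powr (1 / r)"] i real by simp
      also have "\<dots> = ennreal ((i powr (1 / r)) powr (1 - r) * i + i powr (1 / r) * A)"
        using i A by (simp add: ennreal_mult')
      also have "(i powr (1 / r)) powr (1 - r) * i = i powr ((1 / r) * (1 - r)) * i powr 1"
        using i by (simp add: powr_powr)
      also have "\<dots> = i powr (1 / r)"
        using r by (subst powr_add[symmetric]) (simp add: field_simps)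
      also have "ennreal (i powr (1 / r) + i powr (1 / r) * A) = ennreal (1 + A) * epowr ?I (1 / r)"
        using real i A by (simp add: epowr_ennreal algebra_simps flip: ennreal_mult')
      finally show ?thesis .
    qed
  qed (use A in \<open>simp add: ennreal_mult_top\<close>)
qed

lemma le_cmult_Liminf_add:
  fixes W :: "'b \<Rightarrow> ennreal"
  assumes m: "0 < m" and ev: "\<forall>\<^sub>F s in F. x \<le> ennreal m * (W s + ennreal d)"
  shows "x \<le> ennreal m * (Liminf F W + ennreal d)"
proof -
  have div: "ennreal (1 / m) * x \<le> y \<longleftrightarrow> x \<le> ennreal m * y" for y
  proof -
    have 1: "ennreal m * (ennreal (1 / m) * z) = z" "ennreal (1 / m) * (ennreal m * z) = z" for z
      using m by (auto simp: mult.assoc[symmetric] simp flip: ennreal_mult')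
    show ?thesis
      using mult_left_mono[of "ennreal (1 / m) * x" y "ennreal m"] mult_left_mono[of x "ennreal m * y" "ennreal (1 / m)"]
      by (auto simp: 1)
  qed
  have sub: "ennreal (1 / m) * x - ennreal d \<le> w \<longleftrightarrow> x \<le> ennreal m * (w + ennreal d)" for w
    by (simp add: ennreal_minus_le_iff add.commute flip: div)
  have "ennreal (1 / m) * x - ennreal d \<le> Liminf F W"
    using ev by (intro Liminf_bounded) (simp add: sub)
  then show ?thesis by (simp add: sub)
qed

text \<open>
  The exponents vary along the sequence, so monotonicity of a single power is not enough: for each
  \<open>b\<close> below the lower limit of \<open>X\<close>, eventually \<open>b powr e n\<close> is a lower bound, and it converges.
\<close>

lemma le_Liminf_epowr:
  fixes X :: "nat \<Rightarrow> ennreal"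
  assumes lim: "e \<longlonglongrightarrow> e0" and e0: "0 < e0" and e: "\<And>n. 0 < e n"
  shows "epowr (liminf X) e0 \<le> liminf (\<lambda>n. epowr (X n) (e n))"
proof -
  have real: "ennreal (b powr e0) \<le> liminf (\<lambda>n. epowr (X n) (e n))"
    if b: "ennreal b < liminf X" "0 < b" for b
  proof -
    have "\<forall>\<^sub>F n in sequentially. ennreal b < X n"
      using b(1) less_LiminfD by blast
    then have ev: "\<forall>\<^sub>F n in sequentially. ennreal (b powr e n) \<le> epowr (X n) (e n)"
    proof eventually_elim
      case (elim n)
      then show ?case using epowr_mono[of "e n" "ennreal b" "X n"] e[of n] b by (simp add: epowr_ennreal)
    qed
    have "(\<lambda>n. ennreal (b powr e n)) \<longlonglongrightarrow> ennreal (b powr e0)"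
      using b lim by (intro tendsto_ennrealI tendsto_powr tendsto_const) auto
    then have "ennreal (b powr e0) = liminf (\<lambda>n. ennreal (b powr e n))"
      using lim_imp_Liminf[OF sequentially_bot] by metis
    also have "\<dots> \<le> liminf (\<lambda>n. epowr (X n) (e n))" by (rule Liminf_mono[OF ev])
    finally show ?thesis .
  qed
  show ?thesis
  proof (rule dense_le)
    fix y assume y: "y < epowr (liminf X) e0"
    show "y \<le> liminf (\<lambda>n. epowr (X n) (e n))"
    proof -
      have "epowr y (1 / e0) < liminf X"
        using y epowr_le_iff[of "1 / e0" ] epowr_le_iff[OF e0, of "liminf X" y] e0
        by (simp add: not_le[symmetric])
      then obtain z where z: "epowr y (1 / e0) < z" "z < liminf X" using dense by blast
      then obtain b where b: "z = ennreal b" "0 \<le> b" by (cases z) auto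
      with z have "0 < b" by (cases "b = 0") auto
      have "y \<le> epowr z e0"
        using z epowr_mono[of e0 "epowr y (1 / e0)" z] e0 by (simp add: epowr_epowr)
      also have "\<dots> = ennreal (b powr e0)" using b by (simp add: epowr_ennreal)
      also have "\<dots> \<le> liminf (\<lambda>n. epowr (X n) (e n))" using real b z \<open>0 < b\<close> by auto
      finally show ?thesis .
    qed
  qed
qed

section \<open>Quasi-norms of extended nonnegative functions\<close>

text \<open>
  Maximal functions, averages and Gagliardo functionals take values in \<open>[0, \<infinity>]\<close>, and some of them need
  not be measurable. All estimates are therefore carried out for \<^const>\<open>ext_norm\<close>, which inherits the
  lattice property, homogeneity and the quasi-triangle inequality on arbitrary functions, and the Fatou
  property on measurable ones.
\<close>

locale ball_quasi_banach =
  fixes M :: "'a measure" and \<rho> :: "'a \<Rightarrow> 'a \<Rightarrow> real" and N :: "('a \<Rightarrow> complex) \<Rightarrow> ennreal"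
  assumes bqb: "ball_quasi_banach_fs M \<rho> N"
begin

abbreviation "E \<equiv> ext_norm M N"

lemma norm_mono:
  "f \<in> borel_measurable M \<Longrightarrow> g \<in> borel_measurable M \<Longrightarrow>
    (AE x in M. cmod (g x) \<le> cmod (f x)) \<Longrightarrow> N g \<le> N f"
  using bqb unfolding ball_quasi_banach_fs_def by blast

lemma norm_cmult: "f \<in> borel_measurable M \<Longrightarrow> N (\<lambda>x. c * f x) = ennreal (cmod c) * N f"
  using bqb unfolding ball_quasi_banach_fs_def quasi_banach_def by blast

lemma norm_eq_0D: "f \<in> borel_measurable M \<Longrightarrow> N f = 0 \<Longrightarrow> AE x in M. f x = 0"
  using bqb unfolding ball_quasi_banach_fs_def by blast

lemma norm_monotone_convergence:
  assumes "\<And>m. F m \<in> borel_measurable M" "f \<in> borel_measurable M"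
    "AE x in M. (\<forall>m. 0 \<le> F m x) \<and> incseq (\<lambda>m. F m x) \<and> (\<lambda>m. F m x) \<longlonglongrightarrow> f x"
  shows "(\<lambda>m. N (\<lambda>x. of_real (F m x))) \<longlonglongrightarrow> N (\<lambda>x. of_real (f x))"
  using bqb assms unfolding ball_quasi_banach_fs_def by blast

lemma norm_zero: "N (\<lambda>x. 0) = 0"
  using norm_cmult[of "\<lambda>x. 0" 0] by simp

lemma quasi_triangle:
  obtains C :: real where "1 \<le> C"
    "\<And>f g. f \<in> borel_measurable M \<Longrightarrow> g \<in> borel_measurable M \<Longrightarrow>
      N (\<lambda>x. f x + g x) \<le> ennreal C * (N f + N g)"
proof -
  have "\<exists>C::real. 1 \<le> C \<and> (\<forall>f\<in>borel_measurable M. \<forall>g\<in>borel_measurable M.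
      N (\<lambda>x. f x + g x) \<le> ennreal C * (N f + N g))"
    using bqb unfolding ball_quasi_banach_fs_def quasi_banach_def by (elim conjE)
  then show thesis using that by blast
qed

lemma ext_norm_le: "g \<in> borel_measurable M \<Longrightarrow> AE x in M. F x \<le> ennreal (cmod (g x)) \<Longrightarrow> E F \<le> N g"
  unfolding ext_norm_def by (intro INF_lower) auto

lemma ext_norm_greatest:
  "(\<And>g. g \<in> borel_measurable M \<Longrightarrow> AE x in M. F x \<le> ennreal (cmod (g x)) \<Longrightarrow> y \<le> N g) \<Longrightarrow> y \<le> E F"
  unfolding ext_norm_def by (intro INF_greatest) auto

lemma ext_norm_approx:
  assumes "E F < top" and e: "0 < (e :: real)"
  obtains g where "g \<in> borel_measurable M" "AE x in M. F x \<le> ennreal (cmod (g x))" "N g < E F + ennreal e"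
proof -
  have "\<exists>i\<in>{g \<in> borel_measurable M. AE x in M. F x \<le> ennreal (cmod (g x))}. N i < E F + ennreal e"
    using assms(1) by (intro INF_approx_ennreal[OF e ext_norm_def]) simp
  then show ?thesis using that by blast
qed

lemma ext_norm_mono: "AE x in M. F x \<le> G x \<Longrightarrow> E F \<le> E G"
  by (intro ext_norm_greatest ext_norm_le) (auto elim!: eventually_elim2)

lemma ext_norm_cong: "AE x in M. F x = G x \<Longrightarrow> E F = E G"
  by (intro antisym ext_norm_mono) auto

lemma ext_norm_fun: "f \<in> borel_measurable M \<Longrightarrow> E (\<lambda>x. ennreal (cmod (f x))) = N f"
  using ext_norm_eq[OF bqb] by simp

lemma ext_norm_fun_real:
  "f \<in> borel_measurable M \<Longrightarrow> (\<And>x. 0 \<le> f x) \<Longrightarrow> E (\<lambda>x. ennreal (f x)) = N (\<lambda>x. of_real (f x))"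
  using ext_norm_eq[OF bqb, of "\<lambda>x. of_real (f x)" "\<lambda>x. ennreal (f x)"] by simp

lemma ext_norm_cmult_le:
  assumes c: "0 < c"
  shows "ennreal c * E F \<le> E (\<lambda>x. ennreal c * F x)"
proof (rule ext_norm_greatest)
  fix g assume g [measurable]: "g \<in> borel_measurable M" and le: "AE x in M. ennreal c * F x \<le> ennreal (cmod (g x))"
  have "E F \<le> N (\<lambda>x. of_real (1 / c) * g x)"
  proof (rule ext_norm_le)
    show "AE x in M. F x \<le> ennreal (cmod (of_real (1 / c) * g x))"
      using le
    proof eventually_elim
      case (elim x)
      have "ennreal (1 / c) * (ennreal c * F x) \<le> ennreal (1 / c) * ennreal (cmod (g x))"
        by (intro mult_left_mono elim) simp
      moreover have "ennreal (1 / c) * (ennreal c * F x) = F x"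
        using c by (simp add: mult.assoc[symmetric] flip: ennreal_mult')
      ultimately show ?case using c by (simp add: norm_mult norm_divide flip: ennreal_mult')
    qed
  qed measurable
  also have "\<dots> = ennreal (1 / c) * N g"
    using c by (subst norm_cmult) (auto simp: norm_divide)
  finally have "ennreal c * E F \<le> ennreal c * (ennreal (1 / c) * N g)"
    by (intro mult_left_mono) auto
  then show "ennreal c * E F \<le> N g"
    using c by (simp add: mult.assoc[symmetric] flip: ennreal_mult')
qed

lemma ext_norm_cmult:
  assumes c: "0 < c"
  shows "E (\<lambda>x. ennreal c * F x) = ennreal c * E F"
proof (rule antisym)
  have "ennreal (1 / c) * E (\<lambda>x. ennreal c * F x) \<le> E (\<lambda>x. ennreal (1 / c) * (ennreal c * F x))"
    using c by (intro ext_norm_cmult_le) simp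
  also have "(\<lambda>x. ennreal (1 / c) * (ennreal c * F x)) = F"
    using c by (simp add: mult.assoc[symmetric] flip: ennreal_mult')
  finally have "ennreal c * (ennreal (1 / c) * E (\<lambda>x. ennreal c * F x)) \<le> ennreal c * E F"
    by (intro mult_left_mono) auto
  then show "E (\<lambda>x. ennreal c * F x) \<le> ennreal c * E F"
    using c by (simp add: mult.assoc[symmetric] flip: ennreal_mult')
qed (rule ext_norm_cmult_le[OF c])

lemma ext_norm_add_le:
  assumes K: "0 \<le> K"
    and quasi: "\<And>f g. f \<in> borel_measurable M \<Longrightarrow> g \<in> borel_measurable M \<Longrightarrow>
        N (\<lambda>x. f x + g x) \<le> ennreal K * (N f + N g)"
    and fin: "E F < top" "E G < top"
  shows "E (\<lambda>x. F x + G x) \<le> ennreal K * (E F + E G)"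
proof (rule ennreal_le_epsilon)
  fix e :: real assume e: "0 < e"
  define d where "d = e / (2 * (K + 1))"
  have d: "0 < d" "K * (2 * d) \<le> e" using e K by (auto simp: d_def field_simps)
  obtain f where [measurable]: "f \<in> borel_measurable M"
    and f: "AE x in M. F x \<le> ennreal (cmod (f x))" "N f < E F + ennreal d"
    using ext_norm_approx[OF fin(1), of d] d by auto
  obtain g where [measurable]: "g \<in> borel_measurable M"
    and g: "AE x in M. G x \<le> ennreal (cmod (g x))" "N g < E G + ennreal d"
    using ext_norm_approx[OF fin(2), of d] d by auto
  have cm: "N (\<lambda>x. of_real (cmod (h x))) \<le> N h" if "h \<in> borel_measurable M" for h
    using that by (intro norm_mono) auto
  have "E (\<lambda>x. F x + G x) \<le> N (\<lambda>x. of_real (cmod (f x)) + of_real (cmod (g x)))"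
  proof (rule ext_norm_le)
    show "AE x in M. F x + G x \<le> ennreal (cmod (of_real (cmod (f x)) + of_real (cmod (g x))))"
      using f(1) g(1)
    proof eventually_elim
      case (elim x)
      have "cmod (of_real (cmod (f x)) + of_real (cmod (g x))) = cmod (f x) + cmod (g x)"
        by (simp add: norm_of_real flip: of_real_add)
      then show ?case using elim by (simp add: ennreal_plus add_mono del: of_real_add)
    qed
  qed measurable
  also have "\<dots> \<le> ennreal K * (N (\<lambda>x. of_real (cmod (f x))) + N (\<lambda>x. of_real (cmod (g x))))"
    by (intro quasi) measurable
  also have "\<dots> \<le> ennreal K * ((E F + ennreal d) + (E G + ennreal d))"
    using f g by (intro mult_left_mono add_mono) (auto intro: order_trans[OF cm] less_imp_le)
  also have "\<dots> = ennreal K * ((E F + E G) + ennreal (2 * d))"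
  proof -
    have "ennreal (2 * d) = ennreal d + ennreal d"
      using d ennreal_plus[of d d] by (simp only: mult_2 less_imp_le)
    then show ?thesis by (simp only: add_ac)
  qed
  also have "\<dots> = ennreal K * (E F + E G) + ennreal (K * (2 * d))"
    using K by (simp add: distrib_left ennreal_mult')
  also have "\<dots> \<le> ennreal K * (E F + E G) + ennreal e"
    using d by (intro add_left_mono ennreal_leI)
  finally show "E (\<lambda>x. F x + G x) \<le> ennreal K * (E F + E G) + ennreal e" .
qed

lemma ext_norm_finite_AE:
  assumes "E F < top"
  shows "AE x in M. F x < top"
proof -
  obtain g where "AE x in M. F x \<le> ennreal (cmod (g x))"
    using ext_norm_approx[OF assms, of 1] by auto
  then show ?thesis by eventually_elim (auto simp: le_less_trans)
qed

lemma ext_norm_real_eq: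
  assumes "F \<in> borel_measurable M" "AE x in M. F x < top"
  shows "E F = N (\<lambda>x. of_real (enn2real (F x)))"
  using assms by (intro ext_norm_eq[OF bqb]) (auto elim!: eventually_mono)

text \<open>
  The Fatou property survives the passage to infinite values: let the norms \<open>E (F n)\<close> be bounded by a
  finite \<open>c\<close>, and let \<open>P\<close> be the set on which the supremum is infinite. Truncation at height \<open>k\<close> gives
  \<open>k * N 1\<^sub>P \<le> c\<close> for every \<open>k\<close>, so \<open>P\<close> is a null set and the Fatou property for finite functions applies.
\<close>

lemma ext_norm_monotone_convergence:
  assumes [measurable]: "\<And>n. F n \<in> borel_measurable M" and inc: "incseq F"
  shows "E (\<lambda>x. SUP n. F n x) = (SUP n. E (F n))"
proof (rule antisym)
  show "(SUP n. E (F n)) \<le> E (\<lambda>x. SUP n. F n x)"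
    by (intro SUP_least ext_norm_mono AE_I2 SUP_upper) auto
  have incx: "incseq (\<lambda>n. F n x)" for x using inc by (auto simp: incseq_def le_fun_def)
  define c where "c = (SUP n. E (F n))"
  have c: "E (F n) \<le> c" for n unfolding c_def by (intro SUP_upper) auto
  show "E (\<lambda>x. SUP n. F n x) \<le> (SUP n. E (F n))"
  proof (cases "c = top")
    case False
    define S where "S x = (SUP n. F n x)" for x
    have [measurable]: "S \<in> borel_measurable M" unfolding S_def by measurable
    define P where "P = {x\<in>space M. S x = top}"
    have P [measurable]: "P \<in> sets M" unfolding P_def by measurable
    let ?P = "\<lambda>x. complex_of_real (indicator P x)"
    have "ennreal k * N ?P \<le> c" if k: "0 < k" for k :: real
    proof -
      define D where "D n x = enn2real (min (F n x) (ennreal k)) * indicator P x" for n x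
      have [measurable]: "D n \<in> borel_measurable M" for n unfolding D_def by measurable
      have fin: "min (F n x) (ennreal k) < top" for n x by (simp add: min_less_iff_disj)
      have "(\<lambda>n. N (\<lambda>x. of_real (D n x))) \<longlonglongrightarrow> N (\<lambda>x. of_real (k * indicator P x))"
      proof (rule norm_monotone_convergence)
        show "AE x in M. (\<forall>m. 0 \<le> D m x) \<and> incseq (\<lambda>m. D m x) \<and> (\<lambda>m. D m x) \<longlonglongrightarrow> k * indicator P x"
        proof (rule AE_I2, intro conjI allI)
          fix x
          show "0 \<le> D m x" for m by (simp add: D_def)
          show "incseq (\<lambda>m. D m x)"
            unfolding D_def using incx[of x] fin
            by (intro incseq_SucI mult_right_mono enn2real_mono) (auto simp: incseq_Suc_iff min.coboundedI1)
          have "(\<lambda>n. min (F n x) (ennreal k)) \<longlonglongrightarrow> min (S x) (ennreal k)"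
            unfolding S_def by (intro tendsto_min LIMSEQ_SUP incx tendsto_const)
          moreover have "min (S x) (ennreal k) = ennreal (enn2real (min (S x) (ennreal k)))"
            by (simp add: min_less_iff_disj)
          ultimately have "(\<lambda>n. enn2real (min (F n x) (ennreal k))) \<longlonglongrightarrow> enn2real (min (S x) (ennreal k))"
            by (intro tendsto_enn2real) auto
          then have "(\<lambda>m. D m x) \<longlonglongrightarrow> enn2real (min (S x) (ennreal k)) * indicator P x"
            unfolding D_def by (intro tendsto_mult tendsto_const)
          moreover have "enn2real (min (S x) (ennreal k)) * indicator P x = k * indicator P x"
            using k by (auto simp: P_def indicator_def)
          ultimately show "(\<lambda>m. D m x) \<longlonglongrightarrow> k * indicator P x" by simp
        qed
      qed measurable
      moreover have "N (\<lambda>x. of_real (D n x)) \<le> c" for n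
      proof -
        have "N (\<lambda>x. of_real (D n x)) = E (\<lambda>x. ennreal (D n x))"
          by (intro ext_norm_fun_real[symmetric]) (auto simp: D_def)
        also have "\<dots> \<le> E (F n)"
          using fin by (intro ext_norm_mono AE_I2) (auto simp: D_def indicator_def)
        finally show ?thesis using c[of n] by simp
      qed
      ultimately have "N (\<lambda>x. of_real (k * indicator P x)) \<le> c"
        by (intro LIMSEQ_le_const2) auto
      moreover have "N (\<lambda>x. of_real (k * indicator P x)) = ennreal k * N ?P"
        using norm_cmult[of "\<lambda>x. of_real (indicator P x)" "of_real k"] k by simp
      ultimately show ?thesis by simp
    qed
    note bound = this
    have "N ?P = 0"
    proof (rule ccontr)
      assume nz: "N ?P \<noteq> 0"
      obtain r where r: "c = ennreal r" "0 \<le> r" using False by (cases c) auto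
      have "N ?P \<le> c" using bound[of 1] by simp
      then obtain a where a: "N ?P = ennreal a" "0 < a"
        using nz r by (cases "N ?P") (auto simp: top_unique less_le)
      have "ennreal ((r + 1) / a) * ennreal a \<le> ennreal r"
        using bound[of "(r + 1) / a"] a r by simp
      then show False using a r by (simp flip: ennreal_mult')
    qed
    then have "AE x in M. of_real (indicator P x) = (0 :: complex)"
      by (intro norm_eq_0D) measurable
    then have AEfin: "AE x in M. S x < top"
      by (rule AE_mp) (auto simp: P_def indicator_def less_top intro!: AE_I2)
    have le: "F n x \<le> S x" for n x unfolding S_def by (intro SUP_upper) auto
    have "(\<lambda>n. N (\<lambda>x. of_real (enn2real (F n x)))) \<longlonglongrightarrow> N (\<lambda>x. of_real (enn2real (S x)))"
    proof (rule norm_monotone_convergence)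
      show "AE x in M. (\<forall>m. 0 \<le> enn2real (F m x)) \<and> incseq (\<lambda>m. enn2real (F m x)) \<and>
          (\<lambda>m. enn2real (F m x)) \<longlonglongrightarrow> enn2real (S x)"
        using AEfin
      proof eventually_elim
        case (elim x)
        have "(\<lambda>m. F m x) \<longlonglongrightarrow> S x" unfolding S_def by (intro LIMSEQ_SUP incx)
        then have "(\<lambda>m. enn2real (F m x)) \<longlonglongrightarrow> enn2real (S x)"
          using elim by (intro tendsto_enn2real) auto
        moreover have "incseq (\<lambda>m. enn2real (F m x))"
          using incx[of x] elim le[of _ x]
          by (auto simp: incseq_def intro!: enn2real_mono intro: le_less_trans)
        ultimately show ?case by simp
      qed
    qed measurable
    moreover have "N (\<lambda>x. of_real (enn2real (F n x))) = E (F n)" for n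
      using AEfin le[of n]
      by (intro ext_norm_real_eq[symmetric]) (auto elim!: eventually_mono intro: le_less_trans)
    moreover have "N (\<lambda>x. of_real (enn2real (S x))) = E S"
      using AEfin by (intro ext_norm_real_eq[symmetric]) auto
    ultimately have "E S \<le> c" using c by (intro LIMSEQ_le_const2) auto
    then show ?thesis unfolding S_def c_def .
  next
    case True
    then have "(SUP n. E (F n)) = top" by (simp only: c_def)
    then show ?thesis by (simp only: top_greatest)
  qed
qed

lemma ext_norm_Fatou:
  assumes [measurable]: "\<And>n. F n \<in> borel_measurable M"
  shows "E (\<lambda>x. liminf (\<lambda>n. F n x)) \<le> liminf (\<lambda>n. E (F n))"
proof -
  have "E (\<lambda>x. liminf (\<lambda>n. F n x)) = E (\<lambda>x. SUP n. INF m\<in>{n..}. F m x)"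
    by (simp add: liminf_SUP_INF)
  also have "\<dots> = (SUP n. E (\<lambda>x. INF m\<in>{n..}. F m x))"
    by (intro ext_norm_monotone_convergence)
      (auto simp: incseq_def le_fun_def intro!: INF_superset_mono borel_measurable_INF)
  also have "\<dots> \<le> liminf (\<lambda>n. E (F n))"
    unfolding liminf_SUP_INF
    by (intro SUP_mono') (auto intro!: INF_greatest ext_norm_mono AE_I2 INF_lower)
  finally show ?thesis .
qed

text \<open>
  A majorant of \<open>F\<close> corresponds to a majorant of its power, so that the formula defining the norm of
  \<open>Y\<^sup>t\<close> carries over to extended functions.
\<close>

lemma ext_norm_convexif:
  assumes t: "0 < t"
  shows "ext_norm M (convexif N t) F = epowr (ext_norm M N (\<lambda>x. epowr (F x) t)) (1 / t)"
proof (rule antisym)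
  have "epowr (ext_norm M (convexif N t) F) t \<le> ext_norm M N (\<lambda>x. epowr (F x) t)"
    unfolding ext_norm_def[of M N]
  proof (rule INF_greatest, clarify)
    fix g :: "'a \<Rightarrow> complex" assume [measurable]: "g \<in> borel_measurable M"
      and le: "AE x in M. epowr (F x) t \<le> ennreal (cmod (g x))"
    let ?h = "\<lambda>x. complex_of_real (cmod (g x) powr (1 / t))"
    show "epowr (ext_norm M (convexif N t) F) t \<le> N g"
    proof -
      have "ext_norm M (convexif N t) F \<le> convexif N t ?h"
        unfolding ext_norm_def
      proof (rule INF_lower, safe)
        show "AE x in M. F x \<le> ennreal (cmod (?h x))"
          using le
        proof eventually_elim
          case (elim x)
          then show ?case using t by (simp add: epowr_le_iff epowr_ennreal)
        qed
      qed measurable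
      also have "\<dots> = epowr (N (\<lambda>x. of_real (cmod (g x)))) (1 / t)"
        using t unfolding convexif_def by (simp add: powr_powr)
      also have "\<dots> \<le> epowr (N g) (1 / t)"
        using t by (intro epowr_mono norm_mono) auto
      finally show ?thesis using t by (simp add: epowr_le_iff)
    qed
  qed
  then show "ext_norm M (convexif N t) F \<le> epowr (ext_norm M N (\<lambda>x. epowr (F x) t)) (1 / t)"
    using t by (simp add: epowr_le_iff)
next
  show "epowr (ext_norm M N (\<lambda>x. epowr (F x) t)) (1 / t) \<le> ext_norm M (convexif N t) F"
    unfolding ext_norm_def[of M "convexif N t"]
  proof (rule INF_greatest, clarify)
    fix g :: "'a \<Rightarrow> complex" assume [measurable]: "g \<in> borel_measurable M"
      and le: "AE x in M. F x \<le> ennreal (cmod (g x))"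
    have "ext_norm M N (\<lambda>x. epowr (F x) t) \<le> N (\<lambda>x. of_real (cmod (g x) powr t))"
      unfolding ext_norm_def
    proof (rule INF_lower, safe)
      show "AE x in M. epowr (F x) t \<le> ennreal (cmod (complex_of_real (cmod (g x) powr t)))"
        using le
      proof eventually_elim
        case (elim x)
        then show ?case using epowr_mono[of t "F x" "ennreal (cmod (g x))"] t by (simp add: epowr_ennreal)
      qed
    qed measurable
    then show "epowr (ext_norm M N (\<lambda>x. epowr (F x) t)) (1 / t) \<le> convexif N t g"
      unfolding convexif_def using t by (intro epowr_mono) auto
  qed
qed

end

section \<open>Separation by projection in \<open>L\<^sup>2\<close>\<close>

text \<open>
  A bounded function \<open>f\<close> outside a convex, solid and closed class \<open>P\<close> of nonnegative functions is separated
  from \<open>P\<close> by a nonnegative density \<open>h\<close>: \<open>P\<close> contains an \<open>L\<^sup>2\<close>-nearest point \<open>g0\<close> to \<open>f\<close>,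
  and \<open>h = f - g0\<close> separates, by the variational inequality
  \<open>\<integral> h (u - g0) \<le> 0\<close> for \<open>u\<close> in \<open>P\<close>. Since \<open>min g f\<close> is at least as close to \<open>f\<close> as \<open>g\<close>, solidity
  allows the minimization to run over functions between \<open>0\<close> and \<open>f\<close>; then \<open>h\<close> is nonnegative and bounded, and
  all functions that occur are integrable.
\<close>

lemma L2_separation:
  fixes f :: "'a \<Rightarrow> real" and P :: "('a \<Rightarrow> real) \<Rightarrow> bool"
  assumes B [measurable]: "B \<in> sets M" and finB: "emeasure M B < \<infinity>"
    and f [measurable]: "f \<in> borel_measurable M"
    and f0: "\<And>x. 0 \<le> f x" and fb: "\<And>x. f x \<le> b" and fB: "\<And>x. x \<notin> B \<Longrightarrow> f x = 0"
    and zero: "P (\<lambda>x. 0)"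
    and meas: "\<And>g. P g \<Longrightarrow> g \<in> borel_measurable M"
    and nonneg: "\<And>g x. P g \<Longrightarrow> 0 \<le> g x"
    and convex: "\<And>g h t. P g \<Longrightarrow> P h \<Longrightarrow> 0 < t \<Longrightarrow> t < 1 \<Longrightarrow> P (\<lambda>x. (1 - t) * g x + t * h x)"
    and solid: "\<And>g h. P g \<Longrightarrow> h \<in> borel_measurable M \<Longrightarrow> (\<And>x. 0 \<le> h x) \<Longrightarrow> (\<And>x. h x \<le> g x) \<Longrightarrow> P h"
    and closed: "\<And>g h. (\<And>n::nat. P (g n)) \<Longrightarrow> h \<in> borel_measurable M \<Longrightarrow> (\<And>x. 0 \<le> h x) \<Longrightarrow>
        (AE x in M. (\<lambda>n. g n x) \<longlonglongrightarrow> h x) \<Longrightarrow> P h"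
    and notf: "\<not> P f"
  obtains h a where "h \<in> borel_measurable M" "\<And>x. 0 \<le> h x" "\<And>x. h x \<le> b" "\<And>x. x \<notin> B \<Longrightarrow> h x = 0" "0 \<le> a"
    "\<And>g. P g \<Longrightarrow> (\<integral>\<^sup>+x. ennreal (h x * g x) \<partial>M) \<le> ennreal a"
    "ennreal a < (\<integral>\<^sup>+x. ennreal (h x * f x) \<partial>M)"
proof -
  have int: "integrable M u" if "u \<in> borel_measurable M" "\<And>x. \<bar>u x\<bar> \<le> c" "\<And>x. x \<notin> B \<Longrightarrow> u x = 0" for u :: "'a \<Rightarrow> real" and c
    using that finB by (intro integrableI_bounded_set[OF B, where B = c]) auto
  have b0: "0 \<le> b" using f0 fb order_trans by blast
  define K where "K = {g. P g \<and> (\<forall>x. g x \<le> f x)}"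
  define d where "d g = (\<integral>x. (f x - g x)\<^sup>2 \<partial>M)" for g
  define D where "D = (INF g\<in>K. d g)"
  have Km: "g \<in> K \<Longrightarrow> g \<in> borel_measurable M" for g unfolding K_def using meas by auto
  have K0: "g \<in> K \<Longrightarrow> 0 \<le> g x" "g \<in> K \<Longrightarrow> g x \<le> f x" for g x unfolding K_def using nonneg by auto
  have Kz: "(\<lambda>x. 0) \<in> K" unfolding K_def using zero f0 by auto
  have KB: "g \<in> K \<Longrightarrow> x \<notin> B \<Longrightarrow> g x = 0" for g x using K0[of g x] fB[of x] by auto
  have sq: "(u::real)\<^sup>2 \<le> b\<^sup>2" if "\<bar>u\<bar> \<le> b" for u using that by (simp add: abs_le_square_iff[symmetric] b0)
  have diff: "\<bar>u x - v x\<bar> \<le> b" if "u = f \<or> u \<in> K" "v = f \<or> v \<in> K" for u v x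
    using that K0[of u x] K0[of v x] f0[of x] fb[of x] by auto
  have intK: "integrable M (\<lambda>x. (u x - v x)\<^sup>2)" if "u = f \<or> u \<in> K" "v = f \<or> v \<in> K" for u v
  proof (rule int)
    show "\<bar>(u x - v x)\<^sup>2\<bar> \<le> b\<^sup>2" for x using sq[OF diff[OF that]] by simp
    show "(\<lambda>x. (u x - v x)\<^sup>2) \<in> borel_measurable M" 
    proof -
      have [measurable]: "u \<in> borel_measurable M" "v \<in> borel_measurable M" using that Km by auto
      show ?thesis by measurable
    qed
    show "(u x - v x)\<^sup>2 = 0" if "x \<notin> B" for x
      using \<open>u = f \<or> u \<in> K\<close> \<open>v = f \<or> v \<in> K\<close> KB[of u x] KB[of v x] fB[of x] that by auto
  qed
  have dnn: "0 \<le> d g" for g unfolding d_def by simp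
  have bdd: "bdd_below (d ` K)" by (rule bdd_belowI2[of _ 0]) (rule dnn)
  have Dle: "g \<in> K \<Longrightarrow> D \<le> d g" for g unfolding D_def by (intro cINF_lower bdd)
  have Dnn: "0 \<le> D" unfolding D_def using Kz by (intro cINF_greatest dnn) auto
  have "\<exists>g\<in>K. d g < D + 1 / (real n + 1)" for n
    using cINF_less_iff[OF _ bdd, of "D + 1 / (real n + 1)"] Kz unfolding D_def[symmetric] by auto
  then obtain g where gK: "\<And>n. g n \<in> K" and gd: "\<And>n. d (g n) < D + 1 / (real n + 1)" by metis
  have [measurable]: "g n \<in> borel_measurable M" for n using Km gK by auto
  \<comment> \<open>the parallelogram identity makes every minimizing sequence Cauchy\<close>
  have cauchy2: "(\<integral>x. (g i x - g j x)\<^sup>2 \<partial>M) \<le> 2 / (real i + 1) + 2 / (real j + 1)" for i j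
  proof -
    define m where "m x = (1 - 1/2) * g i x + (1/2) * g j x" for x
    have mP: "P m" unfolding m_def using gK by (intro convex) (auto simp: K_def)
    have mK: "m \<in> K" unfolding K_def
    proof (safe intro!: mP)
      show "m x \<le> f x" for x using K0(2)[OF gK[of i], of x] K0(2)[OF gK[of j], of x] by (auto simp: m_def)
    qed
    have "(\<integral>x. (g i x - g j x)\<^sup>2 \<partial>M) = (\<integral>x. 2 * (f x - g i x)\<^sup>2 + 2 * (f x - g j x)\<^sup>2 - 4 * (f x - m x)\<^sup>2 \<partial>M)"
      by (intro Bochner_Integration.integral_cong) (auto simp: m_def power2_eq_square algebra_simps)
    also have "\<dots> = 2 * d (g i) + 2 * d (g j) - 4 * d m"
      unfolding d_def using intK[of f] gK mK by simp
    also have "\<dots> \<le> 2 * (D + 1 / (real i + 1)) + 2 * (D + 1 / (real j + 1)) - 4 * D"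
      using gd[of i] gd[of j] Dle[OF mK] by (intro diff_mono add_mono mult_left_mono) auto
    finally show ?thesis by simp
  qed
  have gint: "integrable M (g n)" for n
    using gK[of n] K0[of "g n"] fb f0 KB
    by (intro int[where c=b]) (auto intro: order_trans)
  obtain r where r: "strict_mono r" and AEc: "AE x in M. Cauchy (\<lambda>i. g (r i) x)"
  proof (rule cauchy_L1_AE_cauchy_subseq[OF gint])
    fix e :: real assume e: "0 < e"
    \<comment> \<open>pass from \<open>L\<^sup>2\<close> to \<open>L\<^sup>1\<close> on the set \<open>B\<close> of finite measure by \<open>\<bar>u\<bar> \<le> t + u\<^sup>2/t\<close>\<close>
    define t where "t = e / (2 * (measure M B + 1))"
    have mB: "0 < measure M B + 1" using measure_nonneg[of M B] by linarith
    have t: "0 < t" unfolding t_def using e mB by simp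
    obtain n0 :: nat where n0: "8 / (e * t) < real n0" using reals_Archimedean2 by blast
    have "(LINT x|M. norm (g i x - g j x)) < e" if ij: "n0 \<le> i" "n0 \<le> j" for i j
    proof -
      have pt: "\<bar>u\<bar> \<le> t + u\<^sup>2 / t" for u :: real
      proof (cases "\<bar>u\<bar> \<le> t")
        case False
        then have "\<bar>u\<bar> * t \<le> \<bar>u\<bar> * \<bar>u\<bar>" using t by (intro mult_left_mono) auto
        then have "\<bar>u\<bar> \<le> u\<^sup>2 / t" using t by (simp add: field_simps power2_eq_square)
        then show ?thesis using t by linarith
      qed (use t in \<open>simp add: add_increasing2\<close>)
      have i2: "integrable M (\<lambda>x. (g i x - g j x)\<^sup>2)" using intK[of "g i" "g j"] gK by auto
      have iB: "integrable M (\<lambda>x. t * indicator B x)" using finB by (simp add: integrable_real_indicator)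
      have "(LINT x|M. norm (g i x - g j x)) \<le> (\<integral>x. t * indicator B x + (g i x - g j x)\<^sup>2 / t \<partial>M)"
      proof (rule integral_mono)
        show "norm (g i x - g j x) \<le> t * indicator B x + (g i x - g j x)\<^sup>2 / t" for x
          using pt[of "g i x - g j x"] KB[OF gK[of i], of x] KB[OF gK[of j], of x] by (cases "x \<in> B") auto
        show "integrable M (\<lambda>x. t * indicator B x + (g i x - g j x)\<^sup>2 / t)"
          using iB i2 by (intro Bochner_Integration.integrable_add) auto
      qed (use gint in auto)
      also have "\<dots> = t * measure M B + (\<integral>x. (g i x - g j x)\<^sup>2 \<partial>M) / t"
        using iB i2 B by simp
      also have "\<dots> \<le> t * measure M B + (4 / (real n0 + 1)) / t"
      proof -
        have "2 / (real i + 1) + 2 / (real j + 1) \<le> 2 / (real n0 + 1) + 2 / (real n0 + 1)"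
          using ij by (intro add_mono divide_left_mono) auto
        then show ?thesis using cauchy2[of i j] t by (intro add_left_mono divide_right_mono) auto
      qed
      also have "\<dots> < e"
      proof -
        have "t * measure M B \<le> t * (measure M B + 1)" using t by simp
        also have "\<dots> = e / 2" using mB by (simp add: t_def field_simps)
        finally have 1: "t * measure M B \<le> e / 2" .
        have "0 < e * t" "8 < real n0 * (e * t)" using n0 e t by (auto simp: field_simps)
        then have "8 < (real n0 + 1) * (e * t)" by (simp add: distrib_right)
        then have "8 < e * ((real n0 + 1) * t)" by (simp only: mult_ac)
        moreover have "0 < (real n0 + 1) * t" using t by simp
        ultimately have "8 / ((real n0 + 1) * t) < e" by (simp only: pos_divide_less_eq)
        then have "(4 / (real n0 + 1)) / t < e / 2" by simp
        with 1 show ?thesis by linarith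
      qed
      finally show ?thesis .
    qed
    then show "\<exists>N. \<forall>i\<ge>N. \<forall>j\<ge>N. (LINT x|M. norm (g i x - g j x)) < e" by blast
  qed
  \<comment> \<open>where the subsequence diverges, the truncation still keeps \<open>g0\<close> between \<open>0\<close> and \<open>f\<close>\<close>
  define g0 where "g0 x = min (f x) (max 0 (lim (\<lambda>i. g (r i) x)))" for x
  have [measurable]: "g0 \<in> borel_measurable M" unfolding g0_def by measurable
  have g0: "0 \<le> g0 x" "g0 x \<le> f x" for x unfolding g0_def using f0 by auto
  have conv: "AE x in M. (\<lambda>i. g (r i) x) \<longlonglongrightarrow> g0 x"
    using AEc
  proof eventually_elim
    case (elim x)
    then have L: "(\<lambda>i. g (r i) x) \<longlonglongrightarrow> lim (\<lambda>i. g (r i) x)"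
      using real_Cauchy_convergent convergent_LIMSEQ_iff by blast
    have "0 \<le> lim (\<lambda>i. g (r i) x)" using L K0(1)[OF gK] by (intro LIMSEQ_le_const[OF L]) auto
    moreover have "lim (\<lambda>i. g (r i) x) \<le> f x" using L K0(2)[OF gK] by (intro LIMSEQ_le_const2[OF L]) auto
    ultimately have "g0 x = lim (\<lambda>i. g (r i) x)" unfolding g0_def by auto
    then show ?case using L by simp
  qed
  have Pg0: "P g0" using gK conv g0 by (intro closed[of "\<lambda>i. g (r i)" g0]) (auto simp: K_def)
  have g0K: "g0 \<in> K" using Pg0 g0 by (auto simp: K_def)
  have dg0: "d g0 = D"
  proof (rule LIMSEQ_unique)
    show "(\<lambda>i. d (g (r i))) \<longlonglongrightarrow> d g0"
      unfolding d_def
    proof (rule integral_dominated_convergence[where w = "\<lambda>x. b\<^sup>2 * indicator B x"])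
      show "AE x in M. (\<lambda>i. (f x - g (r i) x)\<^sup>2) \<longlonglongrightarrow> (f x - g0 x)\<^sup>2"
        using conv by eventually_elim (intro tendsto_intros)
      show "AE x in M. norm ((f x - g (r i) x)\<^sup>2) \<le> b\<^sup>2 * indicator B x" for i
        using sq[OF diff[of f "g (r i)"]] gK fB KB[OF gK] by (intro AE_I2) (auto simp: indicator_def)
    qed (use finB in \<open>auto simp: integrable_real_indicator\<close>)
    show "(\<lambda>i. d (g (r i))) \<longlonglongrightarrow> D"
    proof (rule tendsto_sandwich[of "\<lambda>_. D" _ _ "\<lambda>i. D + 1 / (real (r i) + 1)"])
      have "(\<lambda>n. D + 1 / (real n + 1)) \<longlonglongrightarrow> D + 0"
        using LIMSEQ_inverse_real_of_nat by (intro tendsto_intros) (simp add: inverse_eq_divide add_ac)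
      then show "(\<lambda>i. D + 1 / (real (r i) + 1)) \<longlonglongrightarrow> D"
        using LIMSEQ_subseq_LIMSEQ[OF _ r] by (fastforce simp: o_def)
      show "\<forall>\<^sub>F i in sequentially. d (g (r i)) \<le> D + 1 / (real (r i) + 1)"
        by (intro always_eventually allI less_imp_le gd)
    qed (use Dle gK in auto)
  qed
  define h where "h x = f x - g0 x" for x
  have [measurable]: "h \<in> borel_measurable M" unfolding h_def by measurable
  have h: "0 \<le> h x" "h x \<le> b" for x using g0[of x] fb[of x] by (auto simp: h_def)
  have hB: "x \<notin> B \<Longrightarrow> h x = 0" for x using fB[of x] g0[of x] by (simp add: h_def)
  have intprod: "integrable M (\<lambda>x. h x * u x)" if "u \<in> borel_measurable M" "\<And>x. \<bar>u x\<bar> \<le> c" for u c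
  proof (rule int)
    show "\<bar>h x * u x\<bar> \<le> b * c" for x
      unfolding abs_mult using h[of x] that(2)[of x] by (intro mult_mono) auto
  qed (use that hB in auto)
  define a where "a = (\<integral>x. h x * g0 x \<partial>M)"
  have a0: "0 \<le> a" unfolding a_def using h g0 by (intro integral_nonneg_AE AE_I2) auto
  have var: "(\<integral>x. h x * u x \<partial>M) \<le> a" if u: "P u" "\<And>x. u x \<le> c" "\<And>x. x \<notin> B \<Longrightarrow> u x = 0" for u c
  proof -
    have um [measurable]: "u \<in> borel_measurable M" using meas u by auto
    have u0: "0 \<le> u x" for x using nonneg u by auto
    have g0b: "\<bar>g0 x\<bar> \<le> b" for x using g0[of x] fb[of x] by auto
    have "0 \<le> c" using u0 u(2) order_trans by blast
    have ub: "\<bar>u x - g0 x\<bar> \<le> c + b" for x using u0[of x] u(2)[of x] g0b[of x] g0[of x] \<open>0 \<le> c\<close> b0 by auto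
    have ints: "integrable M (\<lambda>x. h x * (u x - g0 x))" by (rule intprod[OF _ ub]) measurable
    have intq: "integrable M (\<lambda>x. (u x - g0 x)\<^sup>2)"
    proof (rule int)
      show "\<bar>(u x - g0 x)\<^sup>2\<bar> \<le> (c + b)\<^sup>2" for x
        using ub[of x] abs_le_square_iff[of "u x - g0 x" "c + b"] by simp
      show "(u x - g0 x)\<^sup>2 = 0" if "x \<notin> B" for x
        using that u(3)[of x] KB[OF g0K, of x] by simp
    qed measurable
    have inth: "integrable M (\<lambda>x. (h x)\<^sup>2)" using intK[of f g0] g0K by (simp add: h_def)
    have "2 * (\<integral>x. h x * (u x - g0 x) \<partial>M) \<le> t * (\<integral>x. (u x - g0 x)\<^sup>2 \<partial>M)" if t: "0 < t" "t < 1" for t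
    proof -
      \<comment> \<open>move from \<open>g0\<close> a distance \<open>t\<close> towards \<open>u\<close> and compare the distances to \<open>f\<close>\<close>
      define w where "w x = (1 - t) * g0 x + t * u x" for x
      have Pw: "P w" unfolding w_def by (rule convex[OF Pg0 u(1) t])
      define w' where "w' x = min (w x) (f x)" for x
      have [measurable]: "w \<in> borel_measurable M" using meas Pw by auto
      have [measurable]: "w' \<in> borel_measurable M" unfolding w'_def by measurable
      have w0: "0 \<le> w x" for x using nonneg Pw by auto
      have w'K: "w' \<in> K"
        unfolding K_def
        by (safe intro!: solid[OF Pw, of w']) (use w0 f0 in \<open>auto simp: w'_def\<close>)
      have intw: "integrable M (\<lambda>x. (h x)\<^sup>2 - 2 * t * (h x * (u x - g0 x)) + t\<^sup>2 * (u x - g0 x)\<^sup>2)"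
        using inth ints intq by auto
      have "(\<integral>x. (h x)\<^sup>2 \<partial>M) = D" using dg0 by (simp add: d_def h_def)
      also have "D \<le> d w'" by (rule Dle[OF w'K])
      also have "\<dots> \<le> (\<integral>x. (h x)\<^sup>2 - 2 * t * (h x * (u x - g0 x)) + t\<^sup>2 * (u x - g0 x)\<^sup>2 \<partial>M)"
        unfolding d_def
      proof (rule integral_mono)
        fix x
        have "(f x - w' x)\<^sup>2 \<le> (f x - w x)\<^sup>2"
          by (auto simp: w'_def min_def)
        also have "\<dots> = (h x)\<^sup>2 - 2 * t * (h x * (u x - g0 x)) + t\<^sup>2 * (u x - g0 x)\<^sup>2"
          by (simp add: w_def h_def power2_eq_square algebra_simps)
        finally show "(f x - w' x)\<^sup>2 \<le> (h x)\<^sup>2 - 2 * t * (h x * (u x - g0 x)) + t\<^sup>2 * (u x - g0 x)\<^sup>2" .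
      qed (use intw intK[of f w'] w'K in auto)
      also have "\<dots> = (\<integral>x. (h x)\<^sup>2 \<partial>M) - 2 * t * (\<integral>x. h x * (u x - g0 x) \<partial>M) + t\<^sup>2 * (\<integral>x. (u x - g0 x)\<^sup>2 \<partial>M)"
        using inth ints intq by simp
      finally have "t * (2 * (\<integral>x. h x * (u x - g0 x) \<partial>M)) \<le> t * (t * (\<integral>x. (u x - g0 x)\<^sup>2 \<partial>M))"
        by (simp add: power2_eq_square algebra_simps)
      then show ?thesis using t by simp
    qed
    note small = this
    have "2 * (\<integral>x. h x * (u x - g0 x) \<partial>M) \<le> 0"
    proof (rule tendsto_lowerbound)
      show "((\<lambda>t. t * (\<integral>x. (u x - g0 x)\<^sup>2 \<partial>M)) \<longlongrightarrow> 0) (at_right 0)"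
        by (rule tendsto_eq_intros refl tendsto_ident_at)+ simp
      show "\<forall>\<^sub>F t in at_right 0. 2 * (\<integral>x. h x * (u x - g0 x) \<partial>M) \<le> t * (\<integral>x. (u x - g0 x)\<^sup>2 \<partial>M)"
        using small by (auto simp: eventually_at_right_field intro!: exI[of _ 1])
    qed simp
    moreover have "(\<integral>x. h x * (u x - g0 x) \<partial>M) = (\<integral>x. h x * u x \<partial>M) - a"
      unfolding a_def right_diff_distrib
      using u0 u(2) by (intro Bochner_Integration.integral_diff intprod[where c=c] intprod[where c=b] g0b) auto
    ultimately show ?thesis by simp
  qed
  show thesis
  proof (rule that[of h a])
    fix u assume u: "P u"
    have um [measurable]: "u \<in> borel_measurable M" using meas u by auto
    have u0: "0 \<le> u x" for x using nonneg u by auto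
    \<comment> \<open>a general \<open>u\<close> is the limit of bounded functions supported in \<open>B\<close>\<close>
    define v where "v k x = min (u x) (real k) * indicator B x" for k x
    have v: "P (v k)" "\<And>x. v k x \<le> real k" "\<And>x. x \<notin> B \<Longrightarrow> v k x = 0" for k
      unfolding v_def using u0 by (auto intro!: solid[OF u] simp: indicator_def)
    have vm [measurable]: "v k \<in> borel_measurable M" for k using meas v by auto
    have v0: "0 \<le> v k x" for k x using nonneg v by auto
    have lim: "(\<lambda>k. ennreal (h x * v k x)) \<longlonglongrightarrow> ennreal (h x * u x)" for x
    proof (rule tendsto_eventually)
      obtain k0 :: nat where "u x \<le> real k0" using real_arch_simple by blast
      then have "h x * v k x = h x * u x" if "k0 \<le> k" for k
        using that hB[of x] by (auto simp: v_def indicator_def)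
      then show "\<forall>\<^sub>F k in sequentially. ennreal (h x * v k x) = ennreal (h x * u x)"
        unfolding eventually_sequentially by metis
    qed
    have "(\<integral>\<^sup>+x. ennreal (h x * u x) \<partial>M) = (\<integral>\<^sup>+x. liminf (\<lambda>k. ennreal (h x * v k x)) \<partial>M)"
      using lim_imp_Liminf[OF sequentially_bot lim] by (intro nn_integral_cong) simp
    also have "\<dots> \<le> liminf (\<lambda>k. \<integral>\<^sup>+x. ennreal (h x * v k x) \<partial>M)"
      by (intro nn_integral_liminf) measurable
    also have "\<dots> \<le> liminf (\<lambda>k::nat. ennreal a)"
    proof (rule Liminf_mono, rule always_eventually, rule allI)
      fix k
      have "(\<integral>\<^sup>+x. ennreal (h x * v k x) \<partial>M) = ennreal (\<integral>x. h x * v k x \<partial>M)"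
        using h v0 v(2)[of k] by (intro nn_integral_eq_integral intprod[where c = "real k"] AE_I2) auto
      also have "\<dots> \<le> ennreal a" by (intro ennreal_leI var[OF v])
      finally show "(\<integral>\<^sup>+x. ennreal (h x * v k x) \<partial>M) \<le> ennreal a" .
    qed
    finally show "(\<integral>\<^sup>+x. ennreal (h x * u x) \<partial>M) \<le> ennreal a" by (simp add: Liminf_const)
  next
    have fbb: "\<bar>f x\<bar> \<le> b" for x using f0[of x] fb[of x] by simp
    have inth: "integrable M (\<lambda>x. (h x)\<^sup>2)" using intK[of f g0] g0K by (simp add: h_def)
    have hf: "(\<integral>\<^sup>+x. ennreal (h x * f x) \<partial>M) = ennreal (\<integral>x. h x * f x \<partial>M)"
      using h f0 by (intro nn_integral_eq_integral intprod[OF _ fbb]) auto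
    have "(\<integral>x. (h x)\<^sup>2 \<partial>M) \<noteq> 0"
    proof
      assume "(\<integral>x. (h x)\<^sup>2 \<partial>M) = 0"
      then have "AE x in M. (h x)\<^sup>2 = 0"
        using integral_nonneg_eq_0_iff_AE[OF inth] by simp
      then have "AE x in M. (\<lambda>n::nat. g0 x) \<longlonglongrightarrow> f x"
        by eventually_elim (simp add: h_def)
      then have "P f" using Pg0 f0 by (intro closed[of "\<lambda>_. g0" f]) auto
      then show False using notf by simp
    qed
    moreover have "0 \<le> (\<integral>x. (h x)\<^sup>2 \<partial>M)" by simp
    ultimately have pos: "0 < (\<integral>x. (h x)\<^sup>2 \<partial>M)" by linarith
    have "(\<integral>x. h x * f x \<partial>M) = (\<integral>x. (h x)\<^sup>2 + h x * g0 x \<partial>M)"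
      by (intro Bochner_Integration.integral_cong) (auto simp: h_def power2_eq_square algebra_simps)
    also have "\<dots> = (\<integral>x. (h x)\<^sup>2 \<partial>M) + a"
      unfolding a_def using g0 fb by (intro Bochner_Integration.integral_add inth intprod[where c=b]) (auto intro: order_trans)
    finally have "a < (\<integral>x. h x * f x \<partial>M)" using pos by simp
    then show "ennreal a < (\<integral>\<^sup>+x. ennreal (h x * f x) \<partial>M)" unfolding hf using a0 by (simp add: ennreal_lessI)
  qed (use h hB a0 in auto)
qed

section \<open>Doubling spaces\<close>

text \<open>
  The constants of the quasi-triangle inequality and of the doubling condition are fixed as parameters
  \<open>K\<close> and \<open>L\<close>.
\<close>

locale doubling_space =
  fixes M :: "'a measure" and \<rho> :: "'a \<Rightarrow> 'a \<Rightarrow> real" and K L :: real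
  assumes K1: "1 \<le> K" and L1: "1 \<le> L"
    and space_nonempty: "space M \<noteq> {}"
    and dist_nonneg: "x \<in> space M \<Longrightarrow> y \<in> space M \<Longrightarrow> 0 \<le> \<rho> x y"
    and dist_eq_0: "x \<in> space M \<Longrightarrow> y \<in> space M \<Longrightarrow> \<rho> x y = 0 \<longleftrightarrow> x = y"
    and dist_sym: "x \<in> space M \<Longrightarrow> y \<in> space M \<Longrightarrow> \<rho> x y = \<rho> y x"
    and dist_triangle: "x \<in> space M \<Longrightarrow> y \<in> space M \<Longrightarrow> z \<in> space M \<Longrightarrow> \<rho> x z \<le> K * (\<rho> x y + \<rho> y z)"
    and ball_sets': "x \<in> space M \<Longrightarrow> 0 < r \<Longrightarrow> qball (space M) \<rho> x r \<in> sets M"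
    and ball_pos': "x \<in> space M \<Longrightarrow> 0 < r \<Longrightarrow> 0 < emeasure M (qball (space M) \<rho> x (2 * r))"
    and ball_doubling': "x \<in> space M \<Longrightarrow> 0 < r \<Longrightarrow>
      emeasure M (qball (space M) \<rho> x (2 * r)) \<le> ennreal L * emeasure M (qball (space M) \<rho> x r)"
    and ball_finite': "x \<in> space M \<Longrightarrow> 0 < r \<Longrightarrow> ennreal L * emeasure M (qball (space M) \<rho> x r) < \<infinity>"

lemma homogeneous_type_doubling_space:
  assumes "homogeneous_type M \<rho>"
  obtains K L where "doubling_space M \<rho> K L"
proof -
  note H = assms[unfolded homogeneous_type_def quasi_metric_def]
  note Q = H[THEN conjunct1]
  note X1 = Q[THEN conjunct1] and X2 = Q[THEN conjunct2, THEN conjunct1]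
    and X3 = Q[THEN conjunct2, THEN conjunct2, THEN conjunct1]
    and X4 = Q[THEN conjunct2, THEN conjunct2, THEN conjunct2, THEN conjunct1]
    and X5 = H[THEN conjunct2, THEN conjunct1]
  from Q[THEN conjunct2, THEN conjunct2, THEN conjunct2, THEN conjunct2] obtain K where K: "1 \<le> K"
    "\<forall>x\<in>space M. \<forall>y\<in>space M. \<forall>z\<in>space M. \<rho> x z \<le> K * (\<rho> x y + \<rho> y z)"
    by (elim conjE exE)
  from H[THEN conjunct2, THEN conjunct2] obtain L :: real where L: "1 \<le> L" "\<forall>x\<in>space M. \<forall>r>0.
        0 < emeasure M (qball (space M) \<rho> x (2 * r)) \<and>
        emeasure M (qball (space M) \<rho> x (2 * r)) \<le> ennreal L * emeasure M (qball (space M) \<rho> x r) \<and>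
        ennreal L * emeasure M (qball (space M) \<rho> x r) < \<infinity>"
    by (elim conjE exE)
  have "doubling_space M \<rho> K L"
  proof
    fix x r assume x: "x \<in> space M" and r: "0 < (r :: real)"
    show "qball (space M) \<rho> x r \<in> sets M" by (rule X5[rule_format, OF x r])
    note L2 = L(2)[rule_format, OF x r]
    show "0 < emeasure M (qball (space M) \<rho> x (2 * r))" by (rule L2[THEN conjunct1])
    show "emeasure M (qball (space M) \<rho> x (2 * r)) \<le> ennreal L * emeasure M (qball (space M) \<rho> x r)"
      by (rule L2[THEN conjunct2, THEN conjunct1])
    show "ennreal L * emeasure M (qball (space M) \<rho> x r) < \<infinity>"
      by (rule L2[THEN conjunct2, THEN conjunct2])
  next
    fix x y assume x: "x \<in> space M" and y: "y \<in> space M"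
    show "0 \<le> \<rho> x y" by (rule X2[rule_format, OF x y])
    show "\<rho> x y = 0 \<longleftrightarrow> x = y" by (rule X3[rule_format, OF x y])
    show "\<rho> x y = \<rho> y x" by (rule X4[rule_format, OF x y])
    fix z assume z: "z \<in> space M"
    show "\<rho> x z \<le> K * (\<rho> x y + \<rho> y z)" by (rule K(2)[rule_format, OF x y z])
  qed (fact X1 K(1) L(1))+
  then show thesis by (rule that)
qed

context doubling_space
begin

abbreviation "qb \<equiv> qball (space M) \<rho>"
abbreviation "V x r \<equiv> measure M (qb x r)"

lemma ball_nonpos: "x \<in> space M \<Longrightarrow> r \<le> 0 \<Longrightarrow> qb x r = {}"
  using dist_nonneg by (force simp: qball_def)

lemma ball_sets [measurable]: "x \<in> space M \<Longrightarrow> qb x r \<in> sets M"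
  using ball_sets'[of x r] ball_nonpos[of x r] by (cases "0 < r") auto

lemma ball_finite: "x \<in> space M \<Longrightarrow> emeasure M (qb x r) < \<infinity>"
proof (cases "0 < r")
  case True
  assume x: "x \<in> space M"
  have "1 * emeasure M (qb x r) \<le> ennreal L * emeasure M (qb x r)"
    using L1 by (intro mult_right_mono) auto
  with ball_finite'[OF x True] show ?thesis by (auto simp: le_less_trans)
qed (simp add: ball_nonpos)

lemma emeasure_ball: "x \<in> space M \<Longrightarrow> emeasure M (qb x r) = ennreal (V x r)"
  using ball_finite[of x r] by (intro emeasure_eq_ennreal_measure) auto

lemma V_pos: "x \<in> space M \<Longrightarrow> 0 < r \<Longrightarrow> 0 < V x r"
  using ball_pos'[of x "r / 2"] by (simp add: emeasure_ball)

lemma V_mono: "x \<in> space M \<Longrightarrow> y \<in> space M \<Longrightarrow> qb x r \<subseteq> qb y t \<Longrightarrow> V x r \<le> V y t"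
  using ball_finite[of y t] by (intro measure_mono_fmeasurable fmeasurableI) auto

lemma V_mono_radius: "x \<in> space M \<Longrightarrow> r \<le> t \<Longrightarrow> V x r \<le> V x t"
  by (intro V_mono) (auto simp: qball_def)

lemma V_doubling: "x \<in> space M \<Longrightarrow> 0 < r \<Longrightarrow> V x (2 * r) \<le> L * V x r"
  using ball_doubling'[of x r] L1 by (simp add: emeasure_ball flip: ennreal_mult')

lemma V_doubling_power: "x \<in> space M \<Longrightarrow> 0 < r \<Longrightarrow> V x (2 ^ n * r) \<le> L ^ n * V x r"
proof (induction n)
  case (Suc n)
  have "V x (2 ^ Suc n * r) \<le> L * V x (2 ^ n * r)"
    using V_doubling[of x "2 ^ n * r"] Suc.prems by (simp add: mult.assoc)
  also have "\<dots> \<le> L * (L ^ n * V x r)" using Suc L1 by (intro mult_left_mono) auto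
  finally show ?case by (simp add: mult.assoc)
qed simp

text \<open>
  A bound for the factor by which the measure of a ball grows when its radius is multiplied by \<open>c\<close>.
\<close>

definition dbl :: "real \<Rightarrow> real" where
  "dbl c = L ^ (SOME n. c \<le> 2 ^ n)"

lemma dbl_ge_1: "1 \<le> dbl c"
  unfolding dbl_def using L1 by (rule one_le_power)

lemma dbl_pos: "0 < dbl c"
  using dbl_ge_1[of c] by linarith

lemma V_scale_le: "x \<in> space M \<Longrightarrow> 0 < r \<Longrightarrow> V x (c * r) \<le> dbl c * V x r"
proof -
  assume *: "x \<in> space M" "0 < r"
  define n where "n = (SOME n. c \<le> 2 ^ n)"
  obtain m where "c < 2 ^ m" using real_arch_pow[of 2 c] by auto
  then have n: "c \<le> 2 ^ n" unfolding n_def by (metis (mono_tags, lifting) less_imp_le someI)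
  have "V x (c * r) \<le> V x (2 ^ n * r)" using n * by (intro V_mono_radius) auto
  also have "\<dots> \<le> L ^ n * V x r" by (rule V_doubling_power[OF *])
  finally show ?thesis by (simp add: dbl_def n_def)
qed

lemma ball_engulf:
  assumes "x \<in> space M" "y \<in> space M" "\<rho> x y \<le> a" "K * (a + r) \<le> t"
  shows "qb y r \<subseteq> qb x t"
proof
  fix z assume z: "z \<in> qb y r"
  then have zs: "z \<in> space M" "\<rho> y z < r" by (auto simp: qball_def)
  have "\<rho> x z \<le> K * (\<rho> x y + \<rho> y z)" using assms zs by (intro dist_triangle)
  also have "\<dots> < K * (a + r)" using assms zs K1 by (intro mult_strict_left_mono) auto
  finally show "z \<in> qb x t" using zs assms by (auto simp: qball_def)
qed

lemma dist_measurable: "x \<in> space M \<Longrightarrow> (\<lambda>y. \<rho> x y) \<in> borel_measurable M"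
proof (subst borel_measurable_iff_less, rule allI)
  fix a assume "x \<in> space M"
  then show "{w \<in> space M. \<rho> x w < a} \<in> sets M"
    using ball_sets[of x a] by (simp add: qball_def)
qed

lemma V_dist_measurable: "x \<in> space M \<Longrightarrow> (\<lambda>y. V x (\<rho> x y)) \<in> borel_measurable M"
proof -
  assume x: "x \<in> space M"
  have "(\<lambda>r. V x r) \<in> borel_measurable borel"
    using x by (intro borel_measurable_mono monoI V_mono_radius)
  then show ?thesis
    using dist_measurable[OF x] by (rule measurable_compose[rotated])
qed

end

section \<open>Averaging operators\<close>

text \<open>
  For a set \<open>X\<close> of finite positive measure, \<open>F \<mapsto> \<mu>(X)\<^sup>-\<^sup>1 (\<integral>\<^sub>X F) 1\<^sub>X\<close> averages over \<open>X\<close>; an averaging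
  operator is a nonnegative combination of countably many such maps. The averages over balls centred at the
  variable point \<open>x\<close> are avoided on purpose: neither \<open>x \<mapsto> \<mu>(B(x,r))\<close> nor the set of pairs at distance
  less than \<open>r\<close> has to be measurable, whereas a countable sum of fixed balls is measurable, and exchanging
  the order of integration reduces to exchanging an integral with a countable sum.
\<close>

definition avg_op :: "'a measure \<Rightarrow> 'i set \<Rightarrow> ('i \<Rightarrow> ennreal) \<Rightarrow> ('i \<Rightarrow> 'a set) \<Rightarrow> ('a \<Rightarrow> ennreal) \<Rightarrow> 'a \<Rightarrow> ennreal" where
  "avg_op M I c S F x = (\<integral>\<^sup>+i. c i * indicator (S i) x * (\<integral>\<^sup>+y. F y * indicator (S i) y \<partial>M) \<partial>count_space I)"

definition avg_kernel :: "'i set \<Rightarrow> ('i \<Rightarrow> ennreal) \<Rightarrow> ('i \<Rightarrow> 'a set) \<Rightarrow> 'a \<Rightarrow> 'a \<Rightarrow> ennreal" where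
  "avg_kernel I c S x y = (\<integral>\<^sup>+i. c i * indicator (S i) x * indicator (S i) y \<partial>count_space I)"

context
  fixes M :: "'a measure" and I :: "'i set" and c :: "'i \<Rightarrow> ennreal" and S :: "'i \<Rightarrow> 'a set"
  assumes count: "countable I" and S [measurable]: "\<And>i. i \<in> I \<Longrightarrow> S i \<in> sets M"
begin

lemma measurable_count_integral:
  fixes f :: "'b \<Rightarrow> 'i \<Rightarrow> ennreal"
  assumes "\<And>i. i \<in> I \<Longrightarrow> (\<lambda>x. f x i) \<in> borel_measurable N"
  shows "(\<lambda>x. \<integral>\<^sup>+i. f x i \<partial>count_space I) \<in> borel_measurable N"
proof -
  interpret sigma_finite_measure "count_space I"
    using count by (rule sigma_finite_measure_count_space_countable)
  have "(\<lambda>p. (\<lambda>(i, x). f x i) (snd p, fst p)) \<in> borel_measurable (N \<Otimes>\<^sub>M count_space I)"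
  proof (rule measurable_compose[where g = "\<lambda>(i, x). f x i" and N = "count_space I \<Otimes>\<^sub>M N"])
    show "(\<lambda>p. (snd p, fst p)) \<in> N \<Otimes>\<^sub>M count_space I \<rightarrow>\<^sub>M count_space I \<Otimes>\<^sub>M N" by measurable
    show "(\<lambda>(i, x). f x i) \<in> borel_measurable (count_space I \<Otimes>\<^sub>M N)"
      using assms by (intro measurable_pair_measure_countable1 count) auto
  qed
  then show ?thesis
    by (intro borel_measurable_nn_integral) (simp add: split_beta')
qed

lemma measurable_avg_op: "avg_op M I c S F \<in> borel_measurable M"
  unfolding avg_op_def by (intro measurable_count_integral) measurable

lemma measurable_avg_kernel: "avg_kernel I c S x \<in> borel_measurable M"
  unfolding avg_kernel_def by (intro measurable_count_integral) measurable

lemma avg_op_eq_kernel: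
  assumes [measurable]: "F \<in> borel_measurable M"
  shows "avg_op M I c S F x = (\<integral>\<^sup>+y. F y * avg_kernel I c S x y \<partial>M)"
proof -
  have "(\<integral>\<^sup>+y. F y * avg_kernel I c S x y \<partial>M)
      = (\<integral>\<^sup>+y. \<integral>\<^sup>+i. c i * indicator (S i) x * (F y * indicator (S i) y) \<partial>count_space I \<partial>M)"
    unfolding avg_kernel_def by (subst nn_integral_cmult[symmetric]) (auto simp: mult_ac)
  also have "\<dots> = (\<integral>\<^sup>+i. \<integral>\<^sup>+y. c i * indicator (S i) x * (F y * indicator (S i) y) \<partial>M \<partial>count_space I)"
    by (intro nn_integral_count_space_nn_integral count) measurable
  also have "\<dots> = avg_op M I c S F x"
    unfolding avg_op_def by (intro nn_integral_cong nn_integral_cmult) simp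
  finally show ?thesis by simp
qed

lemma avg_kernel_mass:
  "(\<integral>\<^sup>+y. avg_kernel I c S x y \<partial>M) = (\<integral>\<^sup>+i. c i * emeasure M (S i) * indicator (S i) x \<partial>count_space I)"
proof -
  have "(\<integral>\<^sup>+y. avg_kernel I c S x y \<partial>M) = (\<integral>\<^sup>+y. 1 * avg_kernel I c S x y \<partial>M)" by simp
  also have "\<dots> = avg_op M I c S (\<lambda>_. 1) x" by (rule avg_op_eq_kernel[symmetric]) simp
  also have "\<dots> = (\<integral>\<^sup>+i. c i * emeasure M (S i) * indicator (S i) x \<partial>count_space I)"
    unfolding avg_op_def by (intro nn_integral_cong) (simp add: mult_ac)
  finally show ?thesis .
qed

lemma avg_op_selfadjoint:
  assumes [measurable]: "F \<in> borel_measurable M" "H \<in> borel_measurable M"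
  shows "(\<integral>\<^sup>+x. H x * avg_op M I c S F x \<partial>M) = (\<integral>\<^sup>+x. F x * avg_op M I c S H x \<partial>M)"
proof -
  have *: "(\<integral>\<^sup>+x. H x * avg_op M I c S F x \<partial>M) =
      (\<integral>\<^sup>+i. c i * (\<integral>\<^sup>+y. F y * indicator (S i) y \<partial>M) * (\<integral>\<^sup>+y. H y * indicator (S i) y \<partial>M) \<partial>count_space I)"
    if [measurable]: "F \<in> borel_measurable M" "H \<in> borel_measurable M" for F H
  proof -
    have "(\<integral>\<^sup>+x. H x * avg_op M I c S F x \<partial>M) = (\<integral>\<^sup>+x. \<integral>\<^sup>+i. c i * (\<integral>\<^sup>+y. F y * indicator (S i) y \<partial>M) * (H x * indicator (S i) x) \<partial>count_space I \<partial>M)"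
      unfolding avg_op_def by (subst nn_integral_cmult[symmetric]) (auto simp: mult_ac)
    also have "\<dots> = (\<integral>\<^sup>+i. \<integral>\<^sup>+x. c i * (\<integral>\<^sup>+y. F y * indicator (S i) y \<partial>M) * (H x * indicator (S i) x) \<partial>M \<partial>count_space I)"
      by (intro nn_integral_count_space_nn_integral count) measurable
    also have "\<dots> = (\<integral>\<^sup>+i. c i * (\<integral>\<^sup>+y. F y * indicator (S i) y \<partial>M) * (\<integral>\<^sup>+y. H y * indicator (S i) y \<partial>M) \<partial>count_space I)"
      by (intro nn_integral_cong nn_integral_cmult) simp
    finally show ?thesis .
  qed
  show ?thesis using *[of F H] *[of H F] by (simp add: mult_ac)
qed

end

section \<open>Duality with the associate space\<close>

locale doubling_banach = doubling_space M \<rho> K L + ball_quasi_banach M \<rho> N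
  for M :: "'a measure" and \<rho> K L N +
  assumes triangle: "\<And>f g. f \<in> borel_measurable M \<Longrightarrow> g \<in> borel_measurable M \<Longrightarrow>
        N (\<lambda>x. f x + g x) \<le> N f + N g"
begin

lemma unit_ball_convex:
  assumes [measurable]: "f \<in> borel_measurable M" "g \<in> borel_measurable M"
    and "N f \<le> 1" "N g \<le> 1" "0 < t" "t < 1"
  shows "N (\<lambda>x. of_real (1 - t) * f x + of_real t * g x) \<le> 1"
proof -
  have "N (\<lambda>x. of_real (1 - t) * f x + of_real t * g x) \<le> N (\<lambda>x. of_real (1 - t) * f x) + N (\<lambda>x. of_real t * g x)"
    by (intro triangle) measurable
  also have "\<dots> = ennreal (1 - t) * N f + ennreal t * N g"
    using assms by (simp only: norm_cmult norm_of_real) simp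
  also have "\<dots> \<le> ennreal (1 - t) * 1 + ennreal t * 1"
    using assms by (intro add_mono mult_left_mono) auto
  also have "\<dots> = 1" using assms ennreal_plus[of "1 - t" t] by simp
  finally show ?thesis .
qed

text \<open>
  The nontrivial half of the Lorentz-Luxemburg theorem: the norm of a function is recovered from its
  pairings with the unit ball of the associate space. By the Fatou property \<open>F\<close> may be truncated to a
  bounded function on a ball without its norm dropping to \<open>1\<close>; then \<open>L\<^sup>2\<close>-separation from the unit ball applies.
  Dividing \<open>h\<close> by a number \<open>b\<close> strictly between the two separated values normalizes it.
\<close>

lemma duality_witness:
  assumes [measurable]: "F \<in> borel_measurable M" and F: "1 < E F"
  obtains h :: "'a \<Rightarrow> real" where "h \<in> borel_measurable M" "\<And>x. 0 \<le> h x"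
    "assoc_norm M N (\<lambda>x. of_real (h x)) \<le> 1" "1 < (\<integral>\<^sup>+x. ennreal (h x) * F x \<partial>M)"
proof -
  obtain x0 where x0: "x0 \<in> space M" using space_nonempty by auto
  define B where "B n = qb x0 (real n)" for n
  have B [measurable]: "B n \<in> sets M" for n unfolding B_def using x0 by measurable
  define G where "G n x = min (F x) (of_nat n) * indicator (B n) x" for n x
  have [measurable]: "G n \<in> borel_measurable M" for n unfolding G_def by measurable
  have incG: "incseq G"
    by (rule incseq_SucI)
       (auto simp: G_def le_fun_def B_def qball_def indicator_def min.coboundedI2 min_le_iff_disj)
  have supG: "F x = (SUP n. G n x)" if x: "x \<in> space M" for x
  proof (rule LIMSEQ_unique)
    obtain n0 :: nat where n0: "\<rho> x0 x < real n0" using reals_Archimedean2 by blast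
    have "(\<lambda>n. min (F x) (of_nat n)) \<longlonglongrightarrow> F x"
    proof (cases "F x")
      case (real r)
      obtain m :: nat where "r \<le> real m" using real_arch_simple by blast
      then have "min (F x) (of_nat n) = F x" if "m \<le> n" for n
        using real that by (auto simp: min_def ennreal_of_nat_eq_real_of_nat)
      then show ?thesis by (intro tendsto_eventually) (auto simp: eventually_sequentially)
    next
      case top
      then show ?thesis using of_nat_tendsto_top_ennreal by simp
    qed
    moreover have "\<forall>\<^sub>F n in sequentially. min (F x) (of_nat n) = G n x"
      using n0 x by (auto simp: eventually_sequentially G_def B_def qball_def indicator_def intro!: exI[of _ n0])
    ultimately show "(\<lambda>n. G n x) \<longlonglongrightarrow> F x" by (rule Lim_transform_eventually)
    show "(\<lambda>n. G n x) \<longlonglongrightarrow> (SUP n. G n x)"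
      using incG by (intro LIMSEQ_SUP) (auto simp: incseq_def le_fun_def)
  qed
  have "E F = E (\<lambda>x. SUP n. G n x)" using supG by (intro ext_norm_cong AE_I2) auto
  also have "\<dots> = (SUP n. E (G n))" by (intro ext_norm_monotone_convergence incG) measurable
  finally obtain n where n: "1 < E (G n)" using F by (auto simp: less_SUP_iff)
  define f where "f x = enn2real (G n x)" for x
  have fin: "G n x \<le> ennreal (real n)" for x
    by (auto simp: G_def indicator_def ennreal_of_nat_eq_real_of_nat)
  have fG: "ennreal (f x) = G n x" for x
    unfolding f_def using fin[of x] by (intro ennreal_enn2real) (auto intro: le_less_trans)
  have [measurable]: "f \<in> borel_measurable M" unfolding f_def by measurable
  define P where "P g \<longleftrightarrow> g \<in> borel_measurable M \<and> (\<forall>x. 0 \<le> g x) \<and> N (\<lambda>x. of_real (g x)) \<le> 1" for g :: "'a \<Rightarrow> real"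
  obtain h a where h [measurable]: "h \<in> borel_measurable M" and h0: "\<And>x. 0 \<le> h x" and "0 \<le> a"
    and ha: "\<And>g. P g \<Longrightarrow> (\<integral>\<^sup>+x. ennreal (h x * g x) \<partial>M) \<le> ennreal a"
    and af: "ennreal a < (\<integral>\<^sup>+x. ennreal (h x * f x) \<partial>M)"
  proof (rule L2_separation[of "B n" M f "real n" P])
    show "emeasure M (B n) < \<infinity>" unfolding B_def using x0 by (rule ball_finite)
    show "0 \<le> f x" for x by (simp add: f_def)
    show "f x \<le> real n" for x using fin[of x] unfolding fG[symmetric] by simp
    show "f x = 0" if "x \<notin> B n" for x using that by (simp add: f_def G_def)
    show "P (\<lambda>x. 0)" by (simp add: P_def norm_zero)
    show "P h" if P: "P g" and [measurable]: "h \<in> borel_measurable M" and h: "\<And>x. 0 \<le> h x" "\<And>x. h x \<le> g x" for g h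
    proof -
      have "N (\<lambda>x. of_real (h x)) \<le> N (\<lambda>x. of_real (g x))"
        using P h by (intro norm_mono) (auto simp: P_def abs_of_nonneg)
      then show ?thesis using P h by (auto simp: P_def)
    qed
    show "P h" if g: "\<And>n. P (g n)" and [measurable]: "h \<in> borel_measurable M" and h: "\<And>x. 0 \<le> h x"
      and lim: "AE x in M. (\<lambda>n. g n x) \<longlonglongrightarrow> h x" for g h
    proof -
      have [measurable]: "g n \<in> borel_measurable M" for n using g by (simp add: P_def)
      have "N (\<lambda>x. of_real (h x)) = E (\<lambda>x. ennreal (h x))"
        using h by (intro ext_norm_fun_real[symmetric]) auto
      also have "\<dots> = E (\<lambda>x. liminf (\<lambda>n. ennreal (g n x)))"
      proof (intro ext_norm_cong)
        show "AE x in M. ennreal (h x) = liminf (\<lambda>n. ennreal (g n x))"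
          using lim
        proof eventually_elim
          case (elim x)
          then show ?case
            using lim_imp_Liminf[OF sequentially_bot tendsto_ennrealI[OF elim]] by simp
        qed
      qed
      also have "\<dots> \<le> liminf (\<lambda>n. E (\<lambda>x. ennreal (g n x)))"
        by (rule ext_norm_Fatou) measurable
      also have "\<dots> \<le> liminf (\<lambda>n::nat. 1)"
        using g by (intro Liminf_mono always_eventually allI) (auto simp: P_def ext_norm_fun_real)
      finally show ?thesis using h by (simp add: P_def Liminf_const)
    qed
    show "\<not> P f"
    proof
      assume "P f"
      then have "E (\<lambda>x. ennreal (f x)) \<le> 1" by (simp add: P_def ext_norm_fun_real)
      then show False using n fG by simp
    qed
    show "P (\<lambda>x. (1 - t) * g x + t * h x)" if "P g" "P h" "0 < t" "t < 1" for g h t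
      using that unit_ball_convex[of "\<lambda>x. of_real (g x)" "\<lambda>x. of_real (h x)" t] by (auto simp: P_def)
  qed (auto simp: P_def)
  obtain b where b: "ennreal a < ennreal b" "ennreal b < (\<integral>\<^sup>+x. ennreal (h x * f x) \<partial>M)" "0 < b"
  proof -
    obtain z where z: "ennreal a < z" "z < (\<integral>\<^sup>+x. ennreal (h x * f x) \<partial>M)" using dense[OF af] by blast
    then obtain b where "z = ennreal b" "0 \<le> b" by (cases z) auto
    with z show thesis using that[of b] by (cases "b = 0") auto
  qed
  then have ab: "a < b" using \<open>0 \<le> a\<close> by (simp add: ennreal_less_iff)
  show thesis
  proof (rule that[of "\<lambda>x. h x / b"])
    show "assoc_norm M N (\<lambda>x. of_real (h x / b)) \<le> 1"
      unfolding assoc_norm_def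
    proof (rule SUP_least, clarify)
      fix g assume [measurable]: "g \<in> borel_measurable M" and "N g \<le> 1"
      have "N (\<lambda>x. of_real (cmod (g x))) \<le> N g" by (intro norm_mono) auto
      with \<open>N g \<le> 1\<close> have "P (\<lambda>x. cmod (g x))" by (auto simp: P_def)
      from ha[OF this] have *: "(\<integral>\<^sup>+x. ennreal (h x * cmod (g x)) \<partial>M) \<le> ennreal a" .
      have "(\<integral>\<^sup>+x. ennreal (cmod (of_real (h x / b) * g x)) \<partial>M) = (\<integral>\<^sup>+x. ennreal (1 / b) * ennreal (h x * cmod (g x)) \<partial>M)"
        using h0 \<open>0 < b\<close> by (intro nn_integral_cong) (simp add: norm_mult norm_divide flip: ennreal_mult')
      also have "\<dots> = ennreal (1 / b) * (\<integral>\<^sup>+x. ennreal (h x * cmod (g x)) \<partial>M)"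
        by (intro nn_integral_cmult) measurable
      also have "\<dots> \<le> ennreal (1 / b) * ennreal a" by (intro mult_left_mono *) simp
      also have "\<dots> \<le> 1" using ab \<open>0 \<le> a\<close> \<open>0 < b\<close> by (simp flip: ennreal_mult' ennreal_1)
      finally show "(\<integral>\<^sup>+x. ennreal (cmod (of_real (h x / b) * g x)) \<partial>M) \<le> 1" .
    qed
    have "1 = ennreal (1 / b) * ennreal b" using \<open>0 < b\<close> by (simp flip: ennreal_mult')
    also have "\<dots> < ennreal (1 / b) * (\<integral>\<^sup>+x. ennreal (h x * f x) \<partial>M)"
      using b by (intro ennreal_mult_strict_left_mono) auto
    also have "\<dots> = (\<integral>\<^sup>+x. ennreal (h x / b) * G n x \<partial>M)"
    proof (subst nn_integral_cmult[symmetric])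
      have f0: "0 \<le> f x" for x by (simp add: f_def)
      have "ennreal (1 / b) * ennreal (h x * f x) = ennreal (h x / b) * G n x" for x
        unfolding fG[symmetric] using f0[of x] h0[of x] \<open>0 < b\<close> by (subst (1 2) ennreal_mult[symmetric]) auto
      then show "(\<integral>\<^sup>+x. ennreal (1 / b) * ennreal (h x * f x) \<partial>M) = (\<integral>\<^sup>+x. ennreal (h x / b) * G n x \<partial>M)" by simp
    qed measurable
    also have "\<dots> \<le> (\<integral>\<^sup>+x. ennreal (h x / b) * F x \<partial>M)"
      by (intro nn_integral_mono mult_left_mono) (auto simp: G_def indicator_def)
    finally show "1 < (\<integral>\<^sup>+x. ennreal (h x / b) * F x \<partial>M)" .
  qed (use h0 \<open>0 < b\<close> in auto)
qed

lemma holder_assoc: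
  assumes [measurable]: "f \<in> borel_measurable M" "g \<in> borel_measurable M" and fin: "N f < top"
  shows "(\<integral>\<^sup>+x. ennreal (cmod (f x * g x)) \<partial>M) \<le> N f * assoc_norm M N g"
proof (cases "N f = 0")
  case True
  then have "AE x in M. f x = 0" by (intro norm_eq_0D) auto
  then have "(\<integral>\<^sup>+x. ennreal (cmod (f x * g x)) \<partial>M) = (\<integral>\<^sup>+x. 0 \<partial>M)"
    by (intro nn_integral_cong_AE) (auto elim!: eventually_mono)
  then show ?thesis by simp
next
  case False
  then obtain a where a: "N f = ennreal a" "0 < a" using fin by (cases "N f") (auto simp: less_le)
  have "N (\<lambda>x. of_real (1 / a) * f x) = 1"
    using a by (subst norm_cmult) (auto simp: norm_divide simp flip: ennreal_mult')
  then have "(\<integral>\<^sup>+x. ennreal (cmod (g x * (of_real (1 / a) * f x))) \<partial>M) \<le> assoc_norm M N g"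
    unfolding assoc_norm_def by (intro SUP_upper) auto
  then have "N f * (\<integral>\<^sup>+x. ennreal (cmod (g x * (of_real (1 / a) * f x))) \<partial>M) \<le> N f * assoc_norm M N g"
    by (intro mult_left_mono) auto
  moreover have "N f * (\<integral>\<^sup>+x. ennreal (cmod (g x * (of_real (1 / a) * f x))) \<partial>M) = (\<integral>\<^sup>+x. ennreal (cmod (f x * g x)) \<partial>M)"
    using a by (subst nn_integral_cmult[symmetric])
      (auto simp: norm_mult norm_divide field_simps simp flip: ennreal_mult' intro!: nn_integral_cong)
  ultimately show ?thesis by simp
qed

lemma holder_assoc_ext:
  assumes [measurable]: "F \<in> borel_measurable M" "g \<in> borel_measurable M" and fin: "E F < top"
  shows "(\<integral>\<^sup>+x. F x * ennreal (cmod (g x)) \<partial>M) \<le> E F * assoc_norm M N g"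
proof -
  have AEf: "AE x in M. F x < top" by (rule ext_norm_finite_AE[OF fin])
  let ?f = "\<lambda>x. complex_of_real (enn2real (F x))"
  have eq: "E F = N ?f" by (rule ext_norm_real_eq[OF _ AEf]) measurable
  have "(\<integral>\<^sup>+x. F x * ennreal (cmod (g x)) \<partial>M) = (\<integral>\<^sup>+x. ennreal (cmod (?f x * g x)) \<partial>M)"
    using AEf
    by (intro nn_integral_cong_AE) (auto elim!: eventually_mono simp: norm_mult ennreal_mult less_top)
  also have "\<dots> \<le> N ?f * assoc_norm M N g"
    using fin eq by (intro holder_assoc) auto
  finally show ?thesis by (simp add: eq)
qed

text \<open>
  An averaging operator \<open>T\<close> over balls, of total weight at most \<open>A\<close> at each point, is self-adjoint and
  satisfies \<open>T h \<le> A * maximal h\<close>, so that \<open>\<integral> h T F = \<integral> F T h \<le> A \<integral> F maximal h\<close>. If the norm of \<open>T F\<close> exceeded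
  the asserted bound, the function \<open>h\<close> provided by duality for a multiple of \<open>T F\<close> would contradict this
  estimate, by Hoelder's inequality and the bound for the maximal operator on the associate space.
\<close>

lemma avg_op_bounded:
  assumes I: "countable I" and S: "\<And>i. i \<in> I \<Longrightarrow> \<exists>z\<in>space M. \<exists>r>0. S i = qb z r"
    and A: "0 < A" "\<And>x. x \<in> space M \<Longrightarrow> (\<integral>\<^sup>+i. c i * emeasure M (S i) * indicator (S i) x \<partial>count_space I) \<le> ennreal A"
    and C: "0 < C" "maximal_opnorm M \<rho> (assoc_norm M N) \<le> ennreal C"
    and F [measurable]: "F \<in> borel_measurable M"
  shows "E (avg_op M I c S F) \<le> ennreal (A * C) * E F"
proof (rule ccontr)
  have S' [measurable]: "S i \<in> sets M" if "i \<in> I" for i using S[OF that] by auto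
  have T [measurable]: "avg_op M I c S F \<in> borel_measurable M" for F
    by (rule measurable_avg_op[OF I S'])
  let ?T = "avg_op M I c S"
  assume "\<not> E (?T F) \<le> ennreal (A * C) * E F"
  then obtain z where z: "ennreal (A * C) * E F < z" "z < E (?T F)" using dense by (auto simp: not_le)
  then obtain a where a: "z = ennreal a" "0 < a"
  proof -
    have "z \<noteq> top" using z by (metis not_top_less)
    then obtain a where "z = ennreal a" "0 \<le> a" by (cases z) auto
    with z show thesis using that[of a] by (cases "a = 0") auto
  qed
  have "E (\<lambda>x. ennreal (1 / a) * ?T F x) = ennreal (1 / a) * E (?T F)"
    using a by (intro ext_norm_cmult) simp
  moreover have "ennreal (1 / a) * ennreal a < ennreal (1 / a) * E (?T F)"
    using z a by (intro ennreal_mult_strict_left_mono) auto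
  ultimately have "1 < E (\<lambda>x. ennreal (1 / a) * ?T F x)" using a by (simp flip: ennreal_mult')
  then obtain h where h [measurable]: "h \<in> borel_measurable M" and h0: "\<And>x. 0 \<le> h x"
    and h1: "assoc_norm M N (\<lambda>x. of_real (h x)) \<le> 1"
    and int: "1 < (\<integral>\<^sup>+x. ennreal (h x) * (ennreal (1 / a) * ?T F x) \<partial>M)"
    by (rule duality_witness[rotated]) measurable
  let ?h = "\<lambda>x. complex_of_real (h x)"
  let ?N' = "assoc_norm M N"
  have Tle: "?T (\<lambda>x. ennreal (h x)) x \<le> ennreal A * maximal M \<rho> ?h x" if x: "x \<in> space M" for x
  proof -
    have "?T (\<lambda>x. ennreal (h x)) x \<le> (\<integral>\<^sup>+i. maximal M \<rho> ?h x * (c i * emeasure M (S i) * indicator (S i) x) \<partial>count_space I)"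
      unfolding avg_op_def
    proof (intro nn_integral_mono)
      fix i assume "i \<in> space (count_space I)"
      then have i: "i \<in> I" by simp
      obtain z r where zr: "z \<in> space M" "0 < r" "S i = qb z r" using S[OF i] by blast
      let ?J = "\<integral>\<^sup>+y. ennreal (h y) * indicator (S i) y \<partial>M"
      show "c i * indicator (S i) x * ?J
        \<le> maximal M \<rho> ?h x * (c i * emeasure M (S i) * indicator (S i) x)"
      proof (cases "x \<in> S i")
        case True
        have e: "emeasure M (S i) = ennreal (V z r)" "0 < V z r" using zr V_pos by (auto simp: emeasure_ball)
        have "?J / emeasure M (S i) \<le> maximal M \<rho> ?h x"
          unfolding maximal_def using zr True h0 by (intro SUP_upper2[of "S i"]) (auto simp: abs_of_nonneg)
        then have "?J / emeasure M (S i) * emeasure M (S i)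
            \<le> maximal M \<rho> ?h x * emeasure M (S i)"
          by (intro mult_right_mono) auto
        moreover have "?J / emeasure M (S i) * emeasure M (S i)
            = ?J"
          using e by (simp add: ennreal_divide_times ennreal_mult_divide_eq less_le)
        ultimately have "?J \<le> maximal M \<rho> ?h x * emeasure M (S i)" by simp
        then have "c i * ?J \<le> c i * (maximal M \<rho> ?h x * emeasure M (S i))"
          by (intro mult_left_mono) auto
        then show ?thesis using True by (simp add: mult_ac)
      qed simp
    qed
    also have "\<dots> = maximal M \<rho> ?h x * (\<integral>\<^sup>+i. c i * emeasure M (S i) * indicator (S i) x \<partial>count_space I)"
      by (intro nn_integral_cmult) simp
    also have "\<dots> \<le> maximal M \<rho> ?h x * ennreal A"
      by (intro mult_left_mono A(2)[OF x]) simp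
    finally show ?thesis by (simp add: mult.commute)
  qed
  have finF: "E F < top"
  proof (rule ccontr)
    assume "\<not> E F < top"
    then have "E F = top" by (simp add: less_top[symmetric])
    then show False using z C A by (simp add: ennreal_mult_top)
  qed
  have "?h \<in> fspace M ?N'" using h1 by (auto simp: fspace_def intro: le_less_trans)
  then have "ext_norm M ?N' (maximal M \<rho> ?h) \<le> maximal_opnorm M \<rho> ?N'"
    unfolding maximal_opnorm_def using h1 by (intro SUP_upper) auto
  with C have Mh: "ext_norm M ?N' (maximal M \<rho> ?h) \<le> ennreal C" by simp
  have key: "ennreal a \<le> ennreal A * E F * ?N' g"
    if [measurable]: "g \<in> borel_measurable M" and g: "AE x in M. maximal M \<rho> ?h x \<le> ennreal (cmod (g x))" for g
  proof -
    have "ennreal a * 1 \<le> ennreal a * (\<integral>\<^sup>+x. ennreal (h x) * (ennreal (1 / a) * ?T F x) \<partial>M)"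
      using int by (intro mult_left_mono) auto
    also have "\<dots> = (\<integral>\<^sup>+x. ennreal (h x) * ?T F x \<partial>M)"
    proof (subst nn_integral_cmult[symmetric])
      have "ennreal a * (u * (ennreal (1 / a) * v)) = (ennreal a * ennreal (1 / a)) * (u * v)" for u v
        by (simp only: mult_ac)
      moreover have "ennreal a * ennreal (1 / a) = 1" using a by (simp flip: ennreal_mult')
      ultimately show "(\<integral>\<^sup>+x. ennreal a * (ennreal (h x) * (ennreal (1 / a) * ?T F x)) \<partial>M) = (\<integral>\<^sup>+x. ennreal (h x) * ?T F x \<partial>M)"
        by simp
    qed measurable
    also have "\<dots> = (\<integral>\<^sup>+x. F x * ?T (\<lambda>x. ennreal (h x)) x \<partial>M)"
      by (rule avg_op_selfadjoint[OF I S']) measurable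
    also have "\<dots> \<le> (\<integral>\<^sup>+x. ennreal A * (F x * ennreal (cmod (g x))) \<partial>M)"
    proof (rule nn_integral_mono_AE)
      show "AE x in M. F x * ?T (\<lambda>x. ennreal (h x)) x \<le> ennreal A * (F x * ennreal (cmod (g x)))"
        using g AE_space
      proof eventually_elim
        case (elim x)
        have "?T (\<lambda>x. ennreal (h x)) x \<le> ennreal A * ennreal (cmod (g x))"
          using Tle[OF elim(2)] elim(1) by (meson mult_left_mono order_trans zero_le)
        then have "F x * ?T (\<lambda>x. ennreal (h x)) x \<le> F x * (ennreal A * ennreal (cmod (g x)))"
          by (intro mult_left_mono) auto
        then show ?case by (simp add: mult_ac)
      qed
    qed
    also have "\<dots> = ennreal A * (\<integral>\<^sup>+x. F x * ennreal (cmod (g x)) \<partial>M)"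
      by (intro nn_integral_cmult) measurable
    also have "\<dots> \<le> ennreal A * (E F * ?N' g)"
      by (intro mult_left_mono holder_assoc_ext finF) auto
    finally show ?thesis by (simp add: mult.assoc)
  qed
  have "ennreal a \<le> ennreal A * E F * ennreal C"
  proof (rule ennreal_le_epsilon)
    fix e :: real assume e: "0 < e"
    obtain b where b: "ennreal A * E F = ennreal b" "0 \<le> b"
      using finF A by (cases "E F") (auto simp flip: ennreal_mult')
    have "\<exists>g\<in>{g \<in> borel_measurable M. AE x in M. maximal M \<rho> ?h x \<le> ennreal (cmod (g x))}. ?N' g < ext_norm M ?N' (maximal M \<rho> ?h) + ennreal (e / (b + 1))"
      using Mh e b by (intro INF_approx_ennreal[OF _ ext_norm_def]) (auto simp: top_unique)
    then obtain g where [measurable]: "g \<in> borel_measurable M" and g: "AE x in M. maximal M \<rho> ?h x \<le> ennreal (cmod (g x))"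
      and gN: "?N' g < ext_norm M ?N' (maximal M \<rho> ?h) + ennreal (e / (b + 1))" by blast
    have "?N' g \<le> ennreal C + ennreal (e / (b + 1))"
      using gN Mh by (meson add_right_mono less_imp_le order_trans)
    then have "ennreal a \<le> ennreal b * (ennreal C + ennreal (e / (b + 1)))"
      using key[OF _ g] b by (metis (no_types, lifting) \<open>g \<in> borel_measurable M\<close> mult_left_mono order_trans zero_le)
    also have "\<dots> = ennreal b * ennreal C + ennreal (b * (e / (b + 1)))"
      using b e ennreal_mult[of b "e / (b + 1)"] by (simp add: distrib_left)
    also have "\<dots> \<le> ennreal b * ennreal C + ennreal e"
      using b e by (intro add_left_mono ennreal_leI) (simp add: field_simps)
    finally show "ennreal a \<le> ennreal A * E F * ennreal C + ennreal e" by (simp add: b)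
  qed
  then show False using z a A C by (simp add: ennreal_mult' mult_ac)
qed

end

section \<open>The endpoint exponent\<close>

lemma mult_liminf_le:
  fixes X :: "nat \<Rightarrow> ennreal"
  shows "c * liminf X \<le> liminf (\<lambda>n. c * X n)"
  unfolding liminf_SUP_INF
  by (subst SUP_mult_left_ennreal) (auto intro!: SUP_mono' INF_greatest mult_left_mono INF_lower)

text \<open>
  The bound for averaging operators, applied to the function \<open>G\<^sup>t\<close> in the Banach space \<open>Y\<^sup>1\<^sup>/\<^sup>t\<close> and read in \<open>Y\<close>.
\<close>

lemma avg_op_power_bounded:
  fixes S :: "'i \<Rightarrow> 'a set"
  assumes ds: "doubling_space M \<rho> K L" and Y: "ball_quasi_banach_fs M \<rho> Y"
    and t: "0 < t" and Z: "ball_banach_fs M \<rho> (convexif Y (1 / t))"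
    and I: "countable I" and S: "\<And>i. i \<in> I \<Longrightarrow> \<exists>z\<in>space M. \<exists>r>0. S i = qball (space M) \<rho> z r"
    and A: "0 < A" "\<And>x. x \<in> space M \<Longrightarrow> (\<integral>\<^sup>+i. c i * emeasure M (S i) * indicator (S i) x \<partial>count_space I) \<le> ennreal A"
    and C: "0 < C" "maximal_opnorm M \<rho> (assoc_norm M (convexif Y (1 / t))) \<le> ennreal C"
    and G [measurable]: "G \<in> borel_measurable M"
  shows "ext_norm M Y (\<lambda>x. epowr (avg_op M I c S (\<lambda>y. epowr (G y) t) x) (1 / t)) \<le> ennreal ((A * C) powr (1 / t)) * ext_norm M Y G"
proof -
  interpret doubling_space M \<rho> K L by (rule ds)
  interpret Y: ball_quasi_banach M \<rho> Y by standard (rule Y)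
  interpret doubling_banach M \<rho> K L "convexif Y (1 / t)"
    using Z by unfold_locales (auto simp: ball_banach_fs_def)
  have "E (avg_op M I c S (\<lambda>y. epowr (G y) t)) \<le> ennreal (A * C) * E (\<lambda>y. epowr (G y) t)"
    by (rule avg_op_bounded[OF I S A C]) auto
  then have "epowr (ext_norm M Y (\<lambda>x. epowr (avg_op M I c S (\<lambda>y. epowr (G y) t) x) (1 / t))) t
      \<le> ennreal (A * C) * epowr (ext_norm M Y G) t"
    using t by (simp add: Y.ext_norm_convexif epowr_epowr)
  then have "ext_norm M Y (\<lambda>x. epowr (avg_op M I c S (\<lambda>y. epowr (G y) t) x) (1 / t))
      \<le> epowr (ennreal (A * C) * epowr (ext_norm M Y G) t) (1 / t)"
    using t by (simp only: epowr_le_iff)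
  also have "\<dots> = ennreal ((A * C) powr (1 / t)) * ext_norm M Y G"
    using t A C by (subst epowr_cmult) (auto simp: epowr_epowr)
  finally show ?thesis .
qed

text \<open>
  Boundedness on the associate spaces is only known for the exponents \<open>p * \<theta> m\<close>, which tend to \<open>p\<close>. The
  operator \<open>G \<mapsto> (T G\<^sup>t)\<^sup>1\<^sup>/\<^sup>t\<close> is bounded on \<open>Y\<close> for each such exponent \<open>t\<close>, uniformly once \<open>m\<close> is large, and Fatou's
  lemma, first in the integral defining \<open>T\<close> and then in \<open>Y\<close>, gives the bound at \<open>t = p\<close>.
\<close>

lemma avg_op_endpoint_bounded:
  assumes ds: "doubling_space M \<rho> K L" and Y: "ball_quasi_banach_fs M \<rho> Y"
    and p: "0 < p" and ep: "endpoint_bounded M \<rho> Y p" and A: "1 \<le> A"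
  obtains C where "0 < C" and
    "\<And>(I :: 'i set) c S G. countable I \<Longrightarrow> (\<And>i. i \<in> I \<Longrightarrow> \<exists>z\<in>space M. \<exists>r>0. S i = qball (space M) \<rho> z r) \<Longrightarrow>
      (\<And>x. x \<in> space M \<Longrightarrow> (\<integral>\<^sup>+i. c i * emeasure M (S i) * indicator (S i) x \<partial>count_space I) \<le> ennreal A) \<Longrightarrow>
      G \<in> borel_measurable M \<Longrightarrow>
      ext_norm M Y (\<lambda>x. epowr (avg_op M I c S (\<lambda>y. epowr (G y) p) x) (1 / p)) \<le> ennreal C * ext_norm M Y G"
proof -
  from ep obtain \<theta> l where th: "\<And>m::nat. 0 < \<theta> m" "\<And>m. \<theta> m < 1" "\<theta> \<longlonglongrightarrow> 1"
    and Z: "\<And>m. ball_banach_fs M \<rho> (convexif Y (1 / (p * \<theta> m)))"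
    and lim: "(\<lambda>m. maximal_opnorm M \<rho> (assoc_norm M (convexif Y (1 / (p * \<theta> m))))) \<longlonglongrightarrow> l" and l: "l < \<infinity>"
    unfolding endpoint_bounded_def by blast
  define D where "D = enn2real l + 1"
  have D1: "1 \<le> D" using enn2real_nonneg[of l] by (simp add: D_def)
  have lD: "l < ennreal D"
  proof -
    have "l = ennreal (enn2real l)" using l by simp
    also have "\<dots> < ennreal D" using D1 by (intro ennreal_lessI) (simp_all add: D_def add_nonneg_pos)
    finally show ?thesis .
  qed
  have "\<forall>\<^sub>F m in sequentially. maximal_opnorm M \<rho> (assoc_norm M (convexif Y (1 / (p * \<theta> m)))) < ennreal D"
    using lim lD by (rule order_tendstoD)
  moreover have "\<forall>\<^sub>F m in sequentially. 1 / 2 < \<theta> m" using th(3) by (rule order_tendstoD) simp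
  \<comment> \<open>for \<open>\<theta> m > 1 / 2\<close> the exponents \<open>1 / (p * \<theta> m)\<close> stay below \<open>2 / p\<close>, which makes the constants uniform\<close>
  ultimately obtain m0 where m0: "\<And>m. m0 \<le> m \<Longrightarrow> maximal_opnorm M \<rho> (assoc_norm M (convexif Y (1 / (p * \<theta> m)))) < ennreal D \<and> 1 / 2 < \<theta> m"
    using eventually_conj unfolding eventually_sequentially by (metis (no_types, lifting) nat_le_linear order_trans)
  define e where "e m = p * \<theta> (m + m0)" for m
  have e: "0 < e m" "p / 2 \<le> e m" for m using th(1)[of "m + m0"] m0[of "m + m0"] p by (auto simp: e_def field_simps)
  have elim: "e \<longlonglongrightarrow> p"
    using tendsto_mult[OF tendsto_const[of p] LIMSEQ_ignore_initial_segment[OF th(3), of m0]] by (simp add: e_def[abs_def])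
  interpret Y: ball_quasi_banach M \<rho> Y by standard (rule Y)
  have AD: "1 \<le> A * D" using A D1 mult_mono[of 1 A 1 D] by simp
  show thesis
  proof (rule that[of "(A * D) powr (2 / p)"])
    show "0 < (A * D) powr (2 / p)" using A D1 by simp
    fix I :: "'i set" and c :: "'i \<Rightarrow> ennreal" and S :: "'i \<Rightarrow> 'a set" and G :: "'a \<Rightarrow> ennreal"
    assume I: "countable I" and S: "\<And>i. i \<in> I \<Longrightarrow> \<exists>z\<in>space M. \<exists>r>0. S i = qball (space M) \<rho> z r"
      and mass: "\<And>x. x \<in> space M \<Longrightarrow> (\<integral>\<^sup>+i. c i * emeasure M (S i) * indicator (S i) x \<partial>count_space I) \<le> ennreal A"
      and G [measurable]: "G \<in> borel_measurable M"
    have S' [measurable]: "S i \<in> sets M" if "i \<in> I" for i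
      using S[OF that] doubling_space.ball_sets[OF ds] by auto
    have T [measurable]: "avg_op M I c S F \<in> borel_measurable M" for F
      by (rule measurable_avg_op[OF I S'])
    have k [measurable]: "avg_kernel I c S x \<in> borel_measurable M" for x
      by (rule measurable_avg_kernel[OF I S'])
    define H where "H m x = epowr (avg_op M I c S (\<lambda>y. epowr (G y) (e m)) x) (1 / e m)" for m x
    have bound: "ext_norm M Y (H m) \<le> ennreal ((A * D) powr (2 / p)) * ext_norm M Y G" for m
    proof -
      have "ext_norm M Y (H m) \<le> ennreal ((A * D) powr (1 / e m)) * ext_norm M Y G"
        unfolding H_def
        using A D1 e[of m] Z[of "m + m0"] m0[of "m + m0"]
        by (intro avg_op_power_bounded[OF ds Y _ _ I S _ mass]) (auto simp: e_def)
      also have "\<dots> \<le> ennreal ((A * D) powr (2 / p)) * ext_norm M Y G"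
        using AD e[of m] p by (intro mult_right_mono ennreal_leI powr_mono) (auto simp: field_simps)
      finally show ?thesis .
    qed
    have pt: "epowr (avg_op M I c S (\<lambda>y. epowr (G y) p) x) (1 / p) \<le> liminf (\<lambda>m. H m x)" for x
    proof -
      have "avg_op M I c S (\<lambda>y. epowr (G y) p) x = (\<integral>\<^sup>+y. epowr (G y) p * avg_kernel I c S x y \<partial>M)"
        by (rule avg_op_eq_kernel[OF I S']) auto
      also have "\<dots> \<le> (\<integral>\<^sup>+y. liminf (\<lambda>m. epowr (G y) (e m) * avg_kernel I c S x y) \<partial>M)"
      proof (rule nn_integral_mono)
        fix y
        have "epowr (G y) p \<le> liminf (\<lambda>m. epowr (G y) (e m))"
          using le_Liminf_epowr[OF elim p e(1), of "\<lambda>_. G y"] by (simp add: Liminf_const)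
        then have "avg_kernel I c S x y * epowr (G y) p \<le> avg_kernel I c S x y * liminf (\<lambda>m. epowr (G y) (e m))"
          by (intro mult_left_mono) auto
        also have "\<dots> \<le> liminf (\<lambda>m. avg_kernel I c S x y * epowr (G y) (e m))" by (rule mult_liminf_le)
        finally show "epowr (G y) p * avg_kernel I c S x y \<le> liminf (\<lambda>m. epowr (G y) (e m) * avg_kernel I c S x y)"
          by (simp add: mult.commute)
      qed
      also have "\<dots> \<le> liminf (\<lambda>m. \<integral>\<^sup>+y. epowr (G y) (e m) * avg_kernel I c S x y \<partial>M)"
        by (rule nn_integral_liminf) measurable
      also have "\<dots> = liminf (\<lambda>m. avg_op M I c S (\<lambda>y. epowr (G y) (e m)) x)"
        by (subst avg_op_eq_kernel[OF I S']) auto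
      finally have "epowr (avg_op M I c S (\<lambda>y. epowr (G y) p) x) (1 / p) \<le>
          epowr (liminf (\<lambda>m. avg_op M I c S (\<lambda>y. epowr (G y) (e m)) x)) (1 / p)"
        using p by (intro epowr_mono) auto
      also have "\<dots> \<le> liminf (\<lambda>m. H m x)"
        unfolding H_def using p elim e(1) by (intro le_Liminf_epowr tendsto_divide tendsto_const) auto
      finally show ?thesis .
    qed
    have "ext_norm M Y (\<lambda>x. epowr (avg_op M I c S (\<lambda>y. epowr (G y) p) x) (1 / p)) \<le> ext_norm M Y (\<lambda>x. liminf (\<lambda>m. H m x))"
      using pt by (intro Y.ext_norm_mono AE_I2)
    also have "\<dots> \<le> liminf (\<lambda>m. ext_norm M Y (H m))"
      unfolding H_def by (intro Y.ext_norm_Fatou) measurable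
    also have "\<dots> \<le> liminf (\<lambda>m::nat. ennreal ((A * D) powr (2 / p)) * ext_norm M Y G)"
      using bound by (intro Liminf_mono always_eventually allI)
    finally show "ext_norm M Y (\<lambda>x. epowr (avg_op M I c S (\<lambda>y. epowr (G y) p) x) (1 / p))
        \<le> ennreal ((A * D) powr (2 / p)) * ext_norm M Y G" by (simp add: Liminf_const)
  qed
qed

section \<open>A discretized fractional kernel\<close>

text \<open>
  The factor \<open>s\<close> in front of the integral compensates the divergence of the geometric series over the dyadic scales.
\<close>

lemma geometric_factor_bound:
  assumes q: "0 < q" and s: "0 < s" "s < (1::real)"
  shows "s / (1 - 2 powr (- (s * q))) \<le> (1 + q * ln 2) / (q * ln 2)"
proof -
  define t where "t = s * q * ln 2"
  have t: "0 < t" using q s by (simp add: t_def)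
  have "2 powr (- (s * q)) = exp (- t)" by (simp add: powr_def t_def mult.commute)
  also have "\<dots> = 1 / exp t" by (simp add: exp_minus inverse_eq_divide)
  also have "\<dots> \<le> 1 / (1 + t)"
    using exp_ge_add_one_self[of t] t by (intro divide_left_mono) auto
  finally have "t / (1 + t) \<le> 1 - 2 powr (- (s * q))" using t by (simp add: field_simps)
  then have "s / (1 - 2 powr (- (s * q))) \<le> s / (t / (1 + t))"
  proof (intro divide_left_mono mult_pos_pos)
    have "0 < t / (1 + t)" using t by simp
    also note \<open>t / (1 + t) \<le> 1 - 2 powr (- (s * q))\<close>
    finally show "0 < 1 - 2 powr (- (s * q))" .
  qed (use t s in auto)
  also have "\<dots> = (1 + t) / (q * ln 2)" using t s q by (simp add: t_def field_simps)
  also have "\<dots> \<le> (1 + q * ln 2) / (q * ln 2)"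
    using s q by (intro divide_right_mono) (auto simp: t_def)
  finally show ?thesis .
qed

context doubling_space
begin

definition separated :: "real \<Rightarrow> 'a set \<Rightarrow> bool" where
  "separated r S \<longleftrightarrow> S \<subseteq> space M \<and> (\<forall>x\<in>S. \<forall>y\<in>S. x \<noteq> y \<longrightarrow> r \<le> \<rho> x y)"

text \<open>
  A bound for the number of points of an \<open>r\<close>-separated set in a ball of radius \<open>\<tau> r\<close>. The argument of
  \<^const>\<open>dbl\<close> is a factor by which a ball of radius \<open>r / (2 K)\<close> about such a point has to be enlarged so that
  it covers a ball that contains all these small balls.
\<close>

definition pack :: "real \<Rightarrow> nat" where
  "pack \<tau> = nat \<lfloor>dbl (2 * K ^ 2 * (\<tau> + K * (\<tau> + 1)))\<rfloor>"

text \<open>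
  Volume comparison: the balls of radius \<open>r / (2 K)\<close> about separated points are disjoint, lie in one ball \<open>B(x, R)\<close>,
  and each of them has a fixed proportion of its measure.
\<close>

lemma separated_card:
  assumes S: "separated r S" and r: "0 < r" and x: "x \<in> space M" and tau: "0 < \<tau>"
  shows "finite {z\<in>S. \<rho> x z < \<tau> * r} \<and> card {z\<in>S. \<rho> x z < \<tau> * r} \<le> pack \<tau>"
proof (rule finite_if_finite_subsets_card_bdd)
  fix F assume F: "F \<subseteq> {z \<in> S. \<rho> x z < \<tau> * r}" and fin: "finite F"
  define d where "d = r / (2 * K)"
  define R where "R = K * (\<tau> + 1) * r"
  define c where "c = 2 * K ^ 2 * (\<tau> + K * (\<tau> + 1))"
  have d: "0 < d" using r K1 by (simp add: d_def)
  have R: "0 < R" using r K1 tau by (simp add: R_def)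
  have Fs: "z \<in> space M" "\<rho> x z < \<tau> * r" "z \<in> S" if "z \<in> F" for z
    using F that S by (auto simp: separated_def)
  have disj: "disjoint_family_on (\<lambda>z. qb z d) F"
    unfolding disjoint_family_on_def
  proof (intro ballI impI equals0I)
    fix z z' w assume z: "z \<in> F" "z' \<in> F" "z \<noteq> z'" and "w \<in> qb z d \<inter> qb z' d"
    then have w: "w \<in> space M" "\<rho> z w < d" "\<rho> z' w < d" by (auto simp: qball_def)
    have "r \<le> \<rho> z z'" using z Fs S by (auto simp: separated_def)
    also have "\<dots> \<le> K * (\<rho> z w + \<rho> w z')" using z Fs w by (intro dist_triangle) auto
    also have "\<dots> < K * (d + d)"
      using w z Fs K1 dist_sym[of w z'] by (intro mult_strict_left_mono add_strict_mono) auto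
    also have "\<dots> = r" using K1 by (simp add: d_def)
    finally show False by simp
  qed
  have sub: "qb z d \<subseteq> qb x R" if z: "z \<in> F" for z
  proof (rule ball_engulf)
    have "d \<le> r" using r K1 by (simp add: d_def field_simps)
    then show "K * (\<tau> * r + d) \<le> R"
      unfolding R_def using K1 by (simp add: mult.assoc distrib_right)
  qed (use x Fs[OF z] in auto)
  have vol: "V x R \<le> dbl c * V z d" if z: "z \<in> F" for z
  proof -
    have "qb x R \<subseteq> qb z (c * d)"
    proof (rule ball_engulf)
      show "\<rho> z x \<le> \<tau> * r" using Fs[OF z] x dist_sym[of z x] by simp
      have "c * d = K * (\<tau> * r + R)"
        using K1 by (simp add: c_def d_def R_def field_simps power2_eq_square)
      then show "K * (\<tau> * r + R) \<le> c * d" by simp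
    qed (use x Fs[OF z] in auto)
    then have "V x R \<le> V z (c * d)" using x Fs[OF z] by (intro V_mono) auto
    also have "\<dots> \<le> dbl c * V z d" using Fs[OF z] d by (intro V_scale_le)
    finally show ?thesis .
  qed
  have "real (card F) * V x R = (\<Sum>z\<in>F. V x R)" by simp
  also have "\<dots> \<le> (\<Sum>z\<in>F. dbl c * V z d)" by (intro sum_mono vol)
  also have "\<dots> = dbl c * (\<Sum>z\<in>F. V z d)" by (simp add: sum_distrib_left)
  also have "(\<Sum>z\<in>F. V z d) = measure M (\<Union>z\<in>F. qb z d)"
  proof (rule measure_finite_Union[symmetric])
    show "emeasure M (qb z d) \<noteq> \<infinity>" if "z \<in> F" for z using ball_finite[of z d] Fs[OF that] by auto
  qed (use fin disj Fs in auto)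
  also have "dbl c * \<dots> \<le> dbl c * V x R"
  proof (intro mult_left_mono measure_mono_fmeasurable)
    show "(\<Union>z\<in>F. qb z d) \<subseteq> qb x R" using sub by auto
    show "(\<Union>z\<in>F. qb z d) \<in> sets M" using fin Fs by (intro sets.finite_UN) auto
    show "qb x R \<in> fmeasurable M" using ball_finite[OF x] x by (intro fmeasurableI) auto
  qed (use dbl_pos[of c] in simp)
  finally have "real (card F) \<le> dbl c" using V_pos[OF x R] by simp
  then show "card F \<le> pack \<tau>" unfolding pack_def c_def by (simp add: le_nat_floor)
qed

lemma separated_countable:
  assumes S: "separated r S" and r: "0 < r"
  shows "countable S"
proof -
  obtain x0 where x0: "x0 \<in> space M" using space_nonempty by auto
  let ?S = "\<lambda>n. {z\<in>S. \<rho> x0 z < (real n + 1) * r}"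
  have "S \<subseteq> (\<Union>n::nat. (?S n))"
  proof
    fix z assume z: "z \<in> S"
    obtain n :: nat where "\<rho> x0 z / r < real n" using reals_Archimedean2 by blast
    then have "\<rho> x0 z < real n * r" using r by (simp add: field_simps)
    then have "\<rho> x0 z < (real n + 1) * r" using r by (simp add: distrib_right)
    then show "z \<in> (\<Union>n::nat. (?S n))" using z by auto
  qed
  moreover have "countable (\<Union>n::nat. (?S n))"
  proof (rule countable_UN)
    show "countable (?S n)" for n :: nat
      using separated_card[OF S r x0, of "real n + 1"] by (intro countable_finite) simp
  qed simp
  ultimately show ?thesis by (rule countable_subset)
qed

lemma maximal_separated_exists:
  assumes r: "0 < r"
  shows "\<exists>S. separated r S \<and> (\<forall>x\<in>space M. \<exists>z\<in>S. \<rho> z x < r)"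
proof -
  have "\<exists>S\<in>Collect (separated r). \<forall>X\<in>Collect (separated r). S \<subseteq> X \<longrightarrow> X = S"
  proof (rule subset_Zorn')
    fix C assume C: "subset.chain (Collect (separated r)) C"
    then have sep: "\<And>X. X \<in> C \<Longrightarrow> separated r X" and
      ch: "\<And>X X'. X \<in> C \<Longrightarrow> X' \<in> C \<Longrightarrow> X \<subseteq> X' \<or> X' \<subseteq> X"
      by (auto simp: subset.chain_def)
    show "\<Union>C \<in> Collect (separated r)"
      unfolding mem_Collect_eq separated_def
    proof (intro conjI ballI impI)
      show "\<Union>C \<subseteq> space M" using sep by (auto simp: separated_def)
      fix x y assume "x \<in> \<Union>C" "y \<in> \<Union>C" and xy: "x \<noteq> y"
      then obtain X X' where X: "x \<in> X" "X \<in> C" "y \<in> X'" "X' \<in> C" by blast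
      then obtain Z where "Z \<in> C" "x \<in> Z" "y \<in> Z" using ch[of X X'] by blast
      with sep xy show "r \<le> \<rho> x y" by (auto simp: separated_def)
    qed
  qed
  then obtain S where S: "separated r S" and max: "\<And>X. separated r X \<Longrightarrow> S \<subseteq> X \<Longrightarrow> X = S" by auto
  have "\<exists>z\<in>S. \<rho> z x < r" if x: "x \<in> space M" for x
  proof (rule ccontr)
    assume far: "\<not> (\<exists>z\<in>S. \<rho> z x < r)"
    have "separated r (insert x S)"
      unfolding separated_def
    proof (intro conjI ballI impI)
      show "insert x S \<subseteq> space M" using x S by (auto simp: separated_def)
      fix y z assume yz: "y \<in> insert x S" "z \<in> insert x S" "y \<noteq> z"
      have "r \<le> \<rho> z x \<and> r \<le> \<rho> x z" if "z \<in> S" for z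
      proof -
        have "z \<in> space M" using that S by (auto simp: separated_def)
        then have "\<rho> x z = \<rho> z x" using x by (intro dist_sym)
        then show ?thesis using far that by (auto simp: not_less)
      qed
      then show "r \<le> \<rho> y z" using yz S by (auto simp: separated_def)
    qed
    then have "x \<in> S" using max[of "insert x S"] by auto
    moreover have "\<rho> x x = 0" using dist_eq_0[OF x x] by simp
    ultimately show False using far r by auto
  qed
  then show ?thesis using S by blast
qed

text \<open>
  Maximal separated sets at the dyadic scales: the balls of radius \<open>2\<^sup>j\<close> about \<open>net j\<close> cover the space.
\<close>

definition net :: "nat \<Rightarrow> 'a set" where
  "net j = (SOME S. separated (2 ^ j) S \<and> (\<forall>x\<in>space M. \<exists>z\<in>S. \<rho> z x < 2 ^ j))"

lemma net: "separated (2 ^ j) (net j)" "x \<in> space M \<Longrightarrow> \<exists>z\<in>net j. \<rho> z x < 2 ^ j"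
  using someI_ex[OF maximal_separated_exists[of "2 ^ j"]] unfolding net_def[symmetric] by auto

lemma net_subset: "z \<in> net j \<Longrightarrow> z \<in> space M"
  using net(1)[of j] by (auto simp: separated_def)

definition idx :: "(nat \<times> 'a) set" where "idx = (SIGMA j:UNIV. net j)"

text \<open>
  The factor \<open>3 K\<close> makes the cell about a net point near \<open>x\<close> contain every \<open>y\<close> with \<open>\<rho> x y < 2\<^sup>j\<^sup>+\<^sup>1\<close>.
\<close>

definition cell :: "nat \<times> 'a \<Rightarrow> 'a set" where "cell i = qb (snd i) (3 * K * 2 ^ fst i)"

text \<open>
  The discretization of \<open>s / (V x (\<rho> x y) * \<rho> x y powr (s * q))\<close> at the distance \<open>2\<^sup>j\<close>.
\<close>

definition weight :: "real \<Rightarrow> real \<Rightarrow> nat \<times> 'a \<Rightarrow> ennreal" where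
  "weight s q i = ennreal (s * (2 powr (- (s * q))) ^ fst i / V (snd i) (3 * K * 2 ^ fst i))"

lemma idx_countable: "countable idx"
  unfolding idx_def by (intro countable_SIGMA separated_countable[OF net(1)]) auto

lemma cell_ball: "i \<in> idx \<Longrightarrow> \<exists>z\<in>space M. \<exists>r>0. cell i = qb z r"
proof -
  assume "i \<in> idx"
  then have "snd i \<in> space M" using net_subset by (auto simp: idx_def)
  moreover have "0 < 3 * K * 2 ^ fst i" using K1 by simp
  ultimately show ?thesis unfolding cell_def by blast
qed

lemma cell_sets: "i \<in> idx \<Longrightarrow> cell i \<in> sets M"
  using net_subset by (auto simp: idx_def cell_def)

definition mass_bound :: "real \<Rightarrow> real" where
  "mass_bound q = 1 + real (pack (3 * K)) * ((1 + q * ln 2) / (q * ln 2))"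

lemma mass_bound_ge_1: "0 < q \<Longrightarrow> 1 \<le> mass_bound q"
  unfolding mass_bound_def by (simp add: add_nonneg_nonneg)

text \<open>
  At each scale a point lies in boundedly many cells, and the scales contribute a geometric series whose sum
  is of order \<open>1 / s\<close>.
\<close>

lemma weight_mass:
  assumes x: "x \<in> space M" and q: "0 < q" and s: "0 < s" "s < 1"
  shows "(\<integral>\<^sup>+i. weight s q i * emeasure M (cell i) * indicator (cell i) x \<partial>count_space idx) \<le> ennreal (mass_bound q)"
proof -
  define b where "b = 2 powr (- (s * q))"
  have b: "0 < b" "b < 1" using q s powr_less_mono[of "- (s * q)" 0 2] by (auto simp: b_def)
  define f where "f i = weight s q i * emeasure M (cell i) * indicator (cell i) x" for i
  define n where "n = pack (3 * K)"
  have inner: "(\<integral>\<^sup>+z. f (j, z) * indicator (net j) z \<partial>count_space UNIV) \<le> ennreal (s * real n * b ^ j)" for j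
  proof -
    define T where "T = {z\<in>net j. \<rho> x z < 3 * K * 2 ^ j}"
    have T: "finite T" "card T \<le> n"
      using separated_card[OF net(1)[of j] _ x, of "3 * K"] K1 unfolding T_def n_def by auto
    have "(\<integral>\<^sup>+z. f (j, z) * indicator (net j) z \<partial>count_space UNIV) = (\<Sum>z\<in>T. f (j, z) * indicator (net j) z)"
    proof (rule nn_integral_count_space')
      fix z assume "z \<notin> T"
      then show "f (j, z) * indicator (net j) z = 0"
      proof (cases "z \<in> net j")
        case True
        then have "\<not> \<rho> x z < 3 * K * 2 ^ j" "\<rho> z x = \<rho> x z"
          using \<open>z \<notin> T\<close> dist_sym[OF net_subset[OF True] x] by (auto simp: T_def)
        then have "x \<notin> cell (j, z)" by (simp add: cell_def qball_def)
        then show ?thesis by (simp add: f_def)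
      qed simp
    qed (use T in auto)
    also have "\<dots> \<le> (\<Sum>z\<in>T. ennreal (s * b ^ j))"
    proof (rule sum_mono)
      fix z assume "z \<in> T"
      then have z: "z \<in> space M" using net_subset by (auto simp: T_def)
      have pos: "0 < V z (3 * K * 2 ^ j)" using z K1 by (intro V_pos) auto
      have "weight s q (j, z) * emeasure M (cell (j, z)) = ennreal (s * b ^ j)"
        using pos s b z by (simp add: weight_def cell_def emeasure_ball b_def[symmetric] flip: ennreal_mult)
      then show "f (j, z) * indicator (net j) z \<le> ennreal (s * b ^ j)"
        by (auto simp: f_def indicator_def)
    qed
    also have "\<dots> = ennreal (real (card T) * (s * b ^ j))"
      using s b by (simp add: ennreal_mult ennreal_of_nat_eq_real_of_nat)
    also have "\<dots> \<le> ennreal (s * real n * b ^ j)"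
    proof (rule ennreal_leI)
      have "real (card T) * (s * b ^ j) \<le> real n * (s * b ^ j)"
        using T s b by (intro mult_right_mono) auto
      then show "real (card T) * (s * b ^ j) \<le> s * real n * b ^ j" by (simp add: mult_ac)
    qed
    finally show ?thesis .
  qed
  have sums: "(\<lambda>j. s * real n * b ^ j) sums (s * real n * (1 / (1 - b)))"
    using b by (intro sums_mult geometric_sums) auto
  have "(\<integral>\<^sup>+i. f i \<partial>count_space idx) = (\<integral>\<^sup>+i. f i * indicator idx i \<partial>count_space UNIV)"
    by (rule nn_integral_count_space_indicator) simp
  also have "\<dots> = (\<integral>\<^sup>+j. \<integral>\<^sup>+z. f (j, z) * indicator idx (j, z) \<partial>count_space UNIV \<partial>count_space UNIV)"
    by (rule nn_integral_fst_count_space[symmetric])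
  also have "\<dots> = (\<integral>\<^sup>+j. \<integral>\<^sup>+z. f (j, z) * indicator (net j) z \<partial>count_space UNIV \<partial>count_space UNIV)"
    by (intro nn_integral_cong) (simp add: idx_def indicator_def)
  also have "\<dots> \<le> (\<integral>\<^sup>+j. ennreal (s * real n * b ^ j) \<partial>count_space UNIV)"
    by (intro nn_integral_mono inner)
  also have "\<dots> = ennreal (s * real n * (1 / (1 - b)))"
    unfolding nn_integral_count_space_nat using sums s b
    by (subst suminf_ennreal2) (auto simp: sums_iff)
  also have "\<dots> \<le> ennreal (mass_bound q)"
  proof (rule ennreal_leI)
    have "s * real n * (1 / (1 - b)) = real n * (s / (1 - b))" by simp
    also have "\<dots> \<le> real n * ((1 + q * ln 2) / (q * ln 2))"
      unfolding b_def using q s by (intro mult_left_mono geometric_factor_bound) auto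
    finally show "s * real n * (1 / (1 - b)) \<le> mass_bound q" by (simp add: mass_bound_def n_def)
  qed
  finally show ?thesis unfolding f_def .
qed

lemma dyadic_bracket:
  fixes t :: real assumes "1 \<le> t"
  obtains j :: nat where "2 ^ j \<le> t" "t < 2 ^ Suc j"
proof -
  define n where "n = (LEAST n. t < 2 ^ n)"
  have ex: "\<exists>n. t < 2 ^ n" using real_arch_pow[of 2 t] by simp
  have n: "t < 2 ^ n" unfolding n_def by (rule LeastI_ex[OF ex])
  then obtain j where j: "n = Suc j" using assms by (cases n) auto
  have "\<not> t < 2 ^ j" using not_less_Least[of j "\<lambda>n. t < 2 ^ n"] j by (simp add: n_def)
  then show thesis using that[of j] n j by auto
qed

text \<open>
  The single cell at the dyadic scale of \<open>\<rho> x y\<close> whose centre is within \<open>2\<^sup>j\<close> of \<open>x\<close> already accounts for the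
  kernel, since balls of comparable radii around nearby points have comparable measures.
\<close>

lemma kernel_le_avg_kernel:
  assumes x: "x \<in> space M" and y: "y \<in> space M" and q: "0 < q" and s: "0 < s" and xy: "1 \<le> \<rho> x y"
  shows "ennreal (s / (V x (\<rho> x y) * \<rho> x y powr (s * q)))
    \<le> ennreal (dbl (K * (1 + 3 * K))) * avg_kernel idx (weight s q) cell x y"
proof -
  let ?D = "dbl (K * (1 + 3 * K))"
  obtain j :: nat where j: "2 ^ j \<le> \<rho> x y" "\<rho> x y < 2 ^ Suc j" using dyadic_bracket[OF xy] .
  obtain z where z: "z \<in> net j" "\<rho> z x < 2 ^ j" using net(2)[OF x] by blast
  have zs: "z \<in> space M" using z net_subset by auto
  have i: "(j, z) \<in> idx" using z by (simp add: idx_def)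
  have xz: "x \<in> cell (j, z)"
  proof -
    have "\<rho> z x < 1 * 2 ^ j" using z by simp
    also have "\<dots> \<le> 3 * K * 2 ^ j" using K1 by (intro mult_right_mono) auto
    finally show ?thesis using x by (simp add: cell_def qball_def)
  qed
  have yz: "y \<in> cell (j, z)"
  proof -
    have "\<rho> z y \<le> K * (\<rho> z x + \<rho> x y)" using x y zs by (intro dist_triangle)
    also have "\<dots> < K * (2 ^ j + 2 ^ Suc j)" using z j K1 by (intro mult_strict_left_mono add_strict_mono) auto
    also have "\<dots> = 3 * K * 2 ^ j" by simp
    finally show ?thesis using y by (simp add: cell_def qball_def)
  qed
  have "V z (3 * K * 2 ^ j) \<le> V x (K * (1 + 3 * K) * 2 ^ j)"
  proof (intro V_mono zs x ball_engulf)
    show "\<rho> x z \<le> 2 ^ j" using z dist_sym[OF x zs] by simp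
    show "K * (2 ^ j + 3 * K * 2 ^ j) \<le> K * (1 + 3 * K) * 2 ^ j" by (simp add: algebra_simps)
  qed
  also have "\<dots> \<le> ?D * V x (2 ^ j)" using x by (intro V_scale_le) auto
  also have "\<dots> \<le> ?D * V x (\<rho> x y)" using x j dbl_pos by (intro mult_left_mono V_mono_radius) (auto intro: less_imp_le)
  finally have vol: "V z (3 * K * 2 ^ j) \<le> ?D * V x (\<rho> x y)" .
  have pos: "0 < V z (3 * K * 2 ^ j)" using zs K1 by (intro V_pos) auto
  have posx: "0 < V x (\<rho> x y)" using x xy by (intro V_pos) auto
  have "(2 powr (s * q)) ^ j = (2 ^ j) powr (s * q)"
    by (simp add: powr_powr mult.commute flip: powr_realpow)
  also have "\<dots> \<le> \<rho> x y powr (s * q)" using j s q by (intro powr_mono2) auto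
  finally have pw: "(2 powr (s * q)) ^ j \<le> \<rho> x y powr (s * q)" .
  have "s / (V x (\<rho> x y) * \<rho> x y powr (s * q)) \<le> s / ((V z (3 * K * 2 ^ j) / ?D) * (2 powr (s * q)) ^ j)"
  proof (intro divide_left_mono mult_mono)
    show "V z (3 * K * 2 ^ j) / ?D \<le> V x (\<rho> x y)" using vol dbl_pos by (simp add: field_simps)
  qed (use s pw pos posx dbl_pos xy in \<open>auto intro!: mult_pos_pos divide_pos_pos\<close>)
  also have "\<dots> = ?D * (s * (2 powr (- (s * q))) ^ j / V z (3 * K * 2 ^ j))"
    by (simp add: powr_minus power_inverse field_simps)
  finally have "ennreal (s / (V x (\<rho> x y) * \<rho> x y powr (s * q)))
      \<le> ennreal (?D * (s * (2 powr (- (s * q))) ^ j / V z (3 * K * 2 ^ j)))" by (rule ennreal_leI)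
  also have "\<dots> = ennreal ?D * (weight s q (j, z) * indicator (cell (j, z)) x * indicator (cell (j, z)) y)"
    using xz yz dbl_pos s pos by (subst ennreal_mult) (auto simp: weight_def less_imp_le)
  also have "\<dots> \<le> ennreal ?D * avg_kernel idx (weight s q) cell x y"
    unfolding avg_kernel_def
    by (intro mult_left_mono nn_integral_ge_point[OF i, of "\<lambda>i. weight s q i * indicator (cell i) x * indicator (cell i) y"]) simp
  finally show ?thesis .
qed

end

section \<open>Near and far part of the Gagliardo functional\<close>

lemma norm_diff_powr_le:
  fixes a b :: complex assumes q: "0 < q"
  shows "cmod (a - b) powr q \<le> 2 powr q * (cmod a powr q + cmod b powr q)"
proof -
  have "cmod (a - b) \<le> 2 * max (cmod a) (cmod b)" using norm_triangle_ineq4[of a b] by linarith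
  then have "cmod (a - b) powr q \<le> (2 * max (cmod a) (cmod b)) powr q" using q by (intro powr_mono2) auto
  also have "\<dots> = 2 powr q * max (cmod a) (cmod b) powr q" by (simp add: powr_mult)
  also have "\<dots> \<le> 2 powr q * (cmod a powr q + cmod b powr q)"
    by (intro mult_left_mono) (auto simp: max_def)
  finally show ?thesis .
qed

context doubling_space
begin

text \<open>
  The kernel of the Gagliardo functional with \<^const>\<open>qU\<close> replaced by the comparable quantity \<open>\<mu>(B(x, \<rho>(x,y)))\<close>,
  which is measurable in \<open>y\<close>. It vanishes at \<open>y = x\<close>, where the ball has radius \<open>0\<close> and is empty.
\<close>

definition riesz :: "real \<Rightarrow> real \<Rightarrow> 'a \<Rightarrow> 'a \<Rightarrow> real" where
  "riesz s q x y = 1 / (V x (\<rho> x y) * \<rho> x y powr (s * q))"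

definition near :: "real \<Rightarrow> real \<Rightarrow> ('a \<Rightarrow> complex) \<Rightarrow> 'a \<Rightarrow> ennreal" where
  "near s q f x = (\<integral>\<^sup>+y. ennreal (cmod (f x - f y) powr q * riesz s q x y) * indicator {y. \<rho> x y < 1} y \<partial>M)"

definition far :: "real \<Rightarrow> real \<Rightarrow> ('a \<Rightarrow> complex) \<Rightarrow> 'a \<Rightarrow> ennreal" where
  "far s q f x = (\<integral>\<^sup>+y. ennreal (cmod (f x - f y) powr q * riesz s q x y) * indicator {y. 1 \<le> \<rho> x y} y \<partial>M)"

lemma riesz_nonneg: "0 \<le> riesz s q x y"
  by (simp add: riesz_def)

lemma riesz_measurable [measurable]:
  assumes x: "x \<in> space M" shows "riesz s q x \<in> borel_measurable M"
proof -
  note [measurable] = dist_measurable[OF x] V_dist_measurable[OF x]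
  show ?thesis unfolding riesz_def by measurable
qed

lemma integrand_measurable:
  assumes x: "x \<in> space M" and [measurable]: "f \<in> borel_measurable M"
  shows "(\<lambda>y. ennreal (cmod (f x - f y) powr q * riesz s q x y) * indicator {y. \<rho> x y < 1} y) \<in> borel_measurable M"
    and "(\<lambda>y. ennreal (cmod (f x - f y) powr q * riesz s q x y) * indicator {y. 1 \<le> \<rho> x y} y) \<in> borel_measurable M"
proof -
  note [measurable] = dist_measurable[OF x] riesz_measurable[OF x]
  have eq: "indicator {y. 1 \<le> \<rho> x y} y = (if 1 \<le> \<rho> x y then 1 else (0 :: ennreal))"
    "indicator {y. \<rho> x y < 1} y = (if \<rho> x y < 1 then 1 else (0 :: ennreal))" for y
    by (auto simp: indicator_def)
  show "(\<lambda>y. ennreal (cmod (f x - f y) powr q * riesz s q x y) * indicator {y. \<rho> x y < 1} y) \<in> borel_measurable M"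
    unfolding eq by measurable
  show "(\<lambda>y. ennreal (cmod (f x - f y) powr q * riesz s q x y) * indicator {y. 1 \<le> \<rho> x y} y) \<in> borel_measurable M"
    unfolding eq by measurable
qed

lemma qU_comparable:
  assumes x: "x \<in> space M" and y: "y \<in> space M" and "x \<noteq> y"
  obtains u where "qU M \<rho> x y = ennreal u" "0 < u" "u \<le> V x (\<rho> x y)" "V x (\<rho> x y) \<le> dbl (2 * K) * u"
proof -
  let ?d = "\<rho> x y"
  have d: "0 < ?d" using dist_nonneg[OF x y] dist_eq_0[OF x y] \<open>x \<noteq> y\<close> by linarith
  have "V x ?d \<le> V y (2 * K * ?d)"
    by (intro V_mono x y ball_engulf[OF y x, of ?d]) (auto simp: dist_sym[OF x y])
  also have "\<dots> \<le> dbl (2 * K) * V y ?d" using y d by (intro V_scale_le)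
  finally have 1: "V x ?d \<le> dbl (2 * K) * V y ?d" .
  have 2: "V x ?d \<le> dbl (2 * K) * V x ?d"
    using mult_right_mono[OF dbl_ge_1[of "2 * K"], of "V x ?d"] by simp
  show thesis
  proof (rule that[of "min (V x ?d) (V y ?d)"])
    show "qU M \<rho> x y = ennreal (min (V x ?d) (V y ?d))"
      using x y by (simp add: qU_def emeasure_ball min_def)
  qed (use V_pos[OF x d] V_pos[OF y d] 1 2 in \<open>auto simp: min_def\<close>)
qed

lemma gagliardo_integrand_bounds:
  fixes c s q :: real
  assumes x: "x \<in> space M" and y: "y \<in> space M" and c: "0 \<le> c" "y = x \<Longrightarrow> c = 0"
  defines "g \<equiv> (if y = x then 0 else ennreal c / (qU M \<rho> x y * ennreal (\<rho> x y powr (s * q))))"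
  shows "ennreal (c * riesz s q x y) \<le> g" "g \<le> ennreal (dbl (2 * K)) * ennreal (c * riesz s q x y)"
proof -
  have "ennreal (c * riesz s q x y) \<le> g \<and> g \<le> ennreal (dbl (2 * K)) * ennreal (c * riesz s q x y)"
  proof (cases "y = x")
    case True then show ?thesis using c by (simp add: g_def)
  next
    case False
    obtain u where u: "qU M \<rho> x y = ennreal u" "0 < u" "u \<le> V x (\<rho> x y)" "V x (\<rho> x y) \<le> dbl (2 * K) * u"
      using qU_comparable[OF x y] False by blast
    have d: "0 < \<rho> x y" using dist_nonneg[OF x y] dist_eq_0[OF x y] False by auto
    define w where "w = \<rho> x y powr (s * q)"
    have w: "0 < w" using d by (simp add: w_def)
    have g: "g = ennreal (c / (u * w))"
      using False u w c by (simp add: g_def w_def[symmetric] divide_ennreal flip: ennreal_mult)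
    have V: "0 < V x (\<rho> x y)" using V_pos[OF x d] .
    have "c * riesz s q x y \<le> c / (u * w)"
      unfolding riesz_def w_def[symmetric] times_divide_eq_right mult_1_right
      using u w c V by (intro divide_left_mono mult_right_mono mult_pos_pos) auto
    moreover have "c / (u * w) \<le> dbl (2 * K) * (c * riesz s q x y)"
    proof -
      have "c / (u * w) \<le> c / ((V x (\<rho> x y) / dbl (2 * K)) * w)"
        using u w c V dbl_pos[of "2 * K"]
        by (intro divide_left_mono mult_right_mono mult_pos_pos divide_pos_pos) (auto simp: field_simps)
      also have "\<dots> = dbl (2 * K) * (c * riesz s q x y)"
        by (simp add: riesz_def w_def)
      finally show ?thesis .
    qed
    ultimately show ?thesis
      unfolding g using dbl_pos[of "2 * K"] c riesz_nonneg[of s q x y]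
      by (auto simp flip: ennreal_mult intro!: ennreal_leI)
  qed
  then show "ennreal (c * riesz s q x y) \<le> g" "g \<le> ennreal (dbl (2 * K)) * ennreal (c * riesz s q x y)" by auto
qed

lemma far_le_gagliardo:
  assumes x: "x \<in> space M" and q: "0 < q"
  shows "epowr (far s q f x) (1 / q) \<le> gagliardo M \<rho> s q f x"
  unfolding gagliardo_def far_def
proof (intro epowr_mono nn_integral_mono)
  fix y assume y: "y \<in> space M"
  have "ennreal (cmod (f x - f y) powr q * riesz s q x y) * indicator {y. 1 \<le> \<rho> x y} y
      \<le> ennreal (cmod (f x - f y) powr q * riesz s q x y)" by (simp add: indicator_def)
  also have "\<dots> \<le> (if y = x then 0 else ennreal (cmod (f x - f y) powr q) / (qU M \<rho> x y * ennreal (\<rho> x y powr (s * q))))"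
    by (rule gagliardo_integrand_bounds[OF x y]) auto
  finally show "ennreal (cmod (f x - f y) powr q * riesz s q x y) * indicator {y. 1 \<le> \<rho> x y} y \<le> \<dots>" .
qed (use q in auto)

text \<open>
  At distances below \<open>1\<close> the kernel decreases when \<open>s\<close> decreases, so a single finite Gagliardo functional
  controls all the near parts, and the factor \<open>s\<^sup>1\<^sup>/\<^sup>q\<close> removes them in the limit.
\<close>

lemma near_le_gagliardo:
  assumes x: "x \<in> space M" and q: "0 < q" and s: "s \<le> s0"
  shows "epowr (near s q f x) (1 / q) \<le> gagliardo M \<rho> s0 q f x"
  unfolding gagliardo_def near_def
proof (intro epowr_mono nn_integral_mono)
  fix y assume y: "y \<in> space M"
  have "ennreal (cmod (f x - f y) powr q * riesz s q x y) * indicator {y. \<rho> x y < 1} y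
      \<le> ennreal (cmod (f x - f y) powr q * riesz s0 q x y)"
  proof (cases "x \<noteq> y \<and> \<rho> x y < 1")
    case True
    have d: "0 < \<rho> x y" using dist_nonneg[OF x y] dist_eq_0[OF x y] True by auto
    have "\<rho> x y powr (s0 * q) \<le> \<rho> x y powr (s * q)"
      using d True s q by (intro powr_mono') auto
    then have "riesz s q x y \<le> riesz s0 q x y"
      unfolding riesz_def using d V_pos[OF x d] by (intro divide_left_mono mult_left_mono mult_pos_pos) auto
    then show ?thesis using True by (auto intro!: ennreal_leI mult_left_mono)
  qed (auto simp: indicator_def)
  also have "\<dots> \<le> (if y = x then 0 else ennreal (cmod (f x - f y) powr q) / (qU M \<rho> x y * ennreal (\<rho> x y powr (s0 * q))))"
    by (rule gagliardo_integrand_bounds[OF x y]) auto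
  finally show "ennreal (cmod (f x - f y) powr q * riesz s q x y) * indicator {y. \<rho> x y < 1} y \<le> \<dots>" .
qed (use q in auto)

lemma gagliardo_le:
  assumes x: "x \<in> space M" and q: "0 < q" and f: "f \<in> borel_measurable M"
  shows "gagliardo M \<rho> s q f x \<le> epowr (ennreal (dbl (2 * K)) * (near s q f x + far s q f x)) (1 / q)"
  unfolding gagliardo_def
proof (rule epowr_mono)
  note [measurable] = integrand_measurable[OF x f]
  let ?g = "\<lambda>y. if y = x then 0 else ennreal (cmod (f x - f y) powr q) / (qU M \<rho> x y * ennreal (\<rho> x y powr (s * q)))"
  let ?r = "\<lambda>y. ennreal (cmod (f x - f y) powr q * riesz s q x y)"
  have "(\<integral>\<^sup>+y. ?g y \<partial>M)
    \<le> (\<integral>\<^sup>+y. ennreal (dbl (2 * K)) * (?r y * indicator {y. \<rho> x y < 1} y +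
        ?r y * indicator {y. 1 \<le> \<rho> x y} y) \<partial>M)"
  proof (intro nn_integral_mono)
    fix y assume y: "y \<in> space M"
    have "?g y
      \<le> ennreal (dbl (2 * K)) * ?r y"
      by (rule gagliardo_integrand_bounds[OF x y]) auto
    also have "\<dots> = ennreal (dbl (2 * K)) * (?r y * indicator {y. \<rho> x y < 1} y +
        ?r y * indicator {y. 1 \<le> \<rho> x y} y)"
      by (simp add: indicator_def)
    finally show "?g y \<le> \<dots>" .
  qed
  also have "\<dots> = ennreal (dbl (2 * K)) * (near s q f x + far s q f x)"
    unfolding near_def far_def by (simp add: nn_integral_cmult nn_integral_add)
  finally show "(\<integral>\<^sup>+y. ?g y \<partial>M) \<le> \<dots>" .
qed (use q in auto)

lemma far_diff_le:
  assumes x: "x \<in> space M" and q: "0 < q" and f: "f \<in> borel_measurable M" and g: "g \<in> borel_measurable M"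
  shows "far s q (\<lambda>x. f x - g x) x \<le> ennreal (2 powr q) * (far s q f x + far s q g x)"
proof -
  let ?a = "\<lambda>y. ennreal (cmod (f x - f y) powr q * riesz s q x y)"
  let ?b = "\<lambda>y. ennreal (cmod (g x - g y) powr q * riesz s q x y)"
  note [measurable] = integrand_measurable[OF x f] integrand_measurable[OF x g]
  have "far s q (\<lambda>x. f x - g x) x \<le> (\<integral>\<^sup>+y. ennreal (2 powr q) * (?a y * indicator {y. 1 \<le> \<rho> x y} y +
        ?b y * indicator {y. 1 \<le> \<rho> x y} y) \<partial>M)"
    unfolding far_def
  proof (intro nn_integral_mono)
    fix y
    have "cmod ((f x - g x) - (f y - g y)) powr q * riesz s q x y
        \<le> (2 powr q * (cmod (f x - f y) powr q + cmod (g x - g y) powr q)) * riesz s q x y"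
      using norm_diff_powr_le[OF q, of "f x - f y" "g x - g y"]
      by (intro mult_right_mono riesz_nonneg) (simp add: algebra_simps)
    then have "ennreal (cmod ((f x - g x) - (f y - g y)) powr q * riesz s q x y)
        \<le> ennreal (2 powr q * (cmod (f x - f y) powr q * riesz s q x y + cmod (g x - g y) powr q * riesz s q x y))"
      by (intro ennreal_leI) (simp add: algebra_simps)
    also have "\<dots> = ennreal (2 powr q) * (?a y + ?b y)"
      using riesz_nonneg[of s q x y] by (simp add: ennreal_mult' )
    finally show "ennreal (cmod ((f x - g x) - (f y - g y)) powr q * riesz s q x y) * indicator {y. 1 \<le> \<rho> x y} y
       \<le> ennreal (2 powr q) * (?a y * indicator {y. 1 \<le> \<rho> x y} y +
        ?b y * indicator {y. 1 \<le> \<rho> x y} y)"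
      by (auto simp: indicator_def)
  qed
  also have "\<dots> = ennreal (2 powr q) * (far s q f x + far s q g x)"
    unfolding far_def by (simp add: nn_integral_cmult nn_integral_add)
  finally show ?thesis .
qed

text \<open>
  From \<open>\<bar>f x - f y\<bar>\<^sup>q \<le> 2\<^sup>q (\<bar>f x\<bar>\<^sup>q + \<bar>f y\<bar>\<^sup>q)\<close> the far part is dominated by \<open>\<bar>f x\<bar>\<^sup>q\<close>, times the mass of the
  kernel, and by an averaging operator applied to \<open>\<bar>f\<bar>\<^sup>q\<close>. Jensen's inequality raises the exponent \<open>q\<close> to \<open>p\<close>,
  at which averaging operators are known to be bounded.
\<close>

lemma far_pointwise_bound:
  assumes q: "0 < q" and qp: "q \<le> p"
  obtains c where "0 < c"
    "\<And>s f x. 0 < s \<Longrightarrow> s < 1 \<Longrightarrow> f \<in> borel_measurable M \<Longrightarrow> x \<in> space M \<Longrightarrow>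
      epowr (ennreal s * far s q f x) (1 / q) \<le>
      ennreal c * (ennreal (cmod (f x)) + epowr (avg_op M idx (weight s q) cell (\<lambda>y. epowr (ennreal (cmod (f y))) p) x) (1 / p))"
proof -
  define A where "A = mass_bound q"
  have A: "1 \<le> A" using mass_bound_ge_1[OF q] by (simp add: A_def)
  define D where "D = dbl (K * (1 + 3 * K))"
  have D: "0 < D" unfolding D_def by (rule dbl_pos)
  define b where "b = D * 2 powr q * (1 + A)"
  have b: "0 < b" using D A by (simp add: b_def)
  define c where "c = b powr (1 / q) * 2 powr (1 / q)"
  have c: "0 < c" using b by (simp add: c_def)
  show thesis
  proof (rule that[OF c])
    fix s :: real and f :: "'a \<Rightarrow> complex" and x assume s: "0 < s" "s < 1" and f [measurable]: "f \<in> borel_measurable M" and x: "x \<in> space M"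
    let ?k = "avg_kernel idx (weight s q) cell x"
    let ?Tp = "avg_op M idx (weight s q) cell (\<lambda>y. epowr (ennreal (cmod (f y))) p) x"
    note [measurable] = integrand_measurable[OF x f] measurable_avg_kernel[OF idx_countable cell_sets]
    have mass: "(\<integral>\<^sup>+y. ?k y \<partial>M) \<le> ennreal A"
      unfolding A_def by (subst avg_kernel_mass[OF idx_countable cell_sets]) (auto intro: weight_mass[OF x q s])
    let ?u = "\<lambda>y. epowr (ennreal (cmod (f y))) q"
    have "ennreal s * far s q f x = (\<integral>\<^sup>+y. ennreal s * (ennreal (cmod (f x - f y) powr q * riesz s q x y) * indicator {y. 1 \<le> \<rho> x y} y) \<partial>M)"
      unfolding far_def by (intro nn_integral_cmult[symmetric]) measurable
    also have "\<dots> \<le> (\<integral>\<^sup>+y. ennreal (D * 2 powr q) * (?u x * ?k y + ?u y * ?k y) \<partial>M)"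
    proof (intro nn_integral_mono)
      fix y assume y: "y \<in> space M"
      show "ennreal s * (ennreal (cmod (f x - f y) powr q * riesz s q x y) * indicator {y. 1 \<le> \<rho> x y} y)
        \<le> ennreal (D * 2 powr q) * (?u x * ?k y + ?u y * ?k y)"
      proof (cases "1 \<le> \<rho> x y")
        case True
        have "ennreal s * ennreal (cmod (f x - f y) powr q * riesz s q x y) = ennreal (cmod (f x - f y) powr q) * ennreal (s * riesz s q x y)"
          using s riesz_nonneg[of s q x y] by (simp add: mult_ac flip: ennreal_mult)
        also have "\<dots> \<le> ennreal (2 powr q * (cmod (f x) powr q + cmod (f y) powr q)) * (ennreal D * ?k y)"
          using kernel_le_avg_kernel[OF x y q s(1) True] norm_diff_powr_le[OF q, of "f x" "f y"]
          by (intro mult_mono ennreal_leI) (auto simp: riesz_def D_def)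
        also have "\<dots> = ennreal (D * 2 powr q) * (?u x * ?k y + ?u y * ?k y)"
          using D by (simp add: epowr_ennreal ennreal_mult algebra_simps)
        finally show ?thesis using True by simp
      qed simp
    qed
    also have "\<dots> = ennreal (D * 2 powr q) * (?u x * (\<integral>\<^sup>+y. ?k y \<partial>M) + (\<integral>\<^sup>+y. ?u y * ?k y \<partial>M))"
      by (simp add: nn_integral_cmult nn_integral_add)
    also have "\<dots> \<le> ennreal (D * 2 powr q) * (?u x * ennreal (1 + A) + ennreal (1 + A) * epowr (\<integral>\<^sup>+y. epowr (?u y) (p / q) * ?k y \<partial>M) (1 / (p / q)))"
    proof (intro mult_left_mono add_mono)
      show "(\<integral>\<^sup>+y. ?k y \<partial>M) \<le> ennreal (1 + A)" using mass by (rule order_trans) (simp add: ennreal_leI)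
      show "(\<integral>\<^sup>+y. ?u y * ?k y \<partial>M) \<le> ennreal (1 + A) * epowr (\<integral>\<^sup>+y. epowr (?u y) (p / q) * ?k y \<partial>M) (1 / (p / q))"
        using q qp A mass by (intro jensen_epowr) auto
    qed auto
    also have "(\<integral>\<^sup>+y. epowr (?u y) (p / q) * ?k y \<partial>M) = ?Tp"
      using q by (subst avg_op_eq_kernel[OF idx_countable cell_sets]) (auto simp: epowr_epowr)
    also have "ennreal (D * 2 powr q) * (?u x * ennreal (1 + A) + ennreal (1 + A) * epowr (?Tp) (1 / (p / q)))
      = ennreal b * (?u x + epowr (?Tp) (q / p))"
      using D A by (simp add: b_def ennreal_mult algebra_simps)
    finally have "epowr (ennreal s * far s q f x) (1 / q) \<le> epowr (ennreal b * (?u x + epowr (?Tp) (q / p))) (1 / q)"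
      using q by (intro epowr_mono) auto
    also have "\<dots> = ennreal (b powr (1 / q)) * epowr (?u x + epowr (?Tp) (q / p)) (1 / q)"
      by (rule epowr_cmult[OF b])
    also have "\<dots> \<le> ennreal (b powr (1 / q)) * (ennreal (2 powr (1 / q)) * (epowr (?u x) (1 / q) + epowr (epowr (?Tp) (q / p)) (1 / q)))"
      using q by (intro mult_left_mono epowr_add_le) auto
    also have "\<dots> = ennreal c * (ennreal (cmod (f x)) + epowr (?Tp) (1 / p))"
      using q by (simp add: c_def epowr_epowr ennreal_mult mult.assoc)
    finally show "epowr (ennreal s * far s q f x) (1 / q) \<le>
      ennreal c * (ennreal (cmod (f x)) + epowr (?Tp) (1 / p))" .
  qed
qed

text \<open>
  The estimate behind both the upper bound and the approximation argument for the lower bound: the far parts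
  are bounded on \<open>Y\<close>, uniformly in \<open>s\<close>.
\<close>

lemma far_norm_bound:
  assumes Y: "ball_quasi_banach_fs M \<rho> Y" and ep: "endpoint_bounded M \<rho> Y p"
    and q: "0 < q" and qp: "q \<le> p"
  obtains c where "0 < c"
    "\<And>s f. 0 < s \<Longrightarrow> s < 1 \<Longrightarrow> f \<in> borel_measurable M \<Longrightarrow>
      ext_norm M Y (\<lambda>x. epowr (ennreal s * far s q f x) (1 / q)) \<le> ennreal c * Y f"
proof -
  interpret Y: ball_quasi_banach M \<rho> Y by standard (rule Y)
  obtain KY where KY: "1 \<le> KY"
    and quasi: "\<And>f g. f \<in> borel_measurable M \<Longrightarrow> g \<in> borel_measurable M \<Longrightarrow> Y (\<lambda>x. f x + g x) \<le> ennreal KY * (Y f + Y g)"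
    using Y.quasi_triangle by metis
  obtain a where a: "0 < a" and pt: "\<And>s f x. 0 < s \<Longrightarrow> s < 1 \<Longrightarrow> f \<in> borel_measurable M \<Longrightarrow> x \<in> space M \<Longrightarrow>
      epowr (ennreal s * far s q f x) (1 / q) \<le>
      ennreal a * (ennreal (cmod (f x)) + epowr (avg_op M idx (weight s q) cell (\<lambda>y. epowr (ennreal (cmod (f y))) p) x) (1 / p))"
    by (rule far_pointwise_bound[OF q qp]) (erule that, assumption)
  have p: "0 < p" using q qp by simp
  obtain C where C: "0 < C" and avg: "\<And>(I :: (nat \<times> 'a) set) c S G. countable I \<Longrightarrow> (\<And>i. i \<in> I \<Longrightarrow> \<exists>z\<in>space M. \<exists>r>0. S i = qb z r) \<Longrightarrow>
      (\<And>x. x \<in> space M \<Longrightarrow> (\<integral>\<^sup>+i. c i * emeasure M (S i) * indicator (S i) x \<partial>count_space I) \<le> ennreal (mass_bound q)) \<Longrightarrow>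
      G \<in> borel_measurable M \<Longrightarrow>
      ext_norm M Y (\<lambda>x. epowr (avg_op M I c S (\<lambda>y. epowr (G y) p) x) (1 / p)) \<le> ennreal C * ext_norm M Y G"
  proof (rule avg_op_endpoint_bounded[OF doubling_space_axioms Y p ep mass_bound_ge_1[OF q], where 'i = "nat \<times> 'a"], goal_cases)
    case (1 C)
    show ?case by (rule 1(1)[OF 1(2)]) (rule 1(3); blast)
  qed
  define c where "c = a * KY * (1 + C)"
  show thesis
  proof (rule that[of c])
    show "0 < c" using a KY C by (simp add: c_def)
    fix s :: real and f :: "'a \<Rightarrow> complex" assume s: "0 < s" "s < 1" and f [measurable]: "f \<in> borel_measurable M"
    show "ext_norm M Y (\<lambda>x. epowr (ennreal s * far s q f x) (1 / q)) \<le> ennreal c * Y f"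
    proof (cases "Y f = top")
      case True
      then show ?thesis using a KY C by (simp add: c_def ennreal_mult_top)
    next
      case False
      let ?T = "\<lambda>x. epowr (avg_op M idx (weight s q) cell (\<lambda>y. epowr (ennreal (cmod (f y))) p) x) (1 / p)"
      have f1: "ext_norm M Y (\<lambda>x. ennreal (cmod (f x))) = Y f" by (rule Y.ext_norm_fun) measurable
      have T: "ext_norm M Y ?T \<le> ennreal C * Y f"
        using avg[OF idx_countable cell_ball, where c = "weight s q" and G = "\<lambda>y. ennreal (cmod (f y))"] weight_mass q s
        by (simp add: f1)
      then have Tfin: "ext_norm M Y ?T < top"
        using False by (intro le_less_trans[OF T]) (simp add: ennreal_mult_eq_top_iff less_top[symmetric])
      have "ext_norm M Y (\<lambda>x. epowr (ennreal s * far s q f x) (1 / q)) \<le> ext_norm M Y (\<lambda>x. ennreal a * (ennreal (cmod (f x)) + ?T x))"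
        using pt[OF s f] by (intro Y.ext_norm_mono AE_I2)
      also have "\<dots> = ennreal a * ext_norm M Y (\<lambda>x. ennreal (cmod (f x)) + ?T x)"
        by (rule Y.ext_norm_cmult[OF a])
      also have "\<dots> \<le> ennreal a * (ennreal KY * (Y f + ext_norm M Y ?T))"
        using KY False Tfin
        by (intro mult_left_mono Y.ext_norm_add_le[OF _ quasi, of "\<lambda>x. ennreal (cmod (f x))" ?T, unfolded f1])
          (simp_all add: less_top[symmetric])
      also have "\<dots> \<le> ennreal a * (ennreal KY * (Y f + ennreal C * Y f))"
        by (intro mult_left_mono add_left_mono T) auto
      also have "\<dots> = ennreal c * Y f"
        using a KY C by (simp add: c_def ennreal_mult distrib_right distrib_left mult.assoc)
      finally show ?thesis .
    qed
  qed
qed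

text \<open>
  The number \<open>C\<close> obtained here lies strictly between \<open>1\<close> and the bound for the lower limit, so that
  the inequality holds for all large radii.
\<close>

lemma reverse_doubling:
  assumes "weak_reverse_doubling M \<rho>"
  obtains x0 a C r0 where "x0 \<in> space M" "1 < a" "1 < C" "0 < r0"
    "\<And>r. r0 \<le> r \<Longrightarrow> C * V x0 r \<le> V x0 (a * r)"
proof -
  from assms obtain x0 a C where x0: "x0 \<in> space M" and a: "1 < a" and C: "1 < C" and
    lim: "ennreal C \<le> Liminf at_top (\<lambda>r::real. emeasure M (qb x0 (a * r)) / emeasure M (qb x0 r))"
    unfolding weak_reverse_doubling_def by blast
  define C1 where "C1 = (1 + C) / 2"
  have C1: "1 < C1" "C1 < C" using C by (auto simp: C1_def)
  have "ennreal C1 < ennreal C" using C1 by (intro ennreal_lessI) auto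
  then have "ennreal C1 < Liminf at_top (\<lambda>r::real. emeasure M (qb x0 (a * r)) / emeasure M (qb x0 r))"
    using lim by (rule less_le_trans)
  then have "\<forall>\<^sub>F r in at_top. ennreal C1 < emeasure M (qb x0 (a * r)) / emeasure M (qb x0 r)"
    by (rule less_LiminfD)
  then obtain r1 where r1: "\<And>r. r1 \<le> r \<Longrightarrow> ennreal C1 < emeasure M (qb x0 (a * r)) / emeasure M (qb x0 r)"
    unfolding eventually_at_top_linorder by blast
  show thesis
  proof (rule that[OF x0 a C1(1), of "max 1 r1"])
    fix r assume r: "max 1 r1 \<le> r"
    have V: "0 < V x0 r" using x0 r by (intro V_pos) auto
    have "ennreal C1 < ennreal (V x0 (a * r) / V x0 r)"
      using r1[of r] r V x0 by (simp add: emeasure_ball divide_ennreal)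
    then have "C1 < V x0 (a * r) / V x0 r" using C1 by (simp add: ennreal_less_iff)
    then show "C1 * V x0 r \<le> V x0 (a * r)" using V by (simp add: field_simps)
  qed simp
qed

text \<open>
  Let \<open>f\<close> be supported in a ball and let \<open>x\<close> be in it. Far away \<open>f y = 0\<close>, so the integrand there is \<open>\<bar>f x\<bar>\<^sup>q\<close>
  times the kernel. By reverse doubling each annulus about \<open>x0\<close> with radii \<open>a\<^sup>j R0\<close> and \<open>a\<^sup>j\<^sup>+\<^sup>1 R0\<close>
  has a fixed proportion of the measure of its outer ball, so the integral over it is at least a constant times
  \<open>(a\<^sup>j\<^sup>+\<^sup>1 R0) powr (- s q)\<close>. The sum over \<open>j\<close> is of order \<open>1 / s\<close>, and the factor \<open>R0 powr (- s q)\<close>, the only trace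
  of the size of the support, tends to \<open>1\<close>: the constant depends neither on \<open>f\<close> nor on its support.
\<close>

lemma far_lower_bound:
  assumes wrd: "weak_reverse_doubling M \<rho>" and q: "0 < q"
  obtains c where "0 < c"
    "\<And>x1 R. x1 \<in> space M \<Longrightarrow> \<forall>\<^sub>F s in at_right 0. \<forall>f. {y\<in>space M. f y \<noteq> 0} \<subseteq> qb x1 R \<longrightarrow>
      (\<forall>x\<in>space M. ennreal c * ennreal (cmod (f x)) \<le> epowr (ennreal s * far s q f x) (1 / q))"
proof -
  obtain x0 a C r0 where x0: "x0 \<in> space M" and a: "1 < a" and C: "1 < C" and r0: "0 < r0"
    and rd: "\<And>r. r0 \<le> r \<Longrightarrow> C * V x0 r \<le> V x0 (a * r)"
    by (rule reverse_doubling[OF wrd]) blast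
  define D where "D = dbl (K * (1 + 2 * K))"
  have D: "0 < D" unfolding D_def by (rule dbl_pos)
  define c0 where "c0 = (1 - 1 / C) / (2 * D * (q * ln a))"
  have c0: "0 < c0" unfolding c0_def using C D q a by simp
  show thesis
  proof (rule that[of "c0 powr (1 / q)"])
    show "0 < c0 powr (1 / q)" using c0 by simp
    fix x1 R1 assume x1: "x1 \<in> space M"
    define R where "R = max 1 (K * (\<rho> x0 x1 + R1))"
    have R: "0 < R" by (simp add: R_def)
    have supp: "qb x1 R1 \<subseteq> qb x0 R" by (rule ball_engulf[OF x0 x1 order_refl]) (simp add: R_def)
    \<comment> \<open>beyond \<open>R0\<close> reverse doubling holds, \<open>f\<close> vanishes, and all distances to the support are at least \<open>1\<close>\<close>
    define R0 where "R0 = max r0 (max R (K * (R + 1)))"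
    have R0: "r0 \<le> R0" "R \<le> R0" "K * (R + 1) \<le> R0" "0 < R0" using R by (auto simp: R0_def)
    define b where "b = 2 * K * a * R0"
    have b: "0 < b" using K1 a R0 by (simp add: b_def)
    have "((\<lambda>s. b powr (- (s * q))) \<longlongrightarrow> b powr (- (0 * q))) (at_right 0)"
      using b by (intro tendsto_intros) auto
    then have "\<forall>\<^sub>F s in at_right 0. 1 / 2 < b powr (- (s * q))"
      using b by (intro order_tendstoD(1)) auto
    moreover have "\<forall>\<^sub>F s in at_right (0::real). 0 < s" by (rule eventually_at_right_less)
    ultimately show "\<forall>\<^sub>F s in at_right 0. \<forall>f. {y\<in>space M. f y \<noteq> 0} \<subseteq> qb x1 R1 \<longrightarrow>
      (\<forall>x\<in>space M. ennreal (c0 powr (1 / q)) * ennreal (cmod (f x)) \<le> epowr (ennreal s * far s q f x) (1 / q))"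
    proof eventually_elim
      case (elim s)
      then have s: "0 < s" and half: "1 / 2 < b powr (- (s * q))" by auto
      show ?case
      proof (intro allI impI ballI)
        fix f :: "'a \<Rightarrow> complex" and x assume f: "{y\<in>space M. f y \<noteq> 0} \<subseteq> qb x1 R1" and x: "x \<in> space M"
        show "ennreal (c0 powr (1 / q)) * ennreal (cmod (f x)) \<le> epowr (ennreal s * far s q f x) (1 / q)"
        proof (cases "f x = 0")
          case False
          then have xR: "\<rho> x0 x < R" using f x supp by (auto simp: qball_def)
          define r where "r j = a ^ j * R0" for j :: nat
          have r_pos: "0 < r j" for j using a R0 by (simp add: r_def)
          have r_mono: "r i \<le> r j" if "i \<le> j" for i j
            unfolding r_def using a R0 that by (intro mult_right_mono power_increasing) auto
          have rR0: "R0 \<le> r j" for j using r_mono[of 0 j] by (simp add: r_def)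
          define ann where "ann j = qb x0 (r (Suc j)) - qb x0 (r j)" for j
          have ann [measurable]: "ann j \<in> sets M" for j unfolding ann_def using x0 by measurable
          have disj: "disjoint_family ann"
            unfolding disjoint_family_on_def
          proof (intro ballI impI equals0I)
            have *: "False" if "i < j" "y \<in> ann i \<inter> ann j" for i j y
              using that r_mono[of "Suc i" j] by (auto simp: ann_def qball_def)
            fix i j y assume "i \<noteq> j" "y \<in> ann i \<inter> ann j"
            then show False using *[of i j y] *[of j i y] by (cases "i < j") auto
          qed
          define t where "t j = 2 * K * r (Suc j)" for j
          have t_pos: "0 < t j" for j using K1 r_pos by (simp add: t_def)
          define g where "g j = cmod (f x) powr q / (D * V x0 (r (Suc j)) * t j powr (s * q))" for j
          have V0: "0 < V x0 (r j)" for j using x0 r_pos by (intro V_pos)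
          have g0: "0 \<le> g j" for j using D V0 by (simp add: g_def)
          have ptw: "ennreal (g j) \<le> ennreal (cmod (f x - f y) powr q * riesz s q x y) * indicator {y. 1 \<le> \<rho> x y} y"
            if y: "y \<in> ann j" for j y
          proof -
            have ys: "y \<in> space M" "\<rho> x0 y < r (Suc j)" "r j \<le> \<rho> x0 y" using y by (auto simp: ann_def qball_def)
            have "y \<notin> qb x0 R" using ys rR0[of j] R0 by (auto simp: qball_def)
            then have fy: "f y = 0" using f supp ys by auto
            have "K * (R + 1) \<le> \<rho> x0 y" using ys rR0[of j] R0 by linarith
            also have "\<dots> \<le> K * (\<rho> x0 x + \<rho> x y)" by (intro dist_triangle x0 x ys)
            finally have "R + 1 \<le> \<rho> x0 x + \<rho> x y" using K1 by simp
            then have far: "1 \<le> \<rho> x y" using xR by linarith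
            have "\<rho> x y \<le> K * (\<rho> x x0 + \<rho> x0 y)" by (intro dist_triangle x0 x ys)
            also have "\<dots> \<le> K * (r (Suc j) + r (Suc j))"
              using K1 xR ys rR0[of "Suc j"] R0 dist_sym[OF x x0] by (intro mult_left_mono add_mono) auto
            finally have le_t: "\<rho> x y \<le> t j" by (simp add: t_def)
            have "V x (\<rho> x y) \<le> V x0 (K * (1 + 2 * K) * r (Suc j))"
            proof (intro V_mono x x0 ball_engulf)
              show "\<rho> x0 x \<le> r (Suc j)" using xR rR0[of "Suc j"] R0 by linarith
              have "r (Suc j) + \<rho> x y \<le> (1 + 2 * K) * r (Suc j)" using le_t by (simp add: t_def algebra_simps)
              then show "K * (r (Suc j) + \<rho> x y) \<le> K * (1 + 2 * K) * r (Suc j)"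
                using K1 by (simp add: mult.assoc)
            qed
            also have "\<dots> \<le> D * V x0 (r (Suc j))" unfolding D_def using x0 r_pos by (intro V_scale_le)
            finally have Vle: "V x (\<rho> x y) \<le> D * V x0 (r (Suc j))" .
            have Vx: "0 < V x (\<rho> x y)" using x far by (intro V_pos) auto
            have "g j \<le> cmod (f x) powr q / (V x (\<rho> x y) * \<rho> x y powr (s * q))"
              unfolding g_def using Vle Vx D V0 t_pos[of j] le_t far s q
              by (intro divide_left_mono mult_mono mult_pos_pos powr_mono2) auto
            then show ?thesis using far fy by (simp add: riesz_def ennreal_leI)
          qed
          have "ennreal (c0 * cmod (f x) powr q) \<le> ennreal s * far s q f x"
          proof -
            define d where "d = cmod (f x) powr q * ((1 - 1 / C) / D) * b powr (- (s * q))"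
            have d0: "0 \<le> d" using C D by (simp add: d_def)
            define \<beta> where "\<beta> = a powr (- (s * q))"
            have \<beta>: "0 < \<beta>" "\<beta> < 1" using a s q powr_less_mono[of "- (s * q)" 0 a] by (auto simp: \<beta>_def)
            have termj: "d * \<beta> ^ j \<le> g j * measure M (ann j)" for j
            proof -
              have "measure M (ann j) = V x0 (r (Suc j)) - V x0 (r j)"
                unfolding ann_def
              proof (rule measure_Diff)
                show "emeasure M (qb x0 (r (Suc j))) \<noteq> \<infinity>" using ball_finite[OF x0, of "r (Suc j)"] by simp
                show "qb x0 (r j) \<subseteq> qb x0 (r (Suc j))" using r_mono[of j "Suc j"] by (auto simp: qball_def)
              qed (use x0 in auto)
              moreover have "C * V x0 (r j) \<le> V x0 (r (Suc j))"
              proof -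
                have "r0 \<le> r j" using rR0[of j] R0 by linarith
                moreover have "a * r j = r (Suc j)" by (simp add: r_def)
                ultimately show ?thesis using rd[of "r j"] by simp
              qed
              moreover from this have "V x0 (r j) \<le> V x0 (r (Suc j)) / C"
                using C by (simp add: field_simps)
              ultimately have m: "(1 - 1 / C) * V x0 (r (Suc j)) \<le> measure M (ann j)"
                by (simp add: left_diff_distrib)
              have "t j = b * a ^ j" by (simp add: t_def r_def b_def)
              then have "t j powr (s * q) = b powr (s * q) * (a powr (s * q)) ^ j"
                using b a by (simp add: powr_mult powr_powr mult.commute flip: powr_realpow)
              then have "d * \<beta> ^ j = g j * ((1 - 1 / C) * V x0 (r (Suc j)))"
                using V0[of "Suc j"] D b a
                by (simp add: d_def g_def \<beta>_def powr_minus power_inverse field_simps)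
              also have "\<dots> \<le> g j * measure M (ann j)" by (intro mult_left_mono m g0)
              finally show ?thesis .
            qed
            have sums: "(\<lambda>j. d * \<beta> ^ j) sums (d * (1 / (1 - \<beta>)))"
              using \<beta> by (intro sums_mult geometric_sums) auto
            have "ennreal (d * (1 / (1 - \<beta>))) = (\<Sum>j. ennreal (d * \<beta> ^ j))"
              using sums d0 \<beta> by (subst suminf_ennreal2) (auto simp: sums_iff)
            also have "\<dots> \<le> (\<Sum>j. \<integral>\<^sup>+y. ennreal (g j) * indicator (ann j) y \<partial>M)"
            proof (intro suminf_le allI)
              fix j
              have "emeasure M (ann j) = ennreal (measure M (ann j))"
              proof (rule emeasure_eq_ennreal_measure)
                have "emeasure M (ann j) \<le> emeasure M (qb x0 (r (Suc j)))"
                  using x0 by (intro emeasure_mono) (auto simp: ann_def)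
                then show "emeasure M (ann j) \<noteq> top" using ball_finite[OF x0, of "r (Suc j)"] by (auto simp: top_unique)
              qed
              then have "(\<integral>\<^sup>+y. ennreal (g j) * indicator (ann j) y \<partial>M) = ennreal (g j * measure M (ann j))"
                using g0 by (simp add: nn_integral_cmult_indicator ennreal_mult)
              then show "ennreal (d * \<beta> ^ j) \<le> (\<integral>\<^sup>+y. ennreal (g j) * indicator (ann j) y \<partial>M)"
                using termj[of j] by (simp add: ennreal_leI)
            qed auto
            also have "\<dots> = (\<integral>\<^sup>+y. (\<Sum>j. ennreal (g j) * indicator (ann j) y) \<partial>M)"
              by (intro nn_integral_suminf[symmetric]) measurable
            also have "\<dots> \<le> far s q f x"
              unfolding far_def
            proof (rule nn_integral_mono)
              fix y
              show "(\<Sum>j. ennreal (g j) * indicator (ann j) y) \<le> ennreal (cmod (f x - f y) powr q * riesz s q x y) * indicator {y. 1 \<le> \<rho> x y} y"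
              proof (cases "\<exists>j. y \<in> ann j")
                case True
                then obtain j where j: "y \<in> ann j" by blast
                show ?thesis using ptw[OF j] suminf_cmult_indicator[OF disj j, of "\<lambda>j. ennreal (g j)"] by simp
              qed simp
            qed
            finally have *: "ennreal s * ennreal (d * (1 / (1 - \<beta>))) \<le> ennreal s * far s q f x"
              by (intro mult_left_mono) auto
            have "1 - \<beta> \<le> s * (q * ln a)"
            proof -
              have "\<beta> = exp (- (s * (q * ln a)))" using a by (simp add: \<beta>_def powr_def mult.assoc)
              then show ?thesis using exp_ge_add_one_self[of "- (s * (q * ln a))"] by simp
            qed
            then have "s / (s * (q * ln a)) \<le> s / (1 - \<beta>)" using \<beta> s q a by (intro divide_left_mono mult_pos_pos) auto
            then have "1 / (q * ln a) \<le> s / (1 - \<beta>)" using s by simp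
            then have "c0 * cmod (f x) powr q \<le> s * (d * (1 / (1 - \<beta>)))"
            proof -
              assume ge: "1 / (q * ln a) \<le> s / (1 - \<beta>)"
              have "c0 * cmod (f x) powr q = (cmod (f x) powr q * ((1 - 1 / C) / D) * (1 / 2)) * (1 / (q * ln a))"
                using C D q a by (simp add: c0_def field_simps)
              also have "\<dots> \<le> d * (s / (1 - \<beta>))"
                unfolding d_def using half ge C D q a by (intro mult_mono mult_nonneg_nonneg mult_left_mono divide_nonneg_nonneg) auto
              finally show ?thesis by (simp add: mult_ac)
            qed
            then show ?thesis using * s d0 \<beta> by (auto simp flip: ennreal_mult intro: order_trans[OF ennreal_leI])
          qed
          then have "epowr (ennreal (c0 * cmod (f x) powr q)) (1 / q) \<le> epowr (ennreal s * far s q f x) (1 / q)"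
            using q by (intro epowr_mono) auto
          moreover have "epowr (ennreal (c0 * cmod (f x) powr q)) (1 / q) = ennreal (c0 powr (1 / q)) * ennreal (cmod (f x))"
            using q c0 by (simp add: epowr_ennreal powr_mult powr_powr flip: ennreal_mult)
          ultimately show ?thesis by simp
        qed simp
      qed
    qed
  qed
qed

section \<open>The upper estimate\<close>

text \<open>
  The near part is bounded by the finite functional at \<open>s0\<close> and disappears after multiplication by
  \<open>s\<^sup>1\<^sup>/\<^sup>q\<close>; only the far part contributes to the upper limit.
\<close>

lemma limsup_upper_bound:
  assumes Y: "ball_quasi_banach_fs M \<rho> Y" and ep: "endpoint_bounded M \<rho> Y p"
    and q: "0 < q" and qp: "q \<le> p"
  obtains C where "0 < C"
    "\<And>f s0. f \<in> borel_measurable M \<Longrightarrow> 0 < s0 \<Longrightarrow> s0 < 1 \<Longrightarrow> Wnorm M \<rho> Y s0 q f < \<infinity> \<Longrightarrow>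
      Limsup (at_right 0) (\<lambda>s. ennreal (s powr (1 / q)) * Wnorm M \<rho> Y s q f) \<le> ennreal C * Y f"
proof -
  interpret Y: ball_quasi_banach M \<rho> Y by standard (rule Y)
  obtain KY where KY: "1 \<le> KY"
    and quasi: "\<And>f g. f \<in> borel_measurable M \<Longrightarrow> g \<in> borel_measurable M \<Longrightarrow> Y (\<lambda>x. f x + g x) \<le> ennreal KY * (Y f + Y g)"
    using Y.quasi_triangle by metis
  obtain c where c: "0 < c" and far: "\<And>s f. 0 < s \<Longrightarrow> s < 1 \<Longrightarrow> f \<in> borel_measurable M \<Longrightarrow>
      ext_norm M Y (\<lambda>x. epowr (ennreal s * far s q f x) (1 / q)) \<le> ennreal c * Y f"
    using far_norm_bound[OF Y ep q qp] by metis
  define D where "D = dbl (2 * K)"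
  have D: "0 < D" unfolding D_def by (rule dbl_pos)
  define b where "b = D powr (1 / q) * 2 powr (1 / q)"
  have b: "0 < b" using D by (simp add: b_def)
  show thesis
  proof (rule that[of "b * KY * c"])
    show "0 < b * KY * c" using b KY c by simp
    fix f :: "'a \<Rightarrow> complex" and s0 :: real
    assume f: "f \<in> borel_measurable M" and s0: "0 < s0" "s0 < 1" and W: "Wnorm M \<rho> Y s0 q f < \<infinity>"
    show "Limsup (at_right 0) (\<lambda>s. ennreal (s powr (1 / q)) * Wnorm M \<rho> Y s q f) \<le> ennreal (b * KY * c) * Y f"
    proof (cases "Y f = top")
      case True
      then show ?thesis using b KY c by (simp add: ennreal_mult_top)
    next
      case False
      let ?W0 = "Wnorm M \<rho> Y s0 q f"
      define R where "R s = ennreal (b * KY) * (ennreal (s powr (1 / q)) * ?W0 + ennreal c * Y f)" for s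
      have bound: "ennreal (s powr (1 / q)) * Wnorm M \<rho> Y s q f \<le> R s" if s: "0 < s" "s < s0" for s
      proof -
        have s1: "s < 1" using s s0 by simp
        have sp: "0 < s powr (1 / q)" using s by simp
        let ?g0 = "\<lambda>x. ennreal (s powr (1 / q)) * gagliardo M \<rho> s0 q f x"
        let ?ff = "\<lambda>x. epowr (ennreal s * far s q f x) (1 / q)"
        have pt: "ennreal (s powr (1 / q)) * gagliardo M \<rho> s q f x \<le> ennreal b * (?g0 x + ?ff x)" if x: "x \<in> space M" for x
        proof -
          have "gagliardo M \<rho> s q f x \<le> epowr (ennreal D * (near s q f x + far s q f x)) (1 / q)"
            unfolding D_def by (rule gagliardo_le[OF x q f])
          also have "\<dots> = ennreal (D powr (1 / q)) * epowr (near s q f x + far s q f x) (1 / q)"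
            by (rule epowr_cmult[OF D])
          also have "\<dots> \<le> ennreal (D powr (1 / q)) * (ennreal (2 powr (1 / q)) * (epowr (near s q f x) (1 / q) + epowr (far s q f x) (1 / q)))"
            using q by (intro mult_left_mono epowr_add_le) auto
          also have "\<dots> = ennreal b * (epowr (near s q f x) (1 / q) + epowr (far s q f x) (1 / q))"
            by (simp add: b_def ennreal_mult mult.assoc)
          also have "\<dots> \<le> ennreal b * (gagliardo M \<rho> s0 q f x + epowr (far s q f x) (1 / q))"
            using s by (intro mult_left_mono add_right_mono near_le_gagliardo x q) auto
          finally have "ennreal (s powr (1 / q)) * gagliardo M \<rho> s q f x \<le> ennreal (s powr (1 / q)) * (ennreal b * (gagliardo M \<rho> s0 q f x + epowr (far s q f x) (1 / q)))"
            by (intro mult_left_mono) auto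
          also have "\<dots> = ennreal b * (?g0 x + ennreal (s powr (1 / q)) * epowr (far s q f x) (1 / q))"
            by (simp add: distrib_left mult_ac)
          also have "ennreal (s powr (1 / q)) * epowr (far s q f x) (1 / q) = ?ff x"
            using s by (simp add: epowr_cmult)
          finally show ?thesis .
        qed
        have g0: "ext_norm M Y ?g0 = ennreal (s powr (1 / q)) * ?W0"
          unfolding Wnorm_def by (rule Y.ext_norm_cmult[OF sp])
        have "ennreal (s powr (1 / q)) * Wnorm M \<rho> Y s q f = ext_norm M Y (\<lambda>x. ennreal (s powr (1 / q)) * gagliardo M \<rho> s q f x)"
          unfolding Wnorm_def by (rule Y.ext_norm_cmult[OF sp, symmetric])
        also have "\<dots> \<le> ext_norm M Y (\<lambda>x. ennreal b * (?g0 x + ?ff x))"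
          using pt by (intro Y.ext_norm_mono AE_I2)
        also have "\<dots> = ennreal b * ext_norm M Y (\<lambda>x. ?g0 x + ?ff x)" by (rule Y.ext_norm_cmult[OF b])
        also have "\<dots> \<le> ennreal b * (ennreal KY * (ext_norm M Y ?g0 + ext_norm M Y ?ff))"
        proof (intro mult_left_mono Y.ext_norm_add_le[OF _ quasi])
          show "ext_norm M Y ?g0 < top" using W unfolding g0 by (simp add: ennreal_mult_less_top)
          show "ext_norm M Y ?ff < top"
            using False by (intro le_less_trans[OF far[OF s(1) s1 f]]) (simp add: ennreal_mult_eq_top_iff less_top[symmetric])
        qed (use KY in auto)
        also have "\<dots> \<le> ennreal b * (ennreal KY * (ext_norm M Y ?g0 + ennreal c * Y f))"
          by (intro mult_left_mono add_left_mono far[OF s(1) s1 f]) auto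
        also have "\<dots> = R s" using b KY unfolding g0 by (simp add: R_def ennreal_mult mult.assoc)
        finally show ?thesis .
      qed
      have "\<forall>\<^sub>F s in at_right 0. ennreal (s powr (1 / q)) * Wnorm M \<rho> Y s q f \<le> R s"
        using s0 bound by (auto simp: eventually_at_right_field intro!: exI[of _ s0])
      then have "Limsup (at_right 0) (\<lambda>s. ennreal (s powr (1 / q)) * Wnorm M \<rho> Y s q f) \<le> Limsup (at_right 0) R"
        by (rule Limsup_mono)
      also have "Limsup (at_right 0) R = ennreal (b * KY) * (ennreal 0 * ?W0 + ennreal c * Y f)"
      proof (rule lim_imp_Limsup)
        have "((\<lambda>s. s powr (1 / q)) \<longlongrightarrow> 0 powr (1 / q)) (at_right 0)"
          using q by (intro tendsto_powr' tendsto_ident_at tendsto_const) (auto simp: eventually_at_right_field intro!: exI[of _ 1])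
        then have "((\<lambda>s. s powr (1 / q)) \<longlongrightarrow> 0) (at_right 0)" by simp
        then have "((\<lambda>s. ?W0 * ennreal (s powr (1 / q))) \<longlongrightarrow> ?W0 * ennreal 0) (at_right 0)"
          using W by (intro ennreal_tendsto_cmult tendsto_ennrealI) auto
        then show "(R \<longlongrightarrow> ennreal (b * KY) * (ennreal 0 * ?W0 + ennreal c * Y f)) (at_right 0)"
          unfolding R_def by (intro ennreal_tendsto_cmult tendsto_add tendsto_const) (simp_all add: mult.commute)
      qed simp
      also have "\<dots> = ennreal (b * KY * c) * Y f"
        using b KY c by (simp add: ennreal_mult mult.assoc)
      finally show ?thesis .
    qed
  qed
qed

section \<open>The lower estimate\<close>

lemma far_norm_le_Wnorm:
  assumes Y: "ball_quasi_banach_fs M \<rho> Y" and q: "0 < q" and s: "0 < s"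
  shows "ext_norm M Y (\<lambda>x. epowr (ennreal s * far s q f x) (1 / q)) \<le> ennreal (s powr (1 / q)) * Wnorm M \<rho> Y s q f"
proof -
  interpret Y: ball_quasi_banach M \<rho> Y by standard (rule Y)
  have "ext_norm M Y (\<lambda>x. epowr (ennreal s * far s q f x) (1 / q)) \<le> ext_norm M Y (\<lambda>x. ennreal (s powr (1 / q)) * gagliardo M \<rho> s q f x)"
    using s by (intro Y.ext_norm_mono AE_I2) (auto simp: epowr_cmult intro!: mult_left_mono far_le_gagliardo q)
  also have "\<dots> = ennreal (s powr (1 / q)) * Wnorm M \<rho> Y s q f"
    unfolding Wnorm_def using s by (intro Y.ext_norm_cmult) simp
  finally show ?thesis .
qed

text \<open>
  For bounded support the pointwise lower bound for the far part suffices. For \<open>f\<close> in \<open>Y\<close>, absolute continuity of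
  the quasi-norm makes the truncations \<open>h n\<close> of \<open>f\<close> to balls converge. Only far parts are compared, never the full functionals:
  the far part of \<open>h n\<close> is controlled by those of \<open>f\<close> and of \<open>g n = f - h n\<close>, and the latter is bounded by the
  norm of \<open>g n\<close>. Near parts have to stay out of this argument, because truncation destroys the regularity of \<open>f\<close> and
  can make them infinite.
\<close>

lemma liminf_lower_bound:
  assumes Y: "ball_quasi_banach_fs M \<rho> Y" and wrd: "weak_reverse_doubling M \<rho>" and ep: "endpoint_bounded M \<rho> Y p"
    and q: "0 < q" and qp: "q \<le> p"
  obtains C where "0 < C"
    "\<And>f x1 R. f \<in> borel_measurable M \<Longrightarrow> x1 \<in> space M \<Longrightarrow> {y\<in>space M. f y \<noteq> 0} \<subseteq> qb x1 R \<Longrightarrow>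
      ennreal C * Y f \<le> Liminf (at_right 0) (\<lambda>s. ennreal (s powr (1 / q)) * Wnorm M \<rho> Y s q f)"
    "\<And>f. abs_cont_norm M Y \<Longrightarrow> f \<in> borel_measurable M \<Longrightarrow> Y f < \<infinity> \<Longrightarrow>
      ennreal C * Y f \<le> Liminf (at_right 0) (\<lambda>s. ennreal (s powr (1 / q)) * Wnorm M \<rho> Y s q f)"
proof -
  interpret Y: ball_quasi_banach M \<rho> Y by standard (rule Y)
  obtain KY where KY: "1 \<le> KY"
    and quasi: "\<And>f g. f \<in> borel_measurable M \<Longrightarrow> g \<in> borel_measurable M \<Longrightarrow> Y (\<lambda>x. f x + g x) \<le> ennreal KY * (Y f + Y g)"
    using Y.quasi_triangle by metis
  obtain c where c: "0 < c" and far: "\<And>s f. 0 < s \<Longrightarrow> s < 1 \<Longrightarrow> f \<in> borel_measurable M \<Longrightarrow>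
      ext_norm M Y (\<lambda>x. epowr (ennreal s * far s q f x) (1 / q)) \<le> ennreal c * Y f"
    using far_norm_bound[OF Y ep q qp] by metis
  obtain a where a: "0 < a" and low:
    "\<And>x1 R. x1 \<in> space M \<Longrightarrow> \<forall>\<^sub>F s in at_right 0. \<forall>f. {y\<in>space M. f y \<noteq> 0} \<subseteq> qb x1 R \<longrightarrow>
      (\<forall>x\<in>space M. ennreal a * ennreal (cmod (f x)) \<le> epowr (ennreal s * far s q f x) (1 / q))"
  proof (rule far_lower_bound[OF wrd q], goal_cases)
    case (1 c)
    show ?case by (rule 1(1)[OF 1(2)]) (rule 1(3))
  qed
  define FN where "FN s f = ext_norm M Y (\<lambda>x. epowr (ennreal s * far s q f x) (1 / q))" for s f
  have low_norm: "\<forall>\<^sub>F s in at_right 0. ennreal a * Y f \<le> FN s f"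
    if f [measurable]: "f \<in> borel_measurable M" and x1: "x1 \<in> space M" and supp: "{y\<in>space M. f y \<noteq> 0} \<subseteq> qb x1 R" for f x1 R
    using low[OF x1, of R]
  proof eventually_elim
    case (elim s)
    have "ennreal a * Y f = ennreal a * ext_norm M Y (\<lambda>x. ennreal (cmod (f x)))"
      by (subst Y.ext_norm_fun) auto
    also have "\<dots> = ext_norm M Y (\<lambda>x. ennreal a * ennreal (cmod (f x)))"
      by (rule Y.ext_norm_cmult[OF a, symmetric])
    also have "\<dots> \<le> FN s f"
      unfolding FN_def using elim supp by (intro Y.ext_norm_mono AE_I2) auto
    finally show ?case .
  qed
  define m where "m = 2 * 2 powr (1 / q) * KY"
  have m: "1 \<le> m" unfolding m_def using KY q ge_one_powr_ge_zero[of 2 "1 / q"] mult_mono[of 1 "2 * 2 powr (1 / q)" 1 KY] by simp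
  show thesis
  proof (rule that[of "a / m"])
    show "0 < a / m" using a m by simp
    have Cle: "ennreal (a / m) * z = ennreal (1 / m) * (ennreal a * z)" for z
      using a m by (simp add: mult.assoc[symmetric] flip: ennreal_mult)
    let ?W = "\<lambda>f s. ennreal (s powr (1 / q)) * Wnorm M \<rho> Y s q f"
    have pos: "\<forall>\<^sub>F s in at_right (0::real). 0 < s \<and> s < 1"
      by (auto simp: eventually_at_right_field intro!: exI[of _ 1])
    have FW: "\<forall>\<^sub>F s in at_right 0. FN s f \<le> ?W f s" for f
      using pos by eventually_elim (auto simp: FN_def intro!: far_norm_le_Wnorm Y q)
    {
      fix f :: "'a \<Rightarrow> complex" and x1 R assume f: "f \<in> borel_measurable M" "x1 \<in> space M" "{y\<in>space M. f y \<noteq> 0} \<subseteq> qb x1 R"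
      have "\<forall>\<^sub>F s in at_right 0. ennreal a * Y f \<le> ?W f s"
        using low_norm[OF f] FW[of f] by eventually_elim (rule order_trans)
      then have "ennreal a * Y f \<le> Liminf (at_right 0) (?W f)" by (rule Liminf_bounded)
      moreover have "ennreal (a / m) * Y f \<le> ennreal a * Y f"
        using a m by (intro mult_right_mono ennreal_leI) (auto simp: field_simps)
      ultimately show "ennreal (a / m) * Y f \<le> Liminf (at_right 0) (?W f)" by (rule order_trans[rotated])
    next
      fix f :: "'a \<Rightarrow> complex" assume ac: "abs_cont_norm M Y" and f [measurable]: "f \<in> borel_measurable M" and fin: "Y f < \<infinity>"
      obtain x0 where x0: "x0 \<in> space M" using space_nonempty by auto
      define B where "B n = qb x0 (real n)" for n
      define G where "G n = space M - B n" for n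
      have [measurable]: "B n \<in> sets M" for n unfolding B_def using x0 by measurable
      have [measurable]: "G n \<in> sets M" for n unfolding G_def by measurable
      have evB: "\<forall>\<^sub>F n in sequentially. x \<in> B n" if "x \<in> space M" for x
      proof -
        obtain n0 :: nat where "\<rho> x0 x < real n0" using reals_Archimedean2 by blast
        then show ?thesis using that by (auto simp: eventually_sequentially B_def qball_def intro!: exI[of _ n0])
      qed
      define g where "g n x = f x * indicator (G n) x" for n x
      define h where "h n x = f x - g n x" for n x
      have [measurable]: "g n \<in> borel_measurable M" "h n \<in> borel_measurable M" for n
        unfolding g_def h_def by measurable
      have d: "(\<lambda>n. Y (g n)) \<longlonglongrightarrow> 0"
      proof -
        have "AE x in M. (\<lambda>n. indicator (G n) x :: real) \<longlonglongrightarrow> 0"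
        proof (rule AE_I2)
          fix x assume "x \<in> space M"
          from evB[OF this] show "(\<lambda>n. indicator (G n) x :: real) \<longlonglongrightarrow> 0"
            by (intro tendsto_eventually) (auto elim!: eventually_mono simp: G_def)
        qed
        then show ?thesis
          using ac f fin unfolding abs_cont_norm_def g_def by (auto simp: fspace_def)
      qed
      have gle: "Y (g n) \<le> Y f" for n
        by (intro Y.norm_mono) (auto simp: g_def indicator_def)
      have hlim: "(\<lambda>n. Y (h n)) \<longlonglongrightarrow> Y f"
      proof -
        have "(\<lambda>n. Y (\<lambda>x. of_real (cmod (f x) * indicator (B n) x))) \<longlonglongrightarrow> Y (\<lambda>x. of_real (cmod (f x)))"
        proof (rule Y.norm_monotone_convergence)
          show "AE x in M. (\<forall>n. 0 \<le> cmod (f x) * indicator (B n) x) \<and> incseq (\<lambda>n. cmod (f x) * indicator (B n) x) \<and>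
              (\<lambda>n. cmod (f x) * indicator (B n) x) \<longlonglongrightarrow> cmod (f x)"
          proof (intro AE_I2 conjI allI)
            fix x assume x: "x \<in> space M"
            show "incseq (\<lambda>n. cmod (f x) * indicator (B n) x)"
              by (intro incseq_SucI mult_left_mono) (auto simp: B_def qball_def indicator_def)
            show "(\<lambda>n. cmod (f x) * indicator (B n) x) \<longlonglongrightarrow> cmod (f x)"
              by (intro tendsto_eventually eventually_mono[OF evB[OF x]]) simp
          qed auto
        qed measurable
        moreover have "Y (\<lambda>x. of_real (cmod (f x) * indicator (B n) x)) = Y (h n)" for n
          by (intro antisym Y.norm_mono) (auto simp: h_def g_def G_def indicator_def)
        moreover have "Y (\<lambda>x. of_real (cmod (f x))) = Y f" by (intro antisym Y.norm_mono) auto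
        ultimately show ?thesis by simp
      qed
      have split: "FN s (h n) \<le> ennreal m * (FN s f + FN s (g n))" if s: "0 < s" "s < 1" for s n
      proof -
        let ?F = "\<lambda>f x. epowr (ennreal s * far s q f x) (1 / q)"
        have pt: "?F (h n) x \<le> ennreal (2 * 2 powr (1 / q)) * (?F f x + ?F (g n) x)" if x: "x \<in> space M" for x
        proof -
          have "ennreal s * far s q (h n) x \<le> ennreal s * (ennreal (2 powr q) * (far s q f x + far s q (g n) x))"
            unfolding h_def[abs_def] by (intro mult_left_mono far_diff_le x q) auto
          also have "\<dots> = ennreal (2 powr q) * (ennreal s * far s q f x + ennreal s * far s q (g n) x)"
            by (simp add: distrib_left mult_ac)
          finally have "?F (h n) x \<le> epowr (ennreal (2 powr q) * (ennreal s * far s q f x + ennreal s * far s q (g n) x)) (1 / q)"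
            using q by (intro epowr_mono) auto
          also have "\<dots> = ennreal 2 * epowr (ennreal s * far s q f x + ennreal s * far s q (g n) x) (1 / q)"
            using q by (subst epowr_cmult) (auto simp: powr_powr)
          also have "\<dots> \<le> ennreal 2 * (ennreal (2 powr (1 / q)) * (?F f x + ?F (g n) x))"
            using q by (intro mult_left_mono epowr_add_le) auto
          also have "\<dots> = ennreal (2 * 2 powr (1 / q)) * (?F f x + ?F (g n) x)"
            by (simp only: ennreal_mult'' mult.assoc powr_ge_zero)
          finally show ?thesis .
        qed
        have "FN s (h n) \<le> ext_norm M Y (\<lambda>x. ennreal (2 * 2 powr (1 / q)) * (?F f x + ?F (g n) x))"
          unfolding FN_def using pt by (intro Y.ext_norm_mono AE_I2)
        also have "\<dots> = ennreal (2 * 2 powr (1 / q)) * ext_norm M Y (\<lambda>x. ?F f x + ?F (g n) x)"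
          by (rule Y.ext_norm_cmult) simp
        also have "\<dots> \<le> ennreal (2 * 2 powr (1 / q)) * (ennreal KY * (FN s f + FN s (g n)))"
          unfolding FN_def
        proof (intro mult_left_mono Y.ext_norm_add_le[OF _ quasi])
          show "ext_norm M Y (?F f) < top"
            using fin by (intro le_less_trans[OF far[OF s f]]) (simp add: ennreal_mult_less_top)
          have "Y (g n) < \<infinity>" using gle[of n] fin by (rule le_less_trans)
          then show "ext_norm M Y (?F (g n)) < top"
            by (intro le_less_trans[OF far[OF s]]) (simp_all add: ennreal_mult_less_top)
        qed (use KY in auto)
        also have "\<dots> = ennreal m * (FN s f + FN s (g n))"
          using KY ennreal_mult[of "2 * 2 powr (1 / q)" KY] by (simp add: m_def mult.assoc)
        finally show ?thesis .
      qed
      let ?L = "Liminf (at_right 0) (?W f)"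
      have step: "ennreal a * Y (h n) \<le> ennreal m * (?L + ennreal c * Y (g n))" for n
      proof -
        have "Y (g n) < \<infinity>" using gle[of n] fin by (rule le_less_trans)
        then obtain d where d: "Y (g n) = ennreal d" "0 \<le> d" by (cases "Y (g n)") auto
        have cd: "ennreal c * Y (g n) = ennreal (c * d)" using c d by (simp add: ennreal_mult)
        have hm: "h n \<in> borel_measurable M" by measurable
        have supp: "{y\<in>space M. h n y \<noteq> 0} \<subseteq> qb x0 (real n)"
          by (auto simp: h_def g_def G_def B_def indicator_def split: if_splits)
        have "\<forall>\<^sub>F s in at_right 0. ennreal a * Y (h n) \<le> ennreal m * (?W f s + ennreal (c * d))"
          using low_norm[OF hm x0 supp] FW[of f] pos
        proof eventually_elim
          case (elim s)
          have "ennreal a * Y (h n) \<le> FN s (h n)" using elim by simp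
          also have "\<dots> \<le> ennreal m * (FN s f + FN s (g n))" using elim by (intro split) auto
          also have "\<dots> \<le> ennreal m * (?W f s + ennreal c * Y (g n))"
            using elim far[of s "g n"] by (intro mult_left_mono add_mono) (auto simp: FN_def)
          finally show ?case by (simp add: cd)
        qed
        then show ?thesis unfolding cd using m by (intro le_cmult_Liminf_add) auto
      qed
      have "ennreal a * Y f \<le> ennreal m * (?L + ennreal c * 0)"
      proof (rule LIMSEQ_le)
        show "(\<lambda>n. ennreal a * Y (h n)) \<longlonglongrightarrow> ennreal a * Y f"
          using hlim by (intro ennreal_tendsto_cmult) auto
        show "(\<lambda>n. ennreal m * (?L + ennreal c * Y (g n)))
            \<longlonglongrightarrow> ennreal m * (?L + ennreal c * 0)"
          using d by (intro ennreal_tendsto_cmult tendsto_add tendsto_const) auto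
      qed (use step in auto)
      then have "ennreal (1 / m) * (ennreal a * Y f) \<le> ennreal (1 / m) * (ennreal m * ?L)"
        by (intro mult_left_mono) auto
      also have "\<dots> = ?L"
        using m by (simp add: mult.assoc[symmetric] flip: ennreal_mult)
      finally show "ennreal (a / m) * Y f \<le> ?L" by (simp only: Cle)
    }
  qed
qed

end

theorem theorem1p7:
  fixes M :: "'a measure" and \<rho> :: "'a \<Rightarrow> 'a \<Rightarrow> real"
    and Y :: "('a \<Rightarrow> complex) \<Rightarrow> ennreal" and p q :: real
  assumes "homogeneous_type M \<rho>"
    and "weak_reverse_doubling M \<rho>"
    and "0 < q" and "q \<le> p"
    and "ball_quasi_banach_fs M \<rho> Y"
    and "ball_banach_fs M \<rho> (convexif Y (1 / p))"
    and "endpoint_bounded M \<rho> Y p"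
  shows "\<exists>C C' :: real. 0 < C \<and> 0 < C' \<and>
    (\<forall>\<beta>>0. \<forall>f \<in> Cb (space M) \<rho> \<beta> \<inter> (\<Union>s\<in>{0<..<1}. Wdot M \<rho> Y s q).
       ennreal C * Y f
         \<le> Liminf (at_right 0) (\<lambda>s. ennreal (s powr (1 / q)) * Wnorm M \<rho> Y s q f) \<and>
       Liminf (at_right 0) (\<lambda>s. ennreal (s powr (1 / q)) * Wnorm M \<rho> Y s q f)
         \<le> Limsup (at_right 0) (\<lambda>s. ennreal (s powr (1 / q)) * Wnorm M \<rho> Y s q f) \<and>
       Limsup (at_right 0) (\<lambda>s. ennreal (s powr (1 / q)) * Wnorm M \<rho> Y s q f)
         \<le> ennreal C' * Y f) \<and>
    (abs_cont_norm M Y \<and> borel_semiregular M \<rho> \<longrightarrow>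
     (\<forall>f \<in> fspace M (mod_const_norm Y) \<inter> (\<Union>s\<in>{0<..<1}. Wdot M \<rho> Y s q).
       ennreal C * mod_const_norm Y f
         \<le> Liminf (at_right 0) (\<lambda>s. ennreal (s powr (1 / q)) * Wnorm M \<rho> Y s q f) \<and>
       Liminf (at_right 0) (\<lambda>s. ennreal (s powr (1 / q)) * Wnorm M \<rho> Y s q f)
         \<le> Limsup (at_right 0) (\<lambda>s. ennreal (s powr (1 / q)) * Wnorm M \<rho> Y s q f) \<and>
       Limsup (at_right 0) (\<lambda>s. ennreal (s powr (1 / q)) * Wnorm M \<rho> Y s q f)
         \<le> ennreal C' * mod_const_norm Y f))"
proof -
  obtain K L where "doubling_space M \<rho> K L"
    using homogeneous_type_doubling_space[OF assms(1)] .
  then interpret doubling_space M \<rho> K L .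
  let ?W = "\<lambda>f s. ennreal (s powr (1 / q)) * Wnorm M \<rho> Y s q f"
  obtain C' where C': "0 < C'" and up: "\<And>f s0. f \<in> borel_measurable M \<Longrightarrow> 0 < s0 \<Longrightarrow> s0 < 1 \<Longrightarrow>
      Wnorm M \<rho> Y s0 q f < \<infinity> \<Longrightarrow> Limsup (at_right 0) (?W f) \<le> ennreal C' * Y f"
  proof (rule limsup_upper_bound[OF assms(5,7,3,4)], goal_cases)
    case (1 c)
    show ?case by (rule 1(1)[OF 1(2)]) (rule 1(3))
  qed
  obtain C where C: "0 < C"
    and low1: "\<And>f x1 R. f \<in> borel_measurable M \<Longrightarrow> x1 \<in> space M \<Longrightarrow> {y\<in>space M. f y \<noteq> 0} \<subseteq> qb x1 R \<Longrightarrow>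
      ennreal C * Y f \<le> Liminf (at_right 0) (?W f)"
    and low2: "\<And>f. abs_cont_norm M Y \<Longrightarrow> f \<in> borel_measurable M \<Longrightarrow> Y f < \<infinity> \<Longrightarrow>
      ennreal C * Y f \<le> Liminf (at_right 0) (?W f)"
  proof (rule liminf_lower_bound[OF assms(5,2,7,3,4)], goal_cases)
    case (1 c)
    show ?case by (rule 1(1)[OF 1(2)]) (rule 1(3,4); assumption)+
  qed
  have mid: "Liminf (at_right 0) (?W f) \<le> Limsup (at_right 0) (?W f)" for f
    by (rule Liminf_le_Limsup) simp
  show ?thesis
  proof (rule exI[of _ C], rule exI[of _ C'], intro conjI C C' allI ballI impI mid)
    fix \<beta> :: real and f assume "0 < \<beta>" and f: "f \<in> Cb (space M) \<rho> \<beta> \<inter> (\<Union>s\<in>{0<..<1}. Wdot M \<rho> Y s q)"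
    then obtain s0 where s0: "0 < s0" "s0 < 1" "f \<in> borel_measurable M" "Wnorm M \<rho> Y s0 q f < \<infinity>"
      by (auto simp: Wdot_def)
    from f obtain x1 R where "x1 \<in> space M" "{y\<in>space M. f y \<noteq> 0} \<subseteq> qb x1 R"
      by (auto simp: Cb_def)
    then show "ennreal C * Y f \<le> Liminf (at_right 0) (?W f)" using s0 by (intro low1)
    show "Limsup (at_right 0) (?W f) \<le> ennreal C' * Y f" using s0 by (intro up)
  next
    fix f assume ac: "abs_cont_norm M Y \<and> borel_semiregular M \<rho>"
      and f: "f \<in> fspace M (mod_const_norm Y) \<inter> (\<Union>s\<in>{0<..<1}. Wdot M \<rho> Y s q)"
    then obtain s0 where s0: "0 < s0" "s0 < 1" "Wnorm M \<rho> Y s0 q f < \<infinity>"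
      and fm [measurable]: "f \<in> borel_measurable M"
      by (auto simp: Wdot_def)
    \<comment> \<open>Gagliardo functionals do not see additive constants, so the estimates for functions in \<open>Y\<close> apply to \<open>f + a\<close>\<close>
    have inv: "Wnorm M \<rho> Y s q (\<lambda>x. f x + of_real a) = Wnorm M \<rho> Y s q f" for s and a :: real
    proof -
      have "f x + of_real a - (f y + of_real a) = f x - f y" for x y by simp
      then show ?thesis by (simp only: Wnorm_def gagliardo_def[abs_def])
    qed
    from f have "mod_const_norm Y f < \<infinity>" by (simp add: fspace_def)
    then obtain a :: real where a: "Y (\<lambda>x. f x + of_real a) < \<infinity>"
      by (auto simp: mod_const_norm_def INF_less_iff)
    have "ennreal C * mod_const_norm Y f \<le> ennreal C * Y (\<lambda>x. f x + of_real a)"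
      unfolding mod_const_norm_def by (intro mult_left_mono INF_lower) auto
    also have "\<dots> \<le> Liminf (at_right 0) (?W (\<lambda>x. f x + of_real a))"
      using ac a by (intro low2) auto
    finally show "ennreal C * mod_const_norm Y f \<le> Liminf (at_right 0) (?W f)" by (simp add: inv)
    have "ennreal (1 / C') * Limsup (at_right 0) (?W f) \<le> mod_const_norm Y f"
      unfolding mod_const_norm_def
    proof (rule INF_greatest)
      fix a :: real
      have "Limsup (at_right 0) (?W f) \<le> ennreal C' * Y (\<lambda>x. f x + of_real a)"
        using up[of "\<lambda>x. f x + of_real a" s0] s0 by (simp add: inv)
      then have "ennreal (1 / C') * Limsup (at_right 0) (?W f) \<le> ennreal (1 / C') * (ennreal C' * Y (\<lambda>x. f x + of_real a))"
        by (intro mult_left_mono) auto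
      also have "\<dots> = Y (\<lambda>x. f x + of_real a)"
        using C' by (simp add: mult.assoc[symmetric] flip: ennreal_mult)
      finally show "ennreal (1 / C') * Limsup (at_right 0) (?W f) \<le> Y (\<lambda>x. f x + of_real a)" .
    qed
    then have "ennreal C' * (ennreal (1 / C') * Limsup (at_right 0) (?W f)) \<le> ennreal C' * mod_const_norm Y f"
      by (intro mult_left_mono) auto
    then show "Limsup (at_right 0) (?W f) \<le> ennreal C' * mod_const_norm Y f"
      using C' by (simp add: mult.assoc[symmetric] flip: ennreal_mult)
  qed
qed

end
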